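(* (i) Let $(G,\theta)$ be a measured group such that $\theta$ has a density with respect to left Haar measure belonging to $L^p_{\mathrm c}(G)$ for some $1<p\le+\infty$. Then Harnack's inequality holds: $\mathfrak{m}_\theta(g)<+\infty$ for all $g\in G$. (ii) There exists an admissible probability measure $\theta$ on the real affine group $G=\mathrm{Aff}(\mathbb{R})=\{x\mapsto ax+b: a>0,\ b\in\mathbb{R}\}$, whose Poisson boundary is $(\mathbb{R},\mu)$ for some probability measure $\mu$ on $\mathbb{R}$ (with the tautological action of $G$ on $\mathbb{R}$), such that every neighborhood of the identity in $G$ contains an element $g$ with $$\Big\Vert\frac{dg\mu}{d\mu}\Big\Vert_{L^\infty(\mu)}=+\infty .$$ In particular, this Poisson boundary is $\mathrm{SAT}$ but not $\mathrm{SAT}^{\ast}$, and $(G,\theta)$ fails Harnack's inequality (i.e. $\mathfrak{m}_\theta(g)=+\infty$ for some $g\in G$).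
   Context: A measured group $(G,\theta)$ is a locally compact second countable (lcsc) group $G$ with an admissible Borel probability measure $\theta$, i.e. $\theta$ is absolutely continuous with respect to Haar measure and is not supported on a closed proper subsemigroup of $G$ (equivalently $G=\overline{\bigcup_{n\ge1}\mathrm{supp}(\theta^{\ast n})}$). $L^p_{\mathrm c}(G)$ is the space of $L^p$ functions (with respect to left Haar measure) with compact support. A measurable $u:G\to\mathbb{R}$ is $\theta$-harmonic if $u\ast\theta=u$ pointwise, where $u\ast\theta(g)=\int_G u(gh)\,d\theta(h)$. Put $\mathbb{H}(G,\theta)=\{u:G\to\mathbb{R}_{>0}\text{ measurable}: u\ast\theta=u,\ u(e_G)=1\}$, and define the harmonic majorant $\mathfrak{m}_\theta:G\to[1,+\infty]$ by $\mathfrak{m}_\theta(g)=\sup\{u(g):u\in\mathbb{H}(G,\theta)\}$. A stationary $(G,\theta)$-space is a standard Borel space $X$ with a Borel action of $G$ and a Borel probability measure $\mu$ such that $\int_G g\mu\,d\theta(g)=\mu$, where $g\mu(A)=\mu(g^{-1}.A)$; then $g\mu\sim\mu$ for all $g\in G$. The Poisson boundary of $(G,\theta)$ is the stationary $(G,\theta)$-space $(\bm{B},\bm{\nu})$, unique up to isomorphism, for which the Poisson transform $L^\infty(\bm{\nu})\to\mathcal{H}^\infty(G,\theta)$, $f\mapsto\big(g\mapsto\int f(g.b)\,d\bm{\nu}(b)\big)$, onto the space of bounded $\theta$-harmonic functions with the supremum norm, is a surjective isometry. A space $(X,\mu)$ with $g\mu\sim\mu$ for all $g$ is $\mathrm{SAT}$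 if $\sup_{g\in G}g\mu(A)=1$ for every Borel set $A$ with $\mu(A)>0$; it is $\mathrm{SAT}^\ast$ if it is $\mathrm{SAT}$ and moreover $\Vert dg\mu/d\mu\Vert_{L^\infty(\mu)}<+\infty$ for all $g\in G$. *)

theory Defs
  imports "HOL-Probability.Probability" "HOL-Algebra.Group_Action"
begin

definition borel_of :: "'a topology \<Rightarrow> 'a measure" where
  "borel_of T = sigma (topspace T) {U. openin T U}"

definition lcsc_group :: "('g, 'm) monoid_scheme \<Rightarrow> 'g topology \<Rightarrow> bool" where
  "lcsc_group G T \<longleftrightarrow>
     group G \<and> topspace T = carrier G \<and>
     continuous_map (prod_topology T T) T (\<lambda>(x, y). x \<otimes>\<^bsub>G\<^esub> y) \<and>
     continuous_map T T (\<lambda>x. inv\<^bsub>G\<^esub> x) \<and>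
     Hausdorff_space T \<and> locally_compact_space T \<and> second_countable T"

text \<open>On an lcsc group every Borel measure that is finite on compact sets is regular,
  so regularity is not part of the definition.\<close>

definition left_haar_measure ::
    "('g, 'm) monoid_scheme \<Rightarrow> 'g topology \<Rightarrow> 'g measure \<Rightarrow> bool" where
  "left_haar_measure G T \<eta> \<longleftrightarrow>
     sets \<eta> = sets (borel_of T) \<and>
     emeasure \<eta> (space \<eta>) \<noteq> 0 \<and>
     (\<forall>K. compactin T K \<longrightarrow> emeasure \<eta> K < \<infinity>) \<and>
     (\<forall>g\<in>carrier G. \<forall>A\<in>sets \<eta>. emeasure \<eta> ((\<lambda>x. g \<otimes>\<^bsub>G\<^esub> x) ` A) = emeasure \<eta> A)"

text \<open>Left Haar measures are unique up to a scalar, so absolute continuity does not depend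
  on the choice of \<open>\<eta>\<close>.\<close>

definition admissible ::
    "('g, 'm) monoid_scheme \<Rightarrow> 'g topology \<Rightarrow> 'g measure \<Rightarrow> bool" where
  "admissible G T \<theta> \<longleftrightarrow>
     (\<exists>\<eta>. left_haar_measure G T \<eta> \<and> absolutely_continuous \<eta> \<theta>) \<and>
     \<not> (\<exists>S. closedin T S \<and> S \<subset> carrier G \<and> (\<forall>x\<in>S. \<forall>y\<in>S. x \<otimes>\<^bsub>G\<^esub> y \<in> S) \<and>
            emeasure \<theta> (carrier G - S) = 0)"

definition measured_group ::
    "('g, 'm) monoid_scheme \<Rightarrow> 'g topology \<Rightarrow> 'g measure \<Rightarrow> bool" where
  "measured_group G T \<theta> \<longleftrightarrow>
     lcsc_group G T \<and> sets \<theta> = sets (borel_of T) \<and> prob_space \<theta> \<and> admissible G T \<theta>"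

definition Linf_norm :: "'x measure \<Rightarrow> ('x \<Rightarrow> real) \<Rightarrow> ennreal" where
  "Linf_norm M f = esssup M (\<lambda>x. ennreal \<bar>f x\<bar>)"

definition Lp :: "ennreal \<Rightarrow> 'x measure \<Rightarrow> ('x \<Rightarrow> real) set" where
  "Lp p M = {f \<in> borel_measurable M.
     if p = \<infinity> then Linf_norm M f < \<infinity>
     else (\<integral>\<^sup>+ x. ennreal (\<bar>f x\<bar> powr enn2real p) \<partial>M) < \<infinity>}"

text \<open>Elements are representatives of classes modulo null sets, so the support condition is
  imposed almost everywhere.\<close>

definition Lp_compact :: "ennreal \<Rightarrow> 'g topology \<Rightarrow> 'g measure \<Rightarrow> ('g \<Rightarrow> real) set" where
  "Lp_compact p T M =
     {f \<in> Lp p M. \<exists>K. compactin T K \<and> (AE x in M. x \<notin> K \<longrightarrow> f x = 0)}"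

text \<open>Integrability has to be required explicitly: the Bochner integral of a non-integrable
  function is \<open>0\<close> by convention.\<close>

definition harmonic ::
    "('g, 'm) monoid_scheme \<Rightarrow> 'g topology \<Rightarrow> 'g measure \<Rightarrow> ('g \<Rightarrow> real) \<Rightarrow> bool" where
  "harmonic G T \<theta> u \<longleftrightarrow>
     u \<in> borel_measurable (borel_of T) \<and>
     (\<forall>g\<in>carrier G. integrable \<theta> (\<lambda>h. u (g \<otimes>\<^bsub>G\<^esub> h)) \<and>
                    (\<integral>h. u (g \<otimes>\<^bsub>G\<^esub> h) \<partial>\<theta>) = u g)"

definition positive_harmonic ::
    "('g, 'm) monoid_scheme \<Rightarrow> 'g topology \<Rightarrow> 'g measure \<Rightarrow> ('g \<Rightarrow> real) set" where
  "positive_harmonic G T \<theta> =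
     {u. harmonic G T \<theta> u \<and> (\<forall>g\<in>carrier G. 0 < u g) \<and> u \<one>\<^bsub>G\<^esub> = 1}"

definition harmonic_majorant ::
    "('g, 'm) monoid_scheme \<Rightarrow> 'g topology \<Rightarrow> 'g measure \<Rightarrow> 'g \<Rightarrow> ennreal" where
  "harmonic_majorant G T \<theta> g = (SUP u \<in> positive_harmonic G T \<theta>. ennreal (u g))"

definition harnack_inequality ::
    "('g, 'm) monoid_scheme \<Rightarrow> 'g topology \<Rightarrow> 'g measure \<Rightarrow> bool" where
  "harnack_inequality G T \<theta> \<longleftrightarrow> (\<forall>g\<in>carrier G. harmonic_majorant G T \<theta> g < \<infinity>)"

definition sup_norm :: "('g, 'm) monoid_scheme \<Rightarrow> ('g \<Rightarrow> real) \<Rightarrow> ennreal" where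
  "sup_norm G u = (SUP g \<in> carrier G. ennreal \<bar>u g\<bar>)"

definition bounded_harmonic ::
    "('g, 'm) monoid_scheme \<Rightarrow> 'g topology \<Rightarrow> 'g measure \<Rightarrow> ('g \<Rightarrow> real) set" where
  "bounded_harmonic G T \<theta> = {u. harmonic G T \<theta> u \<and> sup_norm G u < \<infinity>}"

definition standard_borel :: "'x measure \<Rightarrow> bool" where
  "standard_borel M \<longleftrightarrow>
     (\<exists>S. completely_metrizable_space S \<and> second_countable S \<and>
          space M = topspace S \<and> sets M = sets (borel_of S))"

text \<open>\<open>group_action\<close> maps into \<open>BijGroup (space M)\<close>, so each \<open>\<phi> g\<close> is a bijection of
  \<open>space M\<close> and, as a convention, \<open>undefined\<close> outside it.\<close>

definition borel_action ::
    "('g, 'm) monoid_scheme \<Rightarrow> 'g topology \<Rightarrow> 'x measure \<Rightarrow> ('g \<Rightarrow> 'x \<Rightarrow> 'x) \<Rightarrow> bool" where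
  "borel_action G T M \<phi> \<longleftrightarrow>
     group_action G (space M) \<phi> \<and> (\<lambda>(g, x). \<phi> g x) \<in> borel_of T \<Otimes>\<^sub>M M \<rightarrow>\<^sub>M M"

definition translate :: "('g \<Rightarrow> 'x \<Rightarrow> 'x) \<Rightarrow> 'g \<Rightarrow> 'x measure \<Rightarrow> 'x measure" where
  "translate \<phi> g \<mu> = distr \<mu> \<mu> (\<phi> g)"

definition stationary_space ::
    "('g, 'm) monoid_scheme \<Rightarrow> 'g topology \<Rightarrow> 'g measure \<Rightarrow>
     'x measure \<Rightarrow> ('g \<Rightarrow> 'x \<Rightarrow> 'x) \<Rightarrow> bool" where
  "stationary_space G T \<theta> \<mu> \<phi> \<longleftrightarrow>
     standard_borel \<mu> \<and> prob_space \<mu> \<and> borel_action G T \<mu> \<phi> \<and>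
     (\<forall>A\<in>sets \<mu>. (\<integral>\<^sup>+ g. emeasure (translate \<phi> g \<mu>) A \<partial>\<theta>) = emeasure \<mu> A)"

definition poisson_transform ::
    "('g \<Rightarrow> 'x \<Rightarrow> 'x) \<Rightarrow> 'x measure \<Rightarrow> ('x \<Rightarrow> real) \<Rightarrow> 'g \<Rightarrow> real" where
  "poisson_transform \<phi> \<nu> f g = (\<integral>b. f (\<phi> g b) \<partial>\<nu>)"

definition poisson_boundary ::
    "('g, 'm) monoid_scheme \<Rightarrow> 'g topology \<Rightarrow> 'g measure \<Rightarrow>
     'x measure \<Rightarrow> ('g \<Rightarrow> 'x \<Rightarrow> 'x) \<Rightarrow> bool" where
  "poisson_boundary G T \<theta> \<nu> \<phi> \<longleftrightarrow>
     measured_group G T \<theta> \<and> stationary_space G T \<theta> \<nu> \<phi> \<and>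
     (\<forall>f\<in>Lp \<infinity> \<nu>. poisson_transform \<phi> \<nu> f \<in> bounded_harmonic G T \<theta>) \<and>
     (\<forall>f\<in>Lp \<infinity> \<nu>. \<forall>f'\<in>Lp \<infinity> \<nu>.
        sup_norm G (\<lambda>g. poisson_transform \<phi> \<nu> f g - poisson_transform \<phi> \<nu> f' g) =
        Linf_norm \<nu> (\<lambda>x. f x - f' x)) \<and>
     (\<forall>u\<in>bounded_harmonic G T \<theta>. \<exists>f\<in>Lp \<infinity> \<nu>.
        \<forall>g\<in>carrier G. poisson_transform \<phi> \<nu> f g = u g)"

definition quasi_invariant ::
    "('g, 'm) monoid_scheme \<Rightarrow> ('g \<Rightarrow> 'x \<Rightarrow> 'x) \<Rightarrow> 'x measure \<Rightarrow> bool" where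
  "quasi_invariant G \<phi> \<mu> \<longleftrightarrow>
     (\<forall>g\<in>carrier G. absolutely_continuous \<mu> (translate \<phi> g \<mu>) \<and>
                    absolutely_continuous (translate \<phi> g \<mu>) \<mu>)"

definition RN_norm :: "('g \<Rightarrow> 'x \<Rightarrow> 'x) \<Rightarrow> 'x measure \<Rightarrow> 'g \<Rightarrow> ennreal" where
  "RN_norm \<phi> \<mu> g = esssup \<mu> (RN_deriv \<mu> (translate \<phi> g \<mu>))"

definition SAT ::
    "('g, 'm) monoid_scheme \<Rightarrow> ('g \<Rightarrow> 'x \<Rightarrow> 'x) \<Rightarrow> 'x measure \<Rightarrow> bool" where
  "SAT G \<phi> \<mu> \<longleftrightarrow> quasi_invariant G \<phi> \<mu> \<and>
     (\<forall>A\<in>sets \<mu>. emeasure \<mu> A > 0 \<longrightarrow>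
        (SUP g \<in> carrier G. emeasure (translate \<phi> g \<mu>) A) = 1)"

definition SAT_star ::
    "('g, 'm) monoid_scheme \<Rightarrow> ('g \<Rightarrow> 'x \<Rightarrow> 'x) \<Rightarrow> 'x measure \<Rightarrow> bool" where
  "SAT_star G \<phi> \<mu> \<longleftrightarrow> SAT G \<phi> \<mu> \<and> (\<forall>g\<in>carrier G. RN_norm \<phi> \<mu> g < \<infinity>)"

text \<open>The pair \<open>(a, b)\<close> stands for the map \<open>x \<mapsto> a * x + b\<close>; multiplication is composition.\<close>

definition aff :: "(real \<times> real) monoid" where
  "aff = \<lparr>carrier = {0<..} \<times> UNIV,
          mult = (\<lambda>(a, b) (c, d). (a * c, a * d + b)),
          one = (1, 0)\<rparr>"

definition aff_topology :: "(real \<times> real) topology" where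
  "aff_topology = top_of_set ({0<..} \<times> UNIV)"

definition aff_action :: "real \<times> real \<Rightarrow> real \<Rightarrow> real" where
  "aff_action = (\<lambda>(a, b) x. a * x + b)"

end

theory Submission
  imports Defs
begin

text \<open>
  Harnack's inequality. Let \<open>f\<close> be the density of \<open>\<theta>\<close>. By the inequality of arithmetic and geometric
  means, \<open>f(y\<^sub>1) \<cdots> f(y\<^sub>n)\<close> is at most the mean over \<open>j\<close> of the products over \<open>i \<noteq> j\<close> of
  \<open>f(y\<^sub>i)\<close> to the power \<open>n/(n-1)\<close>; integrating, some convolution power of \<open>\<theta>\<close> is bounded by a multiple
  of Haar measure. Conversely, \<open>\<theta> * \<theta>\<close> dominates a multiple of Haar measure on an open set (Steinhaus),
  so by admissibility every point has a neighbourhood on which some convolution power does. Comparing both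
  bounds on a compact set, \<open>u(g)\<close> is at most a constant times \<open>u(1)\<close> for positive harmonic \<open>u\<close>.

  The example. Let \<open>\<theta>\<close> be the law of \<open>x \<mapsto> A x + B\<close> with independent \<open>A\<close> and \<open>B\<close>, where \<open>log A\<close> is
  an asymmetric Laplace variable, \<open>|B|\<close> has the law of \<open>A\<close>, and the mean of \<open>A\<close> is 1/2; \<open>\<mu>\<close> is the law
  of \<open>B\<^sub>1 + A\<^sub>1 B\<^sub>2 + A\<^sub>1 A\<^sub>2 B\<^sub>3 + \<cdots>\<close>. For bounded harmonic \<open>u\<close>, the integral of \<open>u(a,b)\<close> over \<open>b\<close> in an
  interval satisfies, up to an error \<open>O(a)\<close>, a mean value equation in \<open>a\<close> alone. For the Laplace law this
  is a linear differential equation, whose bounded solutions are constant up to \<open>O(a)\<close>. Hence the integrals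
  converge as \<open>a \<rightarrow> 0\<close>, and the limits define a function \<open>f\<close> on the line. The difference \<open>w\<close> of \<open>u\<close> and the
  Poisson transform of \<open>f\<close> has interval integrals \<open>O(a)\<close>; since \<open>A\<close> has mean 1/2, harmonicity
  improves the constant by a factor 1/2 at every step, so \<open>w = 0\<close>. Finally \<open>\<mu>(-e,e)\<close> is at least of order
  \<open>e\<close> to the power 2/3, which is much more than the measure of almost every translate of \<open>(-e,e)\<close>.
\<close>

section \<open>Haar measure on an lcsc group\<close>

text \<open>In part (i) a positive harmonic function need not be integrable against Haar measure.
  Compact support of the density helps twice: it bounds the modular function, which appears when a
  kernel is integrated over its starting point, and it confines n steps to a compact set, so that u
  can be cut off there. The exponent n/(n-1) tends to 1 and so drops below p for large n. The
  example has to give up compact support: its density with respect to Haar measure does lie in L^p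
  for 1 < p < 3/2. Two demands compete. The error O(a) and the factor 1/2 use first moments of A and
  |B|. The failure of Harnack's inequality uses mass near 0: the events A < e and |B| < e each have
  probability of order e^(1/3), so by independence they occur together with probability of order
  e^(2/3), whereas the translates of (-e,e) have measures whose Lebesgue integral is only 2e.
  Boundary values are found without martingale convergence: limits are taken only for integrals over
  intervals, with errors O(a) that do not depend on the interval, and pointwise statements are
  recovered at the end from the absolute continuity of \<theta>.\<close>

lemma space_borel_of [simp]: "space (borel_of T) = topspace T"
  unfolding borel_of_def by (rule space_measure_of) (auto dest: openin_subset)

lemma sets_borel_of: "sets (borel_of T) = sigma_sets (topspace T) {U. openin T U}"
  unfolding borel_of_def by (rule sets_measure_of) (auto dest: openin_subset)

lemma borel_of_open: "openin T U \<Longrightarrow> U \<in> sets (borel_of T)"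
  by (auto simp: sets_borel_of)

lemma borel_of_closed: "closedin T C \<Longrightarrow> C \<in> sets (borel_of T)"
proof -
  assume C: "closedin T C"
  then have "topspace T - C \<in> sets (borel_of T)"
    by (intro borel_of_open) auto
  then have "topspace T - (topspace T - C) \<in> sets (borel_of T)"
    by (metis sets.compl_sets space_borel_of)
  moreover have "topspace T - (topspace T - C) = C"
    using C closedin_subset by fastforce
  ultimately show ?thesis by simp
qed

lemma continuous_map_measurable:
  assumes "continuous_map S T f"
  shows "f \<in> borel_of S \<rightarrow>\<^sub>M borel_of T"
proof (rule measurable_sigma_sets[OF sets_borel_of])
  show "{U. openin T U} \<subseteq> Pow (topspace T)"
    by (auto dest: openin_subset)
  show "f \<in> space (borel_of S) \<rightarrow> topspace T"
    using assms by (auto simp: continuous_map)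
  fix U assume "U \<in> {U. openin T U}"
  then have "openin S {x \<in> topspace S. f x \<in> U}"
    using assms by (auto simp: continuous_map)
  moreover have "{x \<in> topspace S. f x \<in> U} = f -` U \<inter> space (borel_of S)"
    by auto
  ultimately show "f -` U \<inter> space (borel_of S) \<in> sets (borel_of S)"
    by (simp add: borel_of_open)
qed

text \<open>By second countability an open set of the product topology is a countable union of open
  rectangles, hence lies in the product sigma-algebra. Continuous maps of two variables, such as the
  multiplication, thereby become measurable on the product on which Fubini's theorem is
  applied.\<close>

lemma id_measurable_borel_of_prod:
  assumes "second_countable S" "second_countable T"
  shows "(\<lambda>x. x) \<in> borel_of S \<Otimes>\<^sub>M borel_of T \<rightarrow>\<^sub>M borel_of (prod_topology S T)"
proof (rule measurable_sigma_sets[OF sets_borel_of])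
  show "{U. openin (prod_topology S T) U} \<subseteq> Pow (topspace (prod_topology S T))"
    using openin_subset by blast
  show "(\<lambda>x. x) \<in> space (borel_of S \<Otimes>\<^sub>M borel_of T) \<rightarrow> topspace (prod_topology S T)"
    by (auto simp: space_pair_measure)
  fix U assume "U \<in> {U. openin (prod_topology S T) U}"
  then have U: "openin (prod_topology S T) U" by simp
  obtain \<B> where \<B>: "countable \<B>" "\<And>V. V \<in> \<B> \<Longrightarrow> openin S V"
    "\<And>W x. openin S W \<Longrightarrow> x \<in> W \<Longrightarrow> \<exists>V\<in>\<B>. x \<in> V \<and> V \<subseteq> W"
    using assms(1) unfolding second_countable_def by metis
  obtain \<C> where \<C>: "countable \<C>" "\<And>V. V \<in> \<C> \<Longrightarrow> openin T V"
    "\<And>W x. openin T W \<Longrightarrow> x \<in> W \<Longrightarrow> \<exists>V\<in>\<C>. x \<in> V \<and> V \<subseteq> W"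
    using assms(2) unfolding second_countable_def by metis
  define R where "R = {(V, W). V \<in> \<B> \<and> W \<in> \<C> \<and> V \<times> W \<subseteq> U}"
  have "countable R"
    by (rule countable_subset[of _ "\<B> \<times> \<C>"]) (auto simp: R_def \<B> \<C>)
  moreover have "U = (\<Union>(V, W)\<in>R. V \<times> W)"
  proof (intro equalityI subsetI)
    fix z assume z: "z \<in> U"
    obtain x y where xy: "z = (x, y)" by (cases z)
    obtain V W where VW: "openin S V" "openin T W" "x \<in> V" "y \<in> W" "V \<times> W \<subseteq> U"
      using U z unfolding openin_prod_topology_alt xy by metis
    obtain V' where V': "V' \<in> \<B>" "x \<in> V'" "V' \<subseteq> V" using \<B>(3) VW by metis
    obtain W' where W': "W' \<in> \<C>" "y \<in> W'" "W' \<subseteq> W" using \<C>(3) VW by metis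
    have "(V', W') \<in> R" using V' W' VW by (auto simp: R_def)
    then show "z \<in> (\<Union>(V, W)\<in>R. V \<times> W)" using V' W' xy by auto
  qed (auto simp: R_def)
  moreover have "(\<Union>(V, W)\<in>R. V \<times> W) \<in> sets (borel_of S \<Otimes>\<^sub>M borel_of T)"
    using \<open>countable R\<close>
    by (intro sets.countable_UN') (auto simp: R_def intro!: pair_measureI borel_of_open \<B>(2) \<C>(2))
  ultimately have "U \<in> sets (borel_of S \<Otimes>\<^sub>M borel_of T)" by simp
  then show "(\<lambda>x. x) -` U \<inter> space (borel_of S \<Otimes>\<^sub>M borel_of T) \<in> sets (borel_of S \<Otimes>\<^sub>M borel_of T)"
    by simp
qed

locale lcsc_haar =
  fixes G :: "('g, 'm) monoid_scheme" (structure) and T :: "'g topology" and \<eta> :: "'g measure"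
  assumes lcsc: "lcsc_group G T" and haar: "left_haar_measure G T \<eta>"
begin

sublocale group G using lcsc by (simp add: lcsc_group_def)

lemma topspace_eq: "topspace T = carrier G"
  and continuous_mult: "continuous_map (prod_topology T T) T (\<lambda>(x, y). x \<otimes> y)"
  and continuous_inv: "continuous_map T T (\<lambda>x. inv x)"
  and Hausdorff: "Hausdorff_space T" and locally_compact: "locally_compact_space T"
  and second_countable: "second_countable T"
  using lcsc by (auto simp: lcsc_group_def)

lemma sets_haar [measurable_cong]: "sets \<eta> = sets (borel_of T)"
  and haar_nonzero: "emeasure \<eta> (space \<eta>) \<noteq> 0"
  and haar_compact: "compactin T K \<Longrightarrow> emeasure \<eta> K < \<infinity>"
  and haar_image: "g \<in> carrier G \<Longrightarrow> A \<in> sets \<eta> \<Longrightarrow> emeasure \<eta> ((\<lambda>x. g \<otimes> x) ` A) = emeasure \<eta> A"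
  using haar by (auto simp: left_haar_measure_def)

lemma space_haar [simp]: "space \<eta> = carrier G"
  using sets_eq_imp_space_eq[OF sets_haar] topspace_eq by simp

lemma open_sets: "openin T U \<Longrightarrow> U \<in> sets \<eta>"
  by (simp add: sets_haar borel_of_open)

lemma compact_sets: "compactin T K \<Longrightarrow> K \<in> sets \<eta>"
  using compactin_imp_closedin[OF Hausdorff] by (simp add: sets_haar borel_of_closed)

lemma measurable_mult: "(\<lambda>(x, y). x \<otimes> y) \<in> \<eta> \<Otimes>\<^sub>M \<eta> \<rightarrow>\<^sub>M \<eta>"
proof -
  have "(\<lambda>p. case p of (x, y) \<Rightarrow> x \<otimes> y) \<in> borel_of T \<Otimes>\<^sub>M borel_of T \<rightarrow>\<^sub>M borel_of T"
    by (rule measurable_compose[OF id_measurable_borel_of_prod[OF second_countable second_countable]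
          continuous_map_measurable[OF continuous_mult]])
  then show ?thesis
    by (simp cong: measurable_cong_sets add: sets_haar sets_pair_measure_cong[OF sets_haar sets_haar])
qed

lemma measurable_mult' [measurable (raw)]:
  assumes [measurable]: "f \<in> M \<rightarrow>\<^sub>M \<eta>" "g \<in> M \<rightarrow>\<^sub>M \<eta>"
  shows "(\<lambda>x. f x \<otimes> g x) \<in> M \<rightarrow>\<^sub>M \<eta>"
  using measurable_compose[OF measurable_Pair[OF assms] measurable_mult] by simp

lemma measurable_inv: "(\<lambda>x. inv x) \<in> \<eta> \<rightarrow>\<^sub>M \<eta>"
  using continuous_map_measurable[OF continuous_inv]
  by (simp cong: measurable_cong_sets add: sets_haar)

lemma measurable_inv' [measurable (raw)]:
  assumes [measurable]: "f \<in> M \<rightarrow>\<^sub>M \<eta>"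
  shows "(\<lambda>x. inv (f x)) \<in> M \<rightarrow>\<^sub>M \<eta>"
  using measurable_compose[OF assms measurable_inv] by simp

lemma measurable_group_const [measurable]: "g \<in> carrier G \<Longrightarrow> (\<lambda>x. g) \<in> M \<rightarrow>\<^sub>M \<eta>"
  by simp

lemma haar_distr:
  assumes g: "g \<in> carrier G"
  shows "distr \<eta> \<eta> (\<lambda>x. g \<otimes> x) = \<eta>"
proof (rule measure_eqI)
  fix A assume "A \<in> sets (distr \<eta> \<eta> (\<lambda>x. g \<otimes> x))"
  then have A: "A \<in> sets \<eta>" by simp
  have sub: "A \<subseteq> carrier G" using sets.sets_into_space[OF A] by simp
  have "(\<lambda>x. g \<otimes> x) -` A \<inter> space \<eta> = (\<lambda>x. inv g \<otimes> x) ` A"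
  proof (intro equalityI subsetI)
    fix x assume "x \<in> (\<lambda>x. g \<otimes> x) -` A \<inter> space \<eta>"
    then have "x \<in> carrier G" "g \<otimes> x \<in> A" by auto
    moreover from this have "x = inv g \<otimes> (g \<otimes> x)" using g by (simp add: m_assoc[symmetric])
    ultimately show "x \<in> (\<lambda>x. inv g \<otimes> x) ` A" by blast
  next
    fix x assume "x \<in> (\<lambda>x. inv g \<otimes> x) ` A"
    then show "x \<in> (\<lambda>x. g \<otimes> x) -` A \<inter> space \<eta>" using g sub by (auto simp: m_assoc[symmetric])
  qed
  then show "emeasure (distr \<eta> \<eta> (\<lambda>x. g \<otimes> x)) A = emeasure \<eta> A"
    using A g by (subst emeasure_distr) (auto simp: haar_image)
qed simp

lemma haar_left:
  assumes g: "g \<in> carrier G" and [measurable]: "\<phi> \<in> borel_measurable \<eta>"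
  shows "(\<integral>\<^sup>+x. \<phi> (g \<otimes> x) \<partial>\<eta>) = (\<integral>\<^sup>+x. \<phi> x \<partial>\<eta>)"
proof -
  have "(\<integral>\<^sup>+x. \<phi> x \<partial>\<eta>) = (\<integral>\<^sup>+x. \<phi> x \<partial>distr \<eta> \<eta> (\<lambda>x. g \<otimes> x))"
    by (simp add: haar_distr[OF g])
  also have "\<dots> = (\<integral>\<^sup>+x. \<phi> (g \<otimes> x) \<partial>\<eta>)"
    using g by (intro nn_integral_distr) auto
  finally show ?thesis ..
qed

text \<open>One witness is chosen for each basis set that fits into a good open set; the countable
  basis then yields a countable cover.\<close>

lemma Lindelof_cover:
  assumes "S \<subseteq> carrier G" and "\<And>x. x \<in> S \<Longrightarrow> \<exists>U. openin T U \<and> x \<in> U \<and> P U"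
  obtains \<U> where "countable \<U>" "\<And>U. U \<in> \<U> \<Longrightarrow> openin T U \<and> P U" "S \<subseteq> \<Union>\<U>"
proof -
  obtain \<B> where \<B>: "countable \<B>" "\<And>V. V \<in> \<B> \<Longrightarrow> openin T V"
    "\<And>W x. openin T W \<Longrightarrow> x \<in> W \<Longrightarrow> \<exists>V\<in>\<B>. x \<in> V \<and> V \<subseteq> W"
    using second_countable unfolding second_countable_def by metis
  define \<C> where "\<C> = {V \<in> \<B>. \<exists>U. openin T U \<and> V \<subseteq> U \<and> P U}"
  have "\<forall>V\<in>\<C>. \<exists>U. openin T U \<and> V \<subseteq> U \<and> P U" by (simp add: \<C>_def)
  from bchoice[OF this] obtain h where h: "\<And>V. V \<in> \<C> \<Longrightarrow> openin T (h V) \<and> V \<subseteq> h V \<and> P (h V)"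
    by blast
  show ?thesis
  proof (rule that[of "h ` \<C>"])
    show "countable (h ` \<C>)" using \<B>(1) by (auto simp: \<C>_def intro!: countable_image)
    show "S \<subseteq> \<Union>(h ` \<C>)"
    proof
      fix x assume "x \<in> S"
      then obtain U where U: "openin T U" "x \<in> U" "P U" using assms(2) by blast
      then obtain V where "V \<in> \<B>" "x \<in> V" "V \<subseteq> U" using \<B>(3) by blast
      then have "V \<in> \<C>" using U by (auto simp: \<C>_def)
      then show "x \<in> \<Union>(h ` \<C>)" using h \<open>x \<in> V\<close> by blast
    qed
  qed (use h in auto)
qed

lemma open_subset: "openin T U \<Longrightarrow> U \<subseteq> carrier G"
  using openin_subset topspace_eq by blast

lemma compact_neighbourhood:
  assumes "x \<in> carrier G"
  obtains U K where "openin T U" "compactin T K" "x \<in> U" "U \<subseteq> K" "emeasure \<eta> U < \<infinity>"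
proof -
  have "\<exists>U K. openin T U \<and> compactin T K \<and> x \<in> U \<and> U \<subseteq> K"
    using locally_compact assms unfolding locally_compact_space_def topspace_eq by (rule bspec)
  then obtain U K where UK: "openin T U" "compactin T K" "x \<in> U" "U \<subseteq> K"
    by blast
  have "emeasure \<eta> U \<le> emeasure \<eta> K"
    using UK by (intro emeasure_mono compact_sets) simp_all
  then have "emeasure \<eta> U < \<infinity>"
    using haar_compact[OF UK(2)] by (rule le_less_trans)
  then show thesis using that UK by blast
qed

lemma finite_open_cover:
  obtains \<U> where "countable \<U>" "\<And>U. U \<in> \<U> \<Longrightarrow> openin T U \<and> emeasure \<eta> U < \<infinity>"
    "carrier G \<subseteq> \<Union>\<U>"
proof -
  have "\<exists>U. openin T U \<and> x \<in> U \<and> emeasure \<eta> U < \<infinity>" if "x \<in> carrier G" for x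
    using compact_neighbourhood[OF that] by metis
  from Lindelof_cover[of "carrier G" "\<lambda>U. emeasure \<eta> U < \<infinity>", OF order_refl this] that
  show thesis by blast
qed

sublocale haar: sigma_finite_measure \<eta>
proof
  obtain \<U> where \<U>: "countable \<U>" "\<And>U. U \<in> \<U> \<Longrightarrow> openin T U \<and> emeasure \<eta> U < \<infinity>"
    "carrier G \<subseteq> \<Union>\<U>" by (rule finite_open_cover) blast
  then show "\<exists>A. countable A \<and> A \<subseteq> sets \<eta> \<and> \<Union> A = space \<eta> \<and> (\<forall>a\<in>A. emeasure \<eta> a \<noteq> \<infinity>)"
    using open_subset by (intro exI[of _ \<U>]) (auto simp: less_top[symmetric] open_sets)
qed

sublocale haar2: pair_sigma_finite \<eta> \<eta> ..

lemma continuous_map_mult: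
  "continuous_map X T a \<Longrightarrow> continuous_map X T b \<Longrightarrow> continuous_map X T (\<lambda>x. a x \<otimes> b x)"
  using continuous_map_compose[OF continuous_map_pairedI continuous_mult] by (simp add: comp_def)

lemma continuous_quotient: "continuous_map (prod_topology T T) T (\<lambda>(x, y). x \<otimes> inv y)"
  using continuous_map_mult[OF continuous_map_fst
    continuous_map_compose[OF continuous_map_snd continuous_inv, unfolded comp_def]]
  by (simp add: case_prod_beta')

lemma open_translate:
  assumes "openin T U" "g \<in> carrier G" "h \<in> carrier G"
  shows "openin T {x \<in> carrier G. g \<otimes> x \<otimes> h \<in> U}"
proof -
  have "continuous_map T T (\<lambda>x. g \<otimes> x \<otimes> h)"
    using assms topspace_eq by (intro continuous_map_mult) (auto simp: continuous_map_const)
  then show ?thesis using assms(1) topspace_eq by (auto simp: continuous_map)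
qed

text \<open>Left translations move a nonempty open null set to a neighbourhood of any given point
  and preserve its measure. Countably many such translates would cover the group, so \<eta> would
  vanish.\<close>

lemma open_positive:
  assumes U: "openin T U" "U \<noteq> {}"
  shows "0 < emeasure \<eta> U"
proof (rule ccontr)
  assume "\<not> 0 < emeasure \<eta> U"
  then have 0: "emeasure \<eta> U = 0" by (auto simp: zero_less_iff_neq_zero)
  obtain u where u: "u \<in> U" using U by auto
  then have uG: "u \<in> carrier G" using U openin_subset topspace_eq by blast
  have "\<exists>V. openin T V \<and> x \<in> V \<and> emeasure \<eta> V = 0" if x: "x \<in> carrier G" for x
  proof (intro exI conjI)
    let ?g = "u \<otimes> inv x"
    let ?V = "{y \<in> carrier G. ?g \<otimes> y \<otimes> \<one> \<in> U}"
    show "openin T ?V" using U uG x by (intro open_translate) auto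
    show "x \<in> ?V" using u uG x by (simp add: m_assoc)
    have [measurable]: "U \<in> sets \<eta>" using U(1) by (rule open_sets)
    have "emeasure \<eta> ?V = (\<integral>\<^sup>+y. indicator U (?g \<otimes> y) \<partial>\<eta>)"
    proof -
      have "emeasure \<eta> ?V = (\<integral>\<^sup>+y. indicator ?V y \<partial>\<eta>)"
        using open_sets[OF \<open>openin T ?V\<close>] by (rule nn_integral_indicator[symmetric])
      also have "\<dots> = (\<integral>\<^sup>+y. indicator U (?g \<otimes> y) \<partial>\<eta>)"
        using x uG by (intro nn_integral_cong) (simp add: indicator_def)
      finally show ?thesis .
    qed
    also have "\<dots> = (\<integral>\<^sup>+y. indicator U y \<partial>\<eta>)" using x uG by (intro haar_left) auto
    finally show "emeasure \<eta> ?V = 0" using 0 by simp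
  qed
  from Lindelof_cover[of "carrier G" "\<lambda>U. emeasure \<eta> U = 0", OF order_refl this]
  obtain \<U> where \<U>: "countable \<U>" "\<And>U. U \<in> \<U> \<Longrightarrow> openin T U \<and> emeasure \<eta> U = 0"
    "carrier G \<subseteq> \<Union>\<U>" by blast
  have "\<Union>\<U> \<in> null_sets \<eta>"
    using \<U> by (intro null_sets_UN'[where N = "\<lambda>x. x", simplified]) (auto intro: null_setsI open_sets)
  moreover have "carrier G \<in> sets \<eta>" using sets.top[of \<eta>] by simp
  ultimately have "emeasure \<eta> (carrier G) = 0"
    using \<U>(3) by (metis null_setsD1 null_sets_subset)
  then show False using haar_nonzero by simp
qed

end

section \<open>The modular function\<close>

context lcsc_haar begin

lemma compact_mult_inv:
  assumes "compactin T K" "compactin T L"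
  shows "compactin T ((\<lambda>(x, y). x \<otimes> inv y) ` (K \<times> L))"
proof (rule image_compactin[OF _ continuous_quotient])
  show "compactin (prod_topology T T) (K \<times> L)" using assms by (simp add: compactin_Times)
qed

text \<open>The substitution \<open>(x, y) \<mapsto> (y x, x\<^sup>-\<^sup>1)\<close> preserves the product of Haar measures. This yields
  the modular function without the uniqueness theorem for Haar measure.\<close>

lemma haar_inverse:
  assumes [measurable]: "\<psi> \<in> borel_measurable \<eta>" "\<phi> \<in> borel_measurable \<eta>"
  shows "(\<integral>\<^sup>+x. \<psi> x \<partial>\<eta>) * (\<integral>\<^sup>+x. \<phi> x \<partial>\<eta>) = (\<integral>\<^sup>+x. \<phi> (inv x) * (\<integral>\<^sup>+y. \<psi> (y \<otimes> x) \<partial>\<eta>) \<partial>\<eta>)"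
proof -
  have "(\<integral>\<^sup>+x. \<psi> x \<partial>\<eta>) * (\<integral>\<^sup>+x. \<phi> x \<partial>\<eta>) = (\<integral>\<^sup>+x. \<psi> x * (\<integral>\<^sup>+y. \<phi> y \<partial>\<eta>) \<partial>\<eta>)"
    by (simp add: nn_integral_multc)
  also have "\<dots> = (\<integral>\<^sup>+x. \<psi> x * (\<integral>\<^sup>+y. \<phi> (inv x \<otimes> y) \<partial>\<eta>) \<partial>\<eta>)"
    by (intro nn_integral_cong) (simp add: haar_left)
  also have "\<dots> = (\<integral>\<^sup>+x. (\<integral>\<^sup>+y. \<psi> x * \<phi> (inv x \<otimes> y) \<partial>\<eta>) \<partial>\<eta>)"
    by (intro nn_integral_cong nn_integral_cmult[symmetric]) simp
  also have "\<dots> = (\<integral>\<^sup>+y. (\<integral>\<^sup>+x. \<psi> x * \<phi> (inv x \<otimes> y) \<partial>\<eta>) \<partial>\<eta>)"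
    by (intro haar2.Fubini') measurable
  also have "\<dots> = (\<integral>\<^sup>+y. (\<integral>\<^sup>+x. \<psi> (y \<otimes> x) * \<phi> (inv x) \<partial>\<eta>) \<partial>\<eta>)"
  proof (rule nn_integral_cong)
    fix y assume y: "y \<in> space \<eta>"
    have "(\<integral>\<^sup>+x. \<psi> x * \<phi> (inv x \<otimes> y) \<partial>\<eta>) = (\<integral>\<^sup>+x. \<psi> (y \<otimes> x) * \<phi> (inv (y \<otimes> x) \<otimes> y) \<partial>\<eta>)"
      using y by (intro haar_left[symmetric]) auto
    also have "\<dots> = (\<integral>\<^sup>+x. \<psi> (y \<otimes> x) * \<phi> (inv x) \<partial>\<eta>)"
      using y by (intro nn_integral_cong) (simp add: inv_mult_group m_assoc)
    finally show "(\<integral>\<^sup>+x. \<psi> x * \<phi> (inv x \<otimes> y) \<partial>\<eta>) = (\<integral>\<^sup>+x. \<psi> (y \<otimes> x) * \<phi> (inv x) \<partial>\<eta>)" .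
  qed
  also have "\<dots> = (\<integral>\<^sup>+x. (\<integral>\<^sup>+y. \<psi> (y \<otimes> x) * \<phi> (inv x) \<partial>\<eta>) \<partial>\<eta>)"
    by (intro haar2.Fubini') measurable
  also have "\<dots> = (\<integral>\<^sup>+x. \<phi> (inv x) * (\<integral>\<^sup>+y. \<psi> (y \<otimes> x) \<partial>\<eta>) \<partial>\<eta>)"
    by (intro nn_integral_cong) (simp add: nn_integral_cmult mult.commute)
  finally show ?thesis .
qed

text \<open>With A an open neighbourhood of 1 inside a compact set L, the number \<open>a x\<close>
  is the measure of A x^-1, and \<open>m\<close> is a/c with c = \<eta>(A). Comparing
  \<open>haar_inverse\<close> for the indicator of A and for its right translate by h, with second
  factors of equal integral, gives the factor a(h)/c for every integrand at once. Positivity and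
  local boundedness are read off from the measures of A x^-1.\<close>

lemma modular_exists:
  obtains m :: "'g \<Rightarrow> ennreal" where "\<And>h (\<phi> :: 'g \<Rightarrow> ennreal). h \<in> carrier G \<Longrightarrow> \<phi> \<in> borel_measurable \<eta> \<Longrightarrow>
      (\<integral>\<^sup>+x. \<phi> (x \<otimes> h) \<partial>\<eta>) = m h * (\<integral>\<^sup>+x. \<phi> x \<partial>\<eta>)"
    "\<And>h. h \<in> carrier G \<Longrightarrow> 0 < m h"
    "\<And>K. compactin T K \<Longrightarrow> \<exists>C<\<infinity>. \<forall>h\<in>K. m h \<le> C" "m \<in> borel_measurable \<eta>"
proof -
  obtain A L where A': "openin T A" "compactin T L" "\<one> \<in> A" "A \<subseteq> L" "emeasure \<eta> A < \<infinity>"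
    using compact_neighbourhood[OF one_closed] by metis
  then have AL: "openin T A" "A \<noteq> {}" "A \<subseteq> L" "compactin T L" "A \<subseteq> carrier G"
    using open_subset by auto
  have [measurable]: "A \<in> sets \<eta>" using AL(1) by (rule open_sets)
  define a where "a x = (\<integral>\<^sup>+y. indicator A (y \<otimes> x) \<partial>\<eta>)" for x
  have [measurable]: "a \<in> borel_measurable \<eta>" unfolding a_def by measurable
  define c where "c = emeasure \<eta> A"
  have c_pos: "0 < c" using open_positive AL by (simp add: c_def)
  have c_int: "(\<integral>\<^sup>+x. indicator A x \<partial>\<eta>) = c" by (simp add: c_def)
  have a_eq: "a x = emeasure \<eta> {y \<in> carrier G. \<one> \<otimes> y \<otimes> x \<in> A}" if "x \<in> carrier G" for x
  proof -
    have "a x = (\<integral>\<^sup>+y. indicator {y \<in> carrier G. \<one> \<otimes> y \<otimes> x \<in> A} y \<partial>\<eta>)"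
      unfolding a_def by (intro nn_integral_cong) (simp add: indicator_def)
    also have "\<dots> = emeasure \<eta> {y \<in> carrier G. \<one> \<otimes> y \<otimes> x \<in> A}"
      by (rule nn_integral_indicator, rule open_sets, rule open_translate) (use that AL in auto)
    finally show ?thesis .
  qed
  have a_pos: "0 < a x" if x: "x \<in> carrier G" for x
  proof -
    obtain z where z: "z \<in> A" using AL by blast
    then have "z \<in> carrier G" using AL by blast
    with z x have "z \<otimes> inv x \<in> {y \<in> carrier G. \<one> \<otimes> y \<otimes> x \<in> A}" by (simp add: m_assoc)
    then show ?thesis unfolding a_eq[OF x]
      using x AL by (intro open_positive open_translate) auto
  qed
  have a_bound: "\<exists>C<\<infinity>. \<forall>x\<in>K. a x \<le> C" if K: "compactin T K" for K
  proof (intro exI conjI ballI)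
    let ?M = "(\<lambda>(x, y). x \<otimes> inv y) ` (L \<times> K)"
    have M: "compactin T ?M" using K AL by (intro compact_mult_inv)
    show "emeasure \<eta> ?M < \<infinity>" by (rule haar_compact[OF M])
    fix x assume x: "x \<in> K"
    then have xG: "x \<in> carrier G" using K compactin_subset_topspace topspace_eq by blast
    \<comment> \<open>This set is A x^-1; for x in K it lies in the compact set L K^-1, whose
      measure bounds \<open>a\<close> on K.\<close>
    have "{y \<in> carrier G. \<one> \<otimes> y \<otimes> x \<in> A} \<subseteq> ?M"
    proof
      fix y assume y: "y \<in> {y \<in> carrier G. \<one> \<otimes> y \<otimes> x \<in> A}"
      then have "y = (y \<otimes> x) \<otimes> inv x" "y \<otimes> x \<in> L" using xG AL by (auto simp: m_assoc)
      then show "y \<in> ?M" using x by (intro image_eqI[of _ _ "(y \<otimes> x, x)"]) auto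
    qed
    then show "a x \<le> emeasure \<eta> ?M"
      unfolding a_eq[OF xG] using M by (intro emeasure_mono compact_sets)
  qed
  have a_fin: "a x < \<infinity>" if "x \<in> carrier G" for x
  proof -
    have "compactin T {x}" using that topspace_eq by (intro finite_imp_compactin) auto
    from a_bound[OF this] obtain C where "C < \<infinity>" "\<forall>y\<in>{x}. a y \<le> C" by blast
    then show ?thesis using le_less_trans[of "a x" C] by blast
  qed
  have c_fin: "c < \<infinity>" using A' by (simp add: c_def)
  have main: "c * (\<integral>\<^sup>+x. \<Phi> (x \<otimes> h) \<partial>\<eta>) = a h * (\<integral>\<^sup>+x. \<Phi> x \<partial>\<eta>)"
    if h: "h \<in> carrier G" and [measurable]: "\<Phi> \<in> borel_measurable \<eta>" for h \<Phi>
  proof -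
    \<comment> \<open>Dividing by \<open>a\<close> cancels the inner integral that
      \<open>haar_inverse\<close> produces.\<close>
    define \<rho> where "\<rho> y = \<Phi> y / a y" for y
    have [measurable]: "\<rho> \<in> borel_measurable \<eta>" unfolding \<rho>_def by measurable
    have \<rho>: "\<rho> y * a y = \<Phi> y" if "y \<in> carrier G" for y
      using a_pos[OF that] a_fin[OF that] unfolding \<rho>_def
      by (simp add: ennreal_divide_times mult.commute)
         (metis ennreal_mult_divide_eq less_irrefl mult.commute ennreal_times_divide)
    have 1: "c * (\<integral>\<^sup>+y. \<rho> (inv y) \<partial>\<eta>) = (\<integral>\<^sup>+x. \<Phi> x \<partial>\<eta>)"
    proof -
      have "c * (\<integral>\<^sup>+y. \<rho> (inv y) \<partial>\<eta>) = (\<integral>\<^sup>+x. \<rho> (inv (inv x)) * a x \<partial>\<eta>)"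
        unfolding a_def c_int[symmetric] by (rule haar_inverse) measurable
      also have "\<dots> = (\<integral>\<^sup>+x. \<Phi> x \<partial>\<eta>)"
        by (intro nn_integral_cong) (simp add: \<rho>)
      finally show ?thesis .
    qed
    have 2: "a h * (\<integral>\<^sup>+y. \<rho> (inv y) \<partial>\<eta>) = (\<integral>\<^sup>+x. \<Phi> (x \<otimes> h) \<partial>\<eta>)"
    proof -
      have "(\<integral>\<^sup>+y. \<rho> (inv y) \<partial>\<eta>) = (\<integral>\<^sup>+y. \<rho> (inv (inv h \<otimes> y)) \<partial>\<eta>)"
        using h by (intro haar_left[symmetric]) auto
      then have "a h * (\<integral>\<^sup>+y. \<rho> (inv y) \<partial>\<eta>)
          = (\<integral>\<^sup>+y. indicator A (y \<otimes> h) \<partial>\<eta>) * (\<integral>\<^sup>+y. \<rho> (inv (inv h \<otimes> y)) \<partial>\<eta>)"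
        by (simp add: a_def)
      also have "\<dots> = (\<integral>\<^sup>+x. \<rho> (inv (inv h \<otimes> inv x)) * (\<integral>\<^sup>+y. indicator A (y \<otimes> x \<otimes> h) \<partial>\<eta>) \<partial>\<eta>)"
        using h by (intro haar_inverse) auto
      also have "\<dots> = (\<integral>\<^sup>+x. \<Phi> (x \<otimes> h) \<partial>\<eta>)"
      proof (intro nn_integral_cong)
        fix x assume x: "x \<in> space \<eta>"
        have "(\<integral>\<^sup>+y. indicator A (y \<otimes> x \<otimes> h) \<partial>\<eta>) = a (x \<otimes> h)"
          unfolding a_def using x h by (intro nn_integral_cong) (simp add: m_assoc)
        moreover have "inv (inv h \<otimes> inv x) = x \<otimes> h" using x h by (simp add: inv_mult_group)
        ultimately show "\<rho> (inv (inv h \<otimes> inv x)) * (\<integral>\<^sup>+y. indicator A (y \<otimes> x \<otimes> h) \<partial>\<eta>) = \<Phi> (x \<otimes> h)"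
          using x h by (simp add: \<rho>)
      qed
      finally show ?thesis .
    qed
    show ?thesis unfolding 2[symmetric] 1[symmetric] by (simp add: ac_simps)
  qed
  show ?thesis
  proof (rule that[of "\<lambda>h. a h / c"])
    fix h and \<phi> :: "'g \<Rightarrow> ennreal" assume h: "h \<in> carrier G" "\<phi> \<in> borel_measurable \<eta>"
    have "c * (\<integral>\<^sup>+x. \<phi> (x \<otimes> h) \<partial>\<eta>) / c = a h * (\<integral>\<^sup>+x. \<phi> x \<partial>\<eta>) / c" by (simp add: main[OF h])
    moreover have "c * (\<integral>\<^sup>+x. \<phi> (x \<otimes> h) \<partial>\<eta>) / c = (\<integral>\<^sup>+x. \<phi> (x \<otimes> h) \<partial>\<eta>)"
      using c_pos c_fin by (metis ennreal_mult_divide_eq less_irrefl mult.commute infinity_ennreal_def)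
    ultimately show "(\<integral>\<^sup>+x. \<phi> (x \<otimes> h) \<partial>\<eta>) = a h / c * (\<integral>\<^sup>+x. \<phi> x \<partial>\<eta>)"
      by (simp add: ennreal_divide_times ennreal_times_divide mult.commute)
  next
    fix h assume "h \<in> carrier G"
    then show "0 < a h / c" using a_pos c_fin by (simp add: ennreal_zero_less_divide)
  next
    fix K assume "compactin T K"
    from a_bound[OF this] obtain C where "C < \<infinity>" "\<forall>x\<in>K. a x \<le> C" by blast
    then show "\<exists>C<\<infinity>. \<forall>h\<in>K. a h / c \<le> C"
      using c_pos by (intro exI[of _ "C / c"]) (auto intro: divide_right_mono_ennreal simp: ennreal_divide_eq_top_iff less_top[symmetric])
  qed measurable
qed

section \<open>Harnack's inequality\<close>

primrec iter :: "('g \<Rightarrow> ennreal) list \<Rightarrow> ('g \<Rightarrow> ennreal) \<Rightarrow> 'g \<Rightarrow> ennreal" where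
  "iter [] \<psi> = \<psi>"
| "iter (k # ks) \<psi> = (\<lambda>g. \<integral>\<^sup>+h. iter ks \<psi> (g \<otimes> h) * k h \<partial>\<eta>)"

lemma iter_append: "iter (ks @ ls) \<psi> = iter ks (iter ls \<psi>)"
  by (induct ks) auto

lemma iter_measurable [measurable (raw)]:
  assumes "\<And>k. k \<in> set ks \<Longrightarrow> k \<in> borel_measurable \<eta>" "\<psi> \<in> borel_measurable \<eta>"
  shows "iter ks \<psi> \<in> borel_measurable \<eta>"
  using assms(1)
proof (induct ks)
  case (Cons k ks)
  then have [measurable]: "iter ks \<psi> \<in> borel_measurable \<eta>" "k \<in> borel_measurable \<eta>" by auto
  show ?case by simp
qed (simp add: assms)

lemma iter_mono:
  "(\<And>x. x \<in> carrier G \<Longrightarrow> \<phi> x \<le> \<psi> x) \<Longrightarrow> g \<in> carrier G \<Longrightarrow> iter ks \<phi> g \<le> iter ks \<psi> g"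
  by (induct ks arbitrary: g) (auto intro!: nn_integral_mono mult_right_mono)

lemma iter_cmult:
  assumes "\<And>k. k \<in> set ks \<Longrightarrow> k \<in> borel_measurable \<eta>" "\<psi> \<in> borel_measurable \<eta>" "g \<in> carrier G"
  shows "iter ks (\<lambda>x. c * \<psi> x) g = c * iter ks \<psi> g"
  using assms(1,3)
proof (induct ks arbitrary: g)
  case (Cons k ks)
  then have [measurable]: "iter ks \<psi> \<in> borel_measurable \<eta>" "k \<in> borel_measurable \<eta>"
    using assms(2) by (auto intro!: iter_measurable)
  show ?case using Cons
    by (simp add: nn_integral_cmult[symmetric] mult.assoc cong: nn_integral_cong_simp)
qed simp

lemma iter_translate:
  "g \<in> carrier G \<Longrightarrow> x \<in> carrier G \<Longrightarrow> iter ks \<psi> (g \<otimes> x) = iter ks (\<lambda>y. \<psi> (g \<otimes> y)) x"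
  by (induct ks arbitrary: x) (auto simp: m_assoc intro!: nn_integral_cong)

text \<open>The constants \<open>c\<close> absorb the values \<open>K j i h\<close> at the outermost variable in the induction.\<close>

lemma iter_geometric_mean:
  fixes K :: "nat \<Rightarrow> nat \<Rightarrow> 'g \<Rightarrow> real"
  assumes K [measurable]: "\<And>j i. K j i \<in> borel_measurable \<eta>" "\<And>j i x. 0 \<le> K j i x"
    and \<psi>: "\<psi> \<in> borel_measurable \<eta>" and n: "0 < n" and "g \<in> carrier G" "\<And>j. 0 \<le> c j"
  shows "ennreal (root n (\<Prod>j<n. c j)) * iter (map (\<lambda>i x. ennreal (root n (\<Prod>j<n. K j i x))) is) \<psi> g
    \<le> (\<Sum>j<n. ennreal (c j) * iter (map (\<lambda>i x. ennreal (K j i x)) is) \<psi> g)"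
  using assms(5,6)
proof (induct "is" arbitrary: g c)
  case Nil
  have "root n (\<Prod>j<n. c j) \<le> (\<Sum>j<n. c j) / n"
    using arith_geom_mean[of "{..<n}" c] Nil n
    by (auto simp: root_powr_inverse prod_nonneg sum_divide_distrib lessThan_empty_iff)
  also have "\<dots> \<le> (\<Sum>j<n. c j) / 1" using n by (intro divide_left_mono sum_nonneg Nil) auto
  finally have "ennreal (root n (\<Prod>j<n. c j)) \<le> (\<Sum>j<n. ennreal (c j))"
    using Nil by (simp add: sum_ennreal ennreal_leI)
  from mult_right_mono[OF this, of "\<psi> g"] show ?case by (simp add: sum_distrib_right)
next
  case (Cons i "is")
  have [measurable]: "iter (map (\<lambda>i x. ennreal (root n (\<Prod>j<n. K j i x))) is) \<psi> \<in> borel_measurable \<eta>"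
    using \<psi> by (intro iter_measurable) auto
  have [measurable]: "iter (map (\<lambda>i x. ennreal (K j i x)) is) \<psi> \<in> borel_measurable \<eta>" for j
    using \<psi> by (intro iter_measurable) auto
  have "ennreal (root n (\<Prod>j<n. c j)) * iter (map (\<lambda>i x. ennreal (root n (\<Prod>j<n. K j i x))) (i # is)) \<psi> g
      = (\<integral>\<^sup>+h. ennreal (root n (\<Prod>j<n. c j * K j i h)) *
          iter (map (\<lambda>i x. ennreal (root n (\<Prod>j<n. K j i x))) is) \<psi> (g \<otimes> h) \<partial>\<eta>)"
    using Cons(2,3) K n by (simp add: nn_integral_cmult[symmetric] prod.distrib real_root_mult
      ennreal_mult prod_nonneg ac_simps)
  also have "\<dots> \<le> (\<integral>\<^sup>+h. (\<Sum>j<n. ennreal (c j * K j i h) * iter (map (\<lambda>i x. ennreal (K j i x)) is) \<psi> (g \<otimes> h)) \<partial>\<eta>)"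
    using Cons(2,3) K by (intro nn_integral_mono Cons(1)) auto
  also have "\<dots> = (\<Sum>j<n. ennreal (c j) * iter (map (\<lambda>i x. ennreal (K j i x)) (i # is)) \<psi> g)"
    using Cons(2,3) K by (simp add: nn_integral_sum nn_integral_cmult[symmetric] ennreal_mult ac_simps)
  finally show ?case .
qed

end

section \<open>Densities of convolutions and the upper bound by Haar measure\<close>

context lcsc_haar begin

lemma inv_mult_cancel: "x \<in> carrier G \<Longrightarrow> y \<in> carrier G \<Longrightarrow> inv x \<otimes> (x \<otimes> y) = y"
  by (simp add: m_assoc[symmetric])

text \<open>Densities are convolved one step at a time: the substitution of x^-1 h for h moves the
  first step x from the test function into the kernel. The empty list stands for a point mass, which
  need not have a density.\<close>

lemma iter_density:
  assumes "ks \<noteq> []" "\<And>k. k \<in> set ks \<Longrightarrow> k \<in> borel_measurable \<eta>"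
  shows "\<exists>l\<in>borel_measurable \<eta>. \<forall>\<phi>\<in>borel_measurable \<eta>. \<forall>g\<in>carrier G.
    iter ks \<phi> g = (\<integral>\<^sup>+h. \<phi> (g \<otimes> h) * l h \<partial>\<eta>)"
  using assms
proof (induct ks rule: list_nonempty_induct)
  case (single k)
  then show ?case by (intro bexI[of _ k]) auto
next
  case (cons k ks)
  then obtain l where l [measurable]: "l \<in> borel_measurable \<eta>" and eq: "\<And>\<phi> g. \<phi> \<in> borel_measurable \<eta> \<Longrightarrow> g \<in> carrier G \<Longrightarrow>
    iter ks \<phi> g = (\<integral>\<^sup>+h. \<phi> (g \<otimes> h) * l h \<partial>\<eta>)" by auto
  have [measurable]: "k \<in> borel_measurable \<eta>" using cons by auto
  show ?case
  proof (intro bexI[of _ "\<lambda>h. \<integral>\<^sup>+x. l (inv x \<otimes> h) * k x \<partial>\<eta>"] ballI)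
    fix \<phi> :: "'g \<Rightarrow> ennreal" and g assume [measurable]: "\<phi> \<in> borel_measurable \<eta>" "g \<in> carrier G"
    then have g: "g \<in> carrier G" by auto
    have "iter (k # ks) \<phi> g = (\<integral>\<^sup>+x. (\<integral>\<^sup>+h. \<phi> (g \<otimes> x \<otimes> h) * l h \<partial>\<eta>) * k x \<partial>\<eta>)"
      unfolding iter.simps using g by (intro nn_integral_cong) (simp add: eq)
    also have "\<dots> = (\<integral>\<^sup>+x. (\<integral>\<^sup>+h. \<phi> (g \<otimes> h) * l (inv x \<otimes> h) \<partial>\<eta>) * k x \<partial>\<eta>)"
    proof (rule nn_integral_cong)
      fix x assume "x \<in> space \<eta>"
      then have x [measurable]: "x \<in> carrier G" by simp
      have "(\<integral>\<^sup>+h. \<phi> (g \<otimes> h) * l (inv x \<otimes> h) \<partial>\<eta>)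
          = (\<integral>\<^sup>+h. \<phi> (g \<otimes> (x \<otimes> h)) * l (inv x \<otimes> (x \<otimes> h)) \<partial>\<eta>)"
        using x g by (intro haar_left[symmetric]) auto
      also have "\<dots> = (\<integral>\<^sup>+h. \<phi> (g \<otimes> x \<otimes> h) * l h \<partial>\<eta>)"
        using x g by (intro nn_integral_cong) (simp add: m_assoc inv_mult_cancel)
      finally show "(\<integral>\<^sup>+h. \<phi> (g \<otimes> x \<otimes> h) * l h \<partial>\<eta>) * k x
          = (\<integral>\<^sup>+h. \<phi> (g \<otimes> h) * l (inv x \<otimes> h) \<partial>\<eta>) * k x" by simp
    qed
    also have "\<dots> = (\<integral>\<^sup>+x. (\<integral>\<^sup>+h. \<phi> (g \<otimes> h) * (l (inv x \<otimes> h) * k x) \<partial>\<eta>) \<partial>\<eta>)"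
      using g by (intro nn_integral_cong) (simp add: nn_integral_multc[symmetric] mult.assoc)
    also have "\<dots> = (\<integral>\<^sup>+h. (\<integral>\<^sup>+x. \<phi> (g \<otimes> h) * (l (inv x \<otimes> h) * k x) \<partial>\<eta>) \<partial>\<eta>)"
      using g by (intro haar2.Fubini') measurable
    also have "\<dots> = (\<integral>\<^sup>+h. \<phi> (g \<otimes> h) * (\<integral>\<^sup>+x. l (inv x \<otimes> h) * k x \<partial>\<eta>) \<partial>\<eta>)"
      using g by (intro nn_integral_cong nn_integral_cmult) auto
    finally show "iter (k # ks) \<phi> g = (\<integral>\<^sup>+h. \<phi> (g \<otimes> h) * (\<integral>\<^sup>+x. l (inv x \<otimes> h) * k x \<partial>\<eta>) \<partial>\<eta>)" .
  qed measurable
qed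

text \<open>The exponent is conjugate to \<open>n\<close>, so that \<open>f\<close> is the geometric mean of one constant 1 and
  \<open>n - 1\<close> copies of \<open>F\<close>.\<close>

lemma iter_le_haar:
  fixes f :: "'g \<Rightarrow> real"
  assumes [measurable]: "f \<in> borel_measurable \<eta>" and f: "\<And>x. 0 \<le> f x"
    and K: "compactin T K" "\<And>x. x \<in> carrier G \<Longrightarrow> x \<notin> K \<Longrightarrow> f x = 0"
    and n: "2 \<le> n" and fin: "(\<integral>\<^sup>+x. ennreal (f x powr (real n / (real n - 1))) \<partial>\<eta>) < \<infinity>"
  obtains C where "C < \<infinity>" "\<And>\<phi> g. \<phi> \<in> borel_measurable \<eta> \<Longrightarrow> g \<in> carrier G \<Longrightarrow>
    iter (replicate n (\<lambda>x. ennreal (f x))) \<phi> g \<le> C * (\<integral>\<^sup>+x. \<phi> x \<partial>\<eta>)"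
proof -
  define F where "F x = f x powr (real n / (real n - 1))" for x
  have [measurable]: "F \<in> borel_measurable \<eta>" unfolding F_def by measurable
  have F0: "0 \<le> F x" for x by (simp add: F_def)
  obtain m where m: "\<And>h (\<phi> :: 'g \<Rightarrow> ennreal). h \<in> carrier G \<Longrightarrow> \<phi> \<in> borel_measurable \<eta> \<Longrightarrow>
      (\<integral>\<^sup>+x. \<phi> (x \<otimes> h) \<partial>\<eta>) = m h * (\<integral>\<^sup>+x. \<phi> x \<partial>\<eta>)"
    "\<And>K. compactin T K \<Longrightarrow> \<exists>C<\<infinity>. \<forall>h\<in>K. m h \<le> C" and [measurable]: "m \<in> borel_measurable \<eta>"
    by (rule modular_exists) blast
  obtain c where c: "c < \<infinity>" "\<forall>h\<in>K. m h \<le> c" using m(2)[OF K(1)] by blast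
  define B where "B = (\<integral>\<^sup>+x. ennreal (F x) \<partial>\<eta>) * (1 + c)"
  have B_fin: "B < \<infinity>"
    using fin c unfolding B_def F_def by (simp add: ennreal_mult_less_top)
  have B1: "(\<integral>\<^sup>+x. ennreal (F x) \<partial>\<eta>) \<le> B"
    unfolding B_def by (simp add: distrib_left)
  have B2: "(\<integral>\<^sup>+x. m x * ennreal (F x) \<partial>\<eta>) \<le> B"
  proof -
    have "(\<integral>\<^sup>+x. m x * ennreal (F x) \<partial>\<eta>) \<le> (\<integral>\<^sup>+x. c * ennreal (F x) \<partial>\<eta>)"
    proof (rule nn_integral_mono)
      fix x assume "x \<in> space \<eta>"
      then show "m x * ennreal (F x) \<le> c * ennreal (F x)"
        using c K(2)[of x] by (cases "x \<in> K") (auto intro: mult_right_mono simp: F_def)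
    qed
    also have "\<dots> = (\<integral>\<^sup>+x. ennreal (F x) \<partial>\<eta>) * c" by (simp add: nn_integral_cmult mult.commute)
    also have "\<dots> \<le> B" unfolding B_def by (intro mult_left_mono) auto
    finally show ?thesis .
  qed
  let ?F = "\<lambda>x. ennreal (F x)"
  \<comment> \<open>Two bounds for steps with kernel F: \<open>bd\<close> carries a uniform bound
    through the steps before the constant kernel, and \<open>int\<close> bounds the integral over
    the starting point of the steps after it. In \<open>int\<close> the order of integration is
    exchanged, which brings in the modular function; it is at most c on the support of F.\<close>
  have bd: "iter (replicate j ?F) \<psi> g \<le> B ^ j * C"
    if "\<And>x. x \<in> carrier G \<Longrightarrow> \<psi> x \<le> C" "g \<in> carrier G" for \<psi> C g j
    using that(2)
  proof (induct j arbitrary: g)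
    case (Suc j)
    have "iter (replicate (Suc j) ?F) \<psi> g \<le> (\<integral>\<^sup>+h. (B ^ j * C) * ?F h \<partial>\<eta>)"
      unfolding replicate_Suc iter.simps using Suc by (intro nn_integral_mono mult_right_mono) auto
    also have "\<dots> = B ^ j * C * (\<integral>\<^sup>+h. ?F h \<partial>\<eta>)" by (simp add: nn_integral_cmult)
    also have "\<dots> \<le> B ^ j * C * B" by (intro mult_left_mono B1) auto
    finally show ?case by (simp add: ac_simps)
  qed (use that in simp)
  have int: "(\<integral>\<^sup>+g. iter (replicate j ?F) \<psi> g \<partial>\<eta>) \<le> B ^ j * (\<integral>\<^sup>+x. \<psi> x \<partial>\<eta>)"
    if [measurable]: "\<psi> \<in> borel_measurable \<eta>" for \<psi> j
  proof (induct j)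
    case (Suc j)
    have [measurable]: "iter (replicate j ?F) \<psi> \<in> borel_measurable \<eta>" by (intro iter_measurable) auto
    have "(\<integral>\<^sup>+g. iter (replicate (Suc j) ?F) \<psi> g \<partial>\<eta>)
        = (\<integral>\<^sup>+g. (\<integral>\<^sup>+h. iter (replicate j ?F) \<psi> (g \<otimes> h) * ?F h \<partial>\<eta>) \<partial>\<eta>)" by simp
    also have "\<dots> = (\<integral>\<^sup>+h. (\<integral>\<^sup>+g. iter (replicate j ?F) \<psi> (g \<otimes> h) * ?F h \<partial>\<eta>) \<partial>\<eta>)"
      by (intro haar2.Fubini') measurable
    also have "\<dots> = (\<integral>\<^sup>+h. (\<integral>\<^sup>+g. iter (replicate j ?F) \<psi> g \<partial>\<eta>) * (m h * ?F h) \<partial>\<eta>)"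
    proof (rule nn_integral_cong)
      fix h assume "h \<in> space \<eta>"
      then have h [measurable]: "h \<in> carrier G" by simp
      have "(\<integral>\<^sup>+g. iter (replicate j ?F) \<psi> (g \<otimes> h) * ?F h \<partial>\<eta>)
          = (\<integral>\<^sup>+g. iter (replicate j ?F) \<psi> (g \<otimes> h) \<partial>\<eta>) * ?F h"
        by (intro nn_integral_multc) measurable
      also have "\<dots> = (\<integral>\<^sup>+g. iter (replicate j ?F) \<psi> g \<partial>\<eta>) * (m h * ?F h)"
        by (subst m(1)[OF h]) (auto simp: ac_simps)
      finally show "(\<integral>\<^sup>+g. iter (replicate j ?F) \<psi> (g \<otimes> h) * ?F h \<partial>\<eta>)
          = (\<integral>\<^sup>+g. iter (replicate j ?F) \<psi> g \<partial>\<eta>) * (m h * ?F h)" .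
    qed
    also have "\<dots> = (\<integral>\<^sup>+g. iter (replicate j ?F) \<psi> g \<partial>\<eta>) * (\<integral>\<^sup>+h. m h * ?F h \<partial>\<eta>)"
      by (intro nn_integral_cmult) auto
    also have "\<dots> \<le> (B ^ j * (\<integral>\<^sup>+x. \<psi> x \<partial>\<eta>)) * B" by (intro mult_mono Suc B2) auto
    finally show ?case by (simp add: ac_simps)
  qed simp
  define k where "k j i = (if i = j then (\<lambda>x. 1) else F)" for j i :: nat
  have k0: "0 \<le> k j i x" for j i x by (simp add: k_def F0)
  have [measurable]: "k j i \<in> borel_measurable \<eta>" for j i by (simp add: k_def)
  have list: "map (\<lambda>i x. ennreal (k j i x)) [0..<n] = replicate j ?F @ (\<lambda>x. 1) # replicate (n - Suc j) ?F"
    if "j < n" for j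
    using that by (intro nth_equalityI) (auto simp: nth_append nth_Cons' k_def)
  have root: "root n (\<Prod>j<n. k j i x) = f x" if "i < n" for i x
  proof -
    have "(\<Prod>j<n. k j i x) = (\<Prod>j\<in>{..<n} - {i}. F x)"
      using that by (subst prod.remove[of _ i]) (auto simp: k_def intro!: prod.cong)
    also have "\<dots> = F x ^ (n - 1)" using that by simp
    also have "\<dots> = f x ^ n"
    proof (cases "f x = 0")
      case False
      then have "0 < f x" using f[of x] by linarith
      then have "F x ^ (n - 1) = F x powr (real n - 1)"
        using n by (subst powr_realpow[symmetric]) (auto simp: F_def of_nat_diff)
      also have "\<dots> = f x powr real n" using n \<open>0 < f x\<close> by (simp add: F_def powr_powr)
      also have "\<dots> = f x ^ n" using \<open>0 < f x\<close> by (simp add: powr_realpow)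
      finally show ?thesis .
    qed (use n in \<open>simp add: F_def power_0_left\<close>)
    finally show ?thesis using n f by (simp add: real_root_power_cancel)
  qed
  show thesis
  proof (rule that[of "of_nat n * (1 + B) ^ n"])
    show "of_nat n * (1 + B) ^ n < \<infinity>" using B_fin
      by (simp add: ennreal_mult_less_top ennreal_of_nat_eq_real_of_nat power_less_top_ennreal)
    fix \<phi> :: "'g \<Rightarrow> ennreal" and g
    assume \<phi> [measurable]: "\<phi> \<in> borel_measurable \<eta>" and g: "g \<in> carrier G"
    have lst: "replicate n (\<lambda>x. ennreal (f x)) = map (\<lambda>i x. ennreal (root n (\<Prod>j<n. k j i x))) [0..<n]"
      by (intro nth_equalityI) (auto simp: root)
    have "iter (replicate n (\<lambda>x. ennreal (f x))) \<phi> g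
        \<le> (\<Sum>j<n. ennreal 1 * iter (map (\<lambda>i x. ennreal (k j i x)) [0..<n]) \<phi> g)"
      using iter_geometric_mean[of k \<phi> n g "\<lambda>_. 1" "[0..<n]"] k0 n g by (simp add: lst)
    also have "\<dots> \<le> (\<Sum>j<n. (1 + B) ^ n * (\<integral>\<^sup>+x. \<phi> x \<partial>\<eta>))"
    proof (rule sum_mono)
      fix j assume "j \<in> {..<n}"
      then have j: "j < n" by simp
      let ?\<psi> = "iter (replicate (n - Suc j) ?F) \<phi>"
      have [measurable]: "?\<psi> \<in> borel_measurable \<eta>" by (intro iter_measurable) auto
      \<comment> \<open>At the constant kernel the integral of
        \<open>?\<psi> (g \<otimes> h)\<close> over h is a Haar integral, which by left invariance
        no longer depends on g.\<close>
      have "iter (map (\<lambda>i x. ennreal (k j i x)) [0..<n]) \<phi> g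
          = iter (replicate j ?F) (\<lambda>g. \<integral>\<^sup>+h. ?\<psi> (g \<otimes> h) \<partial>\<eta>) g"
        by (simp add: list[OF j] iter_append)
      also have "\<dots> \<le> B ^ j * (B ^ (n - Suc j) * (\<integral>\<^sup>+x. \<phi> x \<partial>\<eta>))"
        using g by (intro bd) (simp_all add: haar_left int)
      also have "\<dots> = B ^ (n - 1) * (\<integral>\<^sup>+x. \<phi> x \<partial>\<eta>)"
        using j by (simp add: power_add[symmetric] mult.assoc[symmetric])
      also have "\<dots> \<le> (1 + B) ^ n * (\<integral>\<^sup>+x. \<phi> x \<partial>\<eta>)"
      proof (intro mult_right_mono)
        have "B ^ (n - 1) \<le> (1 + B) ^ (n - 1)" by (intro power_mono) auto
        also have "\<dots> \<le> (1 + B) ^ n" by (intro power_increasing) auto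
        finally show "B ^ (n - 1) \<le> (1 + B) ^ n" .
      qed auto
      finally show "ennreal 1 * iter (map (\<lambda>i x. ennreal (k j i x)) [0..<n]) \<phi> g
          \<le> (1 + B) ^ n * (\<integral>\<^sup>+x. \<phi> x \<partial>\<eta>)" by simp
    qed
    also have "\<dots> = of_nat n * (1 + B) ^ n * (\<integral>\<^sup>+x. \<phi> x \<partial>\<eta>)" by (simp add: mult.assoc)
    finally show "iter (replicate n (\<lambda>x. ennreal (f x))) \<phi> g \<le> of_nat n * (1 + B) ^ n * (\<integral>\<^sup>+x. \<phi> x \<partial>\<eta>)" .
  qed
qed

text \<open>Otherwise there are points z n in a decreasing neighbourhood basis of 1, built from
  finite intersections of basis sets, for which the set of points leaving W has measure at least e.
  As W is open, every x in W satisfies z n x \<in> W for large n, so dominated convergence on the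
  finite measure of W gives a contradiction.\<close>

lemma open_translation_continuous:
  assumes W: "openin T W" "emeasure \<eta> W < \<infinity>" and e: "0 < e"
  shows "\<exists>U. openin T U \<and> \<one> \<in> U \<and> (\<forall>z\<in>U. emeasure \<eta> {x \<in> W. z \<otimes> x \<notin> W} < e)"
proof (rule ccontr)
  assume contr: "\<not> ?thesis"
  have WG: "W \<subseteq> carrier G" using W openin_subset topspace_eq by blast
  have [measurable]: "W \<in> sets \<eta>" using W(1) by (rule open_sets)
  obtain \<B> where \<B>: "countable \<B>" "\<And>V. V \<in> \<B> \<Longrightarrow> openin T V"
    "\<And>W x. openin T W \<Longrightarrow> x \<in> W \<Longrightarrow> \<exists>V\<in>\<B>. x \<in> V \<and> V \<subseteq> W"
    using second_countable unfolding second_countable_def by metis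
  define N where "N = {V \<in> \<B>. \<one> \<in> V}"
  have "openin T (carrier G)" using topspace_eq openin_topspace by metis
  from \<B>(3)[OF this one_closed] have "N \<noteq> {}" by (auto simp: N_def)
  have "countable N" using \<B>(1) by (auto simp: N_def)
  define V where "V n = (\<Inter>i\<le>n. from_nat_into N i)" for n
  have fN: "from_nat_into N i \<in> N" for i using \<open>N \<noteq> {}\<close> by (rule from_nat_into)
  have V: "openin T (V n)" "\<one> \<in> V n" for n
    using fN \<B>(2) by (auto simp: V_def N_def intro!: openin_INT2)
  have "\<exists>z\<in>V n. \<not> emeasure \<eta> {x \<in> W. z \<otimes> x \<notin> W} < e" for n using contr V by blast
  then obtain z where z: "\<And>n. z n \<in> V n" "\<And>n. \<not> emeasure \<eta> {x \<in> W. z n \<otimes> x \<notin> W} < e" by metis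
  have zG [measurable]: "z n \<in> carrier G" for n using z(1) V(1) openin_subset topspace_eq by blast
  have meas [measurable]: "{x \<in> W. z n \<otimes> x \<notin> W} \<in> sets \<eta>" for n
  proof -
    have "{x \<in> W. z n \<otimes> x \<notin> W} = W - {x \<in> carrier G. z n \<otimes> x \<otimes> \<one> \<in> W}"
      using zG WG by (auto simp: m_assoc)
    also have "\<dots> \<in> sets \<eta>"
      using W(1) by (intro sets.Diff open_sets open_translate zG one_closed)
    finally show ?thesis .
  qed
  have "(\<lambda>n. \<integral>\<^sup>+x. indicator {x \<in> W. z n \<otimes> x \<notin> W} x \<partial>\<eta>) \<longlonglongrightarrow> (\<integral>\<^sup>+x. 0 \<partial>\<eta>)"
  proof (rule nn_integral_dominated_convergence)
    show "(\<integral>\<^sup>+x. indicator W x \<partial>\<eta>) < \<infinity>" using W by simp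
    show "AE x in \<eta>. (\<lambda>n. indicator {x \<in> W. z n \<otimes> x \<notin> W} x) \<longlonglongrightarrow> (0 :: ennreal)"
    proof (intro always_eventually allI)
      fix x
      show "(\<lambda>n. indicator {x \<in> W. z n \<otimes> x \<notin> W} x) \<longlonglongrightarrow> (0 :: ennreal)"
      proof (cases "x \<in> W")
        case True
        then have x: "x \<in> carrier G" using WG by auto
        have 1: "openin T {y \<in> carrier G. \<one> \<otimes> y \<otimes> x \<in> W}" using W x by (intro open_translate) auto
        have 2: "\<one> \<in> {y \<in> carrier G. \<one> \<otimes> y \<otimes> x \<in> W}" using True x by simp
        from \<B>(3)[OF 1 2] obtain U
          where U: "U \<in> \<B>" "\<one> \<in> U" "U \<subseteq> {y \<in> carrier G. \<one> \<otimes> y \<otimes> x \<in> W}"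
          by (elim bexE conjE)
        then have "U \<in> N" by (simp add: N_def)
        then obtain i where i: "from_nat_into N i = U"
          using from_nat_into_surj[OF \<open>countable N\<close>] by blast
        have "z n \<otimes> x \<in> W" if "i \<le> n" for n
        proof -
          have "z n \<in> U" using z(1)[of n] that i by (auto simp: V_def)
          then show ?thesis using U(3) zG[of n] by auto
        qed
        then have "\<forall>\<^sub>F n in sequentially. (0::ennreal) = indicator {x \<in> W. z n \<otimes> x \<notin> W} x"
          by (auto simp: eventually_sequentially indicator_def)
        then show ?thesis by (rule Lim_transform_eventually[OF tendsto_const])
      qed simp
    qed
  qed (auto simp: indicator_def)
  then have "(\<lambda>n. emeasure \<eta> {x \<in> W. z n \<otimes> x \<notin> W}) \<longlonglongrightarrow> 0" by simp
  from order_tendstoD(2)[OF this e] z(2) show False by (auto simp: eventually_sequentially)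
qed

end

section \<open>Continuity of translation in measure and Steinhaus' theorem\<close>

context lcsc_haar begin

text \<open>The symmetric difference of A and z^-1 A; its measure is the L^1 distance between the
  indicator of A and its translate.\<close>

definition moved :: "'g \<Rightarrow> 'g set \<Rightarrow> 'g set" where
  "moved z A = {x \<in> carrier G. (z \<otimes> x \<in> A) \<noteq> (x \<in> A)}"

definition translation_continuous :: "'g set \<Rightarrow> bool" where
  "translation_continuous A \<longleftrightarrow>
    (\<forall>e>0. \<exists>U. openin T U \<and> \<one> \<in> U \<and> (\<forall>z\<in>U. emeasure \<eta> (moved z A) \<le> ennreal e))"

lemma moved_sets [measurable]: "z \<in> carrier G \<Longrightarrow> A \<in> sets \<eta> \<Longrightarrow> moved z A \<in> sets \<eta>"
proof -
  assume z: "z \<in> carrier G" and A: "A \<in> sets \<eta>"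
  let ?Z = "(\<lambda>x. z \<otimes> x) -` A \<inter> space \<eta>"
  have "?Z \<in> sets \<eta>" using z by (intro measurable_sets[OF _ A]) auto
  moreover have "moved z A = (?Z - A) \<union> (A - ?Z)"
    using sets.sets_into_space[OF A] by (auto simp: moved_def)
  ultimately show ?thesis using A by (auto intro: sets.Un sets.Diff)
qed

lemma translate_sets:
  assumes z: "z \<in> carrier G" and A: "A \<in> sets \<eta>"
  shows "{x \<in> carrier G. z \<otimes> x \<in> A} \<in> sets \<eta>"
proof -
  have "(\<lambda>x. z \<otimes> x) -` A \<inter> space \<eta> \<in> sets \<eta>" using z by (intro measurable_sets[OF _ A]) auto
  also have "(\<lambda>x. z \<otimes> x) -` A \<inter> space \<eta> = {x \<in> carrier G. z \<otimes> x \<in> A}" by auto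
  finally show ?thesis .
qed

lemma emeasure_translate:
  assumes z: "z \<in> carrier G" and [measurable]: "A \<in> sets \<eta>"
  shows "emeasure \<eta> {x \<in> carrier G. z \<otimes> x \<in> A} = emeasure \<eta> A"
proof -
  have "emeasure \<eta> {x \<in> carrier G. z \<otimes> x \<in> A} = (\<integral>\<^sup>+x. indicator {x \<in> carrier G. z \<otimes> x \<in> A} x \<partial>\<eta>)"
    by (rule nn_integral_indicator[symmetric, OF translate_sets[OF assms]])
  also have "\<dots> = (\<integral>\<^sup>+x. indicator A (z \<otimes> x) \<partial>\<eta>)"
    by (intro nn_integral_cong) (simp add: indicator_def)
  also have "\<dots> = emeasure \<eta> A" using z by (subst haar_left) auto
  finally show ?thesis .
qed

text \<open>The hypothesis on moved points fits unions and relative complements of A and B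
  alike.\<close>

lemma translation_continuousI:
  assumes A: "A \<in> sets \<eta>" "translation_continuous A" and B: "B \<in> sets \<eta>" "translation_continuous B"
    and sub: "\<And>z. z \<in> carrier G \<Longrightarrow> moved z C \<subseteq> moved z A \<union> moved z B"
  shows "translation_continuous C"
  unfolding translation_continuous_def
proof (intro allI impI)
  fix e :: real assume e: "0 < e"
  obtain U where U: "openin T U" "\<one> \<in> U" "\<forall>z\<in>U. emeasure \<eta> (moved z A) \<le> ennreal (e / 2)"
    using A(2) e unfolding translation_continuous_def by (meson half_gt_zero)
  obtain V where V: "openin T V" "\<one> \<in> V" "\<forall>z\<in>V. emeasure \<eta> (moved z B) \<le> ennreal (e / 2)"
    using B(2) e unfolding translation_continuous_def by (meson half_gt_zero)
  show "\<exists>U. openin T U \<and> \<one> \<in> U \<and> (\<forall>z\<in>U. emeasure \<eta> (moved z C) \<le> ennreal e)"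
  proof (intro exI[of _ "U \<inter> V"] conjI ballI)
    fix z assume z: "z \<in> U \<inter> V"
    then have zG: "z \<in> carrier G" using open_subset[OF U(1)] by auto
    have "emeasure \<eta> (moved z C) \<le> emeasure \<eta> (moved z A \<union> moved z B)"
      using zG A B by (intro emeasure_mono sub sets.Un moved_sets)
    also have "\<dots> \<le> emeasure \<eta> (moved z A) + emeasure \<eta> (moved z B)"
      using zG A B by (intro emeasure_subadditive moved_sets)
    also have "\<dots> \<le> ennreal (e / 2) + ennreal (e / 2)"
      using z U V by (intro add_mono) auto
    also have "\<dots> = ennreal e" using e by (simp add: ennreal_plus[symmetric] del: ennreal_plus)
    finally show "emeasure \<eta> (moved z C) \<le> ennreal e" .
  qed (use U V in auto)
qed

text \<open>\<open>open_translation_continuous\<close> controls the points that leave W. The points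
  that enter W under z are carried by z onto those that leave W under z^-1, so the neighbourhood U
  is cut down by its inverse.\<close>

lemma translation_continuous_open:
  assumes W: "openin T W" "emeasure \<eta> W < \<infinity>"
  shows "translation_continuous W"
  unfolding translation_continuous_def
proof (intro allI impI)
  fix e :: real assume e: "0 < e"
  have WG: "W \<subseteq> carrier G" and Ws [measurable]: "W \<in> sets \<eta>" using W open_subset open_sets by auto
  have "0 < ennreal (e / 2)" using e by simp
  from open_translation_continuous[OF W this]
  obtain U where U: "openin T U" "\<one> \<in> U" "\<forall>z\<in>U. emeasure \<eta> {x \<in> W. z \<otimes> x \<notin> W} < ennreal (e / 2)" by blast
  let ?V = "{z \<in> topspace T. inv z \<in> U}"
  have V: "openin T ?V" using continuous_inv U(1) by (rule openin_continuous_map_preimage)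
  show "\<exists>U. openin T U \<and> \<one> \<in> U \<and> (\<forall>z\<in>U. emeasure \<eta> (moved z W) \<le> ennreal e)"
  proof (intro exI[of _ "U \<inter> ?V"] conjI ballI)
    fix z assume z: "z \<in> U \<inter> ?V"
    then have zG [measurable]: "z \<in> carrier G" using open_subset[OF U(1)] by auto
    have m: "{x \<in> space \<eta>. y \<otimes> x \<notin> W} \<in> sets \<eta>" if [measurable]: "y \<in> carrier G" for y
      by measurable
    have m': "{x \<in> W. y \<otimes> x \<notin> W} \<in> sets \<eta>" if [measurable]: "y \<in> carrier G" for y
    proof -
      have "W \<inter> {x \<in> space \<eta>. y \<otimes> x \<notin> W} \<in> sets \<eta>" using Ws m[OF that] by (rule sets.Int)
      also have "W \<inter> {x \<in> space \<eta>. y \<otimes> x \<notin> W} = {x \<in> W. y \<otimes> x \<notin> W}"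
        unfolding space_haar using WG by blast
      finally show ?thesis .
    qed
    have "{x \<in> carrier G. z \<otimes> x \<in> {y \<in> W. inv z \<otimes> y \<notin> W}} = {x \<in> carrier G. x \<notin> W \<and> z \<otimes> x \<in> W}"
      using zG by (auto simp: inv_mult_cancel)
    with emeasure_translate[OF zG m'[of "inv z"]] zG
    have eq: "emeasure \<eta> {x \<in> carrier G. x \<notin> W \<and> z \<otimes> x \<in> W} = emeasure \<eta> {y \<in> W. inv z \<otimes> y \<notin> W}"
      by simp
    have m'': "{x \<in> space \<eta>. x \<notin> W \<and> z \<otimes> x \<in> W} \<in> sets \<eta>" by measurable
    have mv: "moved z W = {x \<in> W. z \<otimes> x \<notin> W} \<union> {x \<in> carrier G. x \<notin> W \<and> z \<otimes> x \<in> W}"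
      using WG by (auto simp: moved_def)
    have "emeasure \<eta> (moved z W) \<le> emeasure \<eta> {x \<in> W. z \<otimes> x \<notin> W} + emeasure \<eta> {x \<in> carrier G. x \<notin> W \<and> z \<otimes> x \<in> W}"
      unfolding mv by (rule emeasure_subadditive[OF m'[OF zG] m''[unfolded space_haar]])
    also have "\<dots> \<le> ennreal (e / 2) + ennreal (e / 2)"
      unfolding eq using U(3) z by (intro add_mono) (auto intro: less_imp_le)
    also have "\<dots> = ennreal e" using e by (simp add: ennreal_plus[symmetric] del: ennreal_plus)
    finally show "emeasure \<eta> (moved z W) \<le> ennreal e" .
  next
    show "openin T (U \<inter> ?V)" using U V by blast
    show "\<one> \<in> U \<inter> ?V" using U topspace_eq by auto
  qed
qed

text \<open>Dynkin induction, starting from the intersection-stable family of open sets.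
  Intersecting with W keeps measures finite; hence the tail R n of a disjoint union is small, and
  its translates have the same measure, so the tail is negligible uniformly in z.\<close>

lemma translation_continuous_Int:
  assumes W: "openin T W" "emeasure \<eta> W < \<infinity>" and A: "A \<in> sets \<eta>"
  shows "translation_continuous (A \<inter> W)"
proof -
  have [measurable]: "W \<in> sets \<eta>" using W(1) by (rule open_sets)
  have eq: "sets \<eta> = sigma_sets (carrier G) {U. openin T U}"
    unfolding sets_haar sets_borel_of topspace_eq ..
  have empty: "translation_continuous {}" by (auto simp: translation_continuous_def moved_def intro!: exI[of _ "carrier G"])
      (metis openin_topspace topspace_eq)
  have stable: "Int_stable {U. openin T U}" by (auto simp: Int_stable_def)
  have Pow: "{U. openin T U} \<subseteq> Pow (carrier G)" by (auto dest: open_subset)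
  from stable Pow A[unfolded eq] show ?thesis
  proof (induct rule: sigma_sets_induct_disjoint)
    case (basic A)
    then have A: "openin T (A \<inter> W)" using W by auto
    have "emeasure \<eta> (A \<inter> W) \<le> emeasure \<eta> W" by (intro emeasure_mono) auto
    then show ?case using W A by (intro translation_continuous_open) (auto intro: le_less_trans)
  next
    case (compl A)
    have "A \<in> sets \<eta>" using compl eq by simp
    then show ?case
      by (intro translation_continuousI[OF _ compl(2) _ translation_continuous_open[OF W]])
        (auto simp: moved_def)
  next
    case (union A)
    have A [measurable]: "A i \<in> sets \<eta>" for i using union(2) eq by auto
    define F where "F n = (\<Union>i<n. A i) \<inter> W" for n :: nat
    have F [measurable]: "F n \<in> sets \<eta>" for n unfolding F_def by measurable
    have Fc: "translation_continuous (F n)" for n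
    proof (induct n)
      case (Suc n)
      show ?case
        by (intro translation_continuousI[OF F Suc _ union(3)[of n]])
          (auto simp: moved_def F_def less_Suc_eq)
    qed (simp add: F_def empty)
    define R where "R n = (\<Union>i. A i) \<inter> W - F n" for n
    have R [measurable]: "R n \<in> sets \<eta>" for n unfolding R_def by measurable
    have "(\<lambda>n. emeasure \<eta> (R n)) \<longlonglongrightarrow> emeasure \<eta> (\<Inter>n. R n)"
    proof (rule Lim_emeasure_decseq)
      show "decseq R" unfolding R_def F_def decseq_def by fastforce
      have "emeasure \<eta> (R n) \<le> emeasure \<eta> W" for n unfolding R_def by (intro emeasure_mono) auto
      then show "emeasure \<eta> (R n) \<noteq> \<infinity>" for n using W(2) by (metis leD infinity_ennreal_def)
    qed auto
    also have "(\<Inter>n. R n) = {}" by (auto simp: R_def F_def)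
    finally have lim: "(\<lambda>n. emeasure \<eta> (R n)) \<longlonglongrightarrow> 0" by simp
    show ?case
      unfolding translation_continuous_def
    proof (intro allI impI)
      fix e :: real assume e: "0 < e"
      from order_tendstoD(2)[OF lim, of "ennreal (e / 3)"] e obtain n where n: "emeasure \<eta> (R n) < ennreal (e / 3)"
        by (auto simp: eventually_sequentially)
      have "0 < e / 3" using e by simp
      with Fc[of n] obtain U where U: "openin T U" "\<one> \<in> U" "\<forall>z\<in>U. emeasure \<eta> (moved z (F n)) \<le> ennreal (e / 3)"
        unfolding translation_continuous_def by blast
      show "\<exists>U. openin T U \<and> \<one> \<in> U \<and> (\<forall>z\<in>U. emeasure \<eta> (moved z (\<Union> (range A) \<inter> W)) \<le> ennreal e)"
      proof (intro exI[of _ U] conjI ballI)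
        fix z assume z: "z \<in> U"
        then have zG [measurable]: "z \<in> carrier G" using open_subset[OF U(1)] by auto
        let ?Z = "{x \<in> carrier G. z \<otimes> x \<in> R n}"
        have Z: "?Z \<in> sets \<eta>" by (rule translate_sets[OF zG R])
        have "moved z (\<Union> (range A) \<inter> W) \<subseteq> (moved z (F n) \<union> R n) \<union> ?Z"
          by (auto simp: moved_def R_def F_def)
        then have "emeasure \<eta> (moved z (\<Union> (range A) \<inter> W)) \<le> emeasure \<eta> ((moved z (F n) \<union> R n) \<union> ?Z)"
          using zG Z by (intro emeasure_mono sets.Un moved_sets F R)
        also have "\<dots> \<le> emeasure \<eta> (moved z (F n) \<union> R n) + emeasure \<eta> ?Z"
          using Z zG by (intro emeasure_subadditive sets.Un moved_sets F R)
        also have "\<dots> \<le> (emeasure \<eta> (moved z (F n)) + emeasure \<eta> (R n)) + emeasure \<eta> ?Z"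
          using Z zG by (intro add_mono emeasure_subadditive sets.Un moved_sets F R order_refl)
        also have "\<dots> \<le> (ennreal (e / 3) + ennreal (e / 3)) + ennreal (e / 3)"
          unfolding emeasure_translate[OF zG R] using z U(3) n by (intro add_mono) auto
        also have "\<dots> = ennreal e" using e by (simp add: ennreal_plus[symmetric] del: ennreal_plus)
        finally show "emeasure \<eta> (moved z (\<Union> (range A) \<inter> W)) \<le> ennreal e" .
      qed (use U in auto)
    qed
  qed (simp add: empty)
qed

text \<open>On some set A of positive finite measure f exceeds a positive constant. The convolution
  q of the indicator of A with itself has integral \<eta>(A)^2 > 0, so it is positive at some y0,
  and continuity of translation keeps it above half of that value on the open set U y0.\<close>

lemma convolution_square_lower_bound:
  fixes f :: "'g \<Rightarrow> real"
  assumes [measurable]: "f \<in> borel_measurable \<eta>" and pos: "0 < (\<integral>\<^sup>+x. ennreal (f x) \<partial>\<eta>)"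
  obtains W c where "openin T W" "W \<noteq> {}" "0 < c"
    "\<And>\<phi>. \<phi> \<in> borel_measurable \<eta> \<Longrightarrow>
      c * (\<integral>\<^sup>+x. \<phi> x * indicator W x \<partial>\<eta>) \<le> iter [\<lambda>x. ennreal (f x), \<lambda>x. ennreal (f x)] \<phi> \<one>"
proof -
  obtain \<U> where \<U>: "countable \<U>" "\<And>U. U \<in> \<U> \<Longrightarrow> openin T U \<and> emeasure \<eta> U < \<infinity>"
    "carrier G \<subseteq> \<Union>\<U>" by (rule finite_open_cover) blast
  define B where "B n = {x \<in> space \<eta>. 1 / Suc n < f x}" for n :: nat
  have B [measurable]: "B n \<in> sets \<eta>" for n unfolding B_def by measurable
  have "\<exists>U\<in>\<U>. \<exists>n. emeasure \<eta> (B n \<inter> U) \<noteq> 0"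
  proof (rule ccontr)
    assume "\<not> ?thesis"
    then have "B n \<inter> U \<in> null_sets \<eta>" if "U \<in> \<U>" for n U
      using that \<U>(2) open_sets by (intro null_setsI) auto
    then have null: "(\<Union>U\<in>\<U>. \<Union>n. B n \<inter> U) \<in> null_sets \<eta>"
      using \<U>(1) by (intro null_sets_UN' null_sets_UN)
    have "AE x in \<eta>. ennreal (f x) = 0"
    proof (rule AE_I'[OF null], rule subsetI)
      fix x assume x: "x \<in> {x \<in> space \<eta>. ennreal (f x) \<noteq> 0}"
      then have "0 < f x" by (auto simp: ennreal_eq_0_iff)
      then obtain n where "1 / Suc n < f x"
        using reals_Archimedean[of "f x"] by (auto simp: inverse_eq_divide)
      moreover obtain U where "U \<in> \<U>" "x \<in> U" using x \<U>(3) by auto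
      ultimately show "x \<in> (\<Union>U\<in>\<U>. \<Union>n. B n \<inter> U)" using x by (auto simp: B_def)
    qed
    then have "(\<integral>\<^sup>+x. ennreal (f x) \<partial>\<eta>) = 0" by (subst nn_integral_0_iff_AE) auto
    then show False using pos by simp
  qed
  then obtain V n where V: "V \<in> \<U>" "emeasure \<eta> (B n \<inter> V) \<noteq> 0" by blast
  define A where "A = B n \<inter> V"
  have A: "A \<in> sets \<eta>" using \<U>(2)[OF V(1)] open_sets unfolding A_def by auto
  note [measurable] = A
  have A_fin: "emeasure \<eta> A < \<infinity>"
  proof -
    have "emeasure \<eta> A \<le> emeasure \<eta> V" unfolding A_def using \<U>(2)[OF V(1)] open_sets by (intro emeasure_mono) auto
    then show ?thesis using \<U>(2)[OF V(1)] by auto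
  qed
  have tc: "translation_continuous A"
    unfolding A_def using \<U>(2)[OF V(1)] by (intro translation_continuous_Int B) auto
  define q where "q y = (\<integral>\<^sup>+x. indicator A x * indicator A (inv x \<otimes> y) \<partial>\<eta>)" for y
  have [measurable]: "q \<in> borel_measurable \<eta>" unfolding q_def by measurable
  have "(\<integral>\<^sup>+y. q y \<partial>\<eta>) = (\<integral>\<^sup>+x. (\<integral>\<^sup>+y. indicator A x * indicator A (inv x \<otimes> y) \<partial>\<eta>) \<partial>\<eta>)"
    unfolding q_def by (intro haar2.Fubini') measurable
  also have "\<dots> = (\<integral>\<^sup>+x. indicator A x * emeasure \<eta> A \<partial>\<eta>)"
    by (intro nn_integral_cong) (simp add: nn_integral_cmult haar_left[where \<phi> = "indicator A"])
  also have "\<dots> = emeasure \<eta> A * emeasure \<eta> A" by (simp add: nn_integral_multc)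
  finally have "(\<integral>\<^sup>+y. q y \<partial>\<eta>) \<noteq> 0" using V(2) by (simp add: A_def)
  then have "\<not> (\<forall>y\<in>carrier G. q y = 0)"
    by (metis (mono_tags, lifting) nn_integral_0_iff_AE AE_I2 space_haar \<open>q \<in> borel_measurable \<eta>\<close>)
  then obtain y0 where y0: "y0 \<in> carrier G" "q y0 \<noteq> 0" by blast
  have "q y0 \<le> (\<integral>\<^sup>+x. indicator A x \<partial>\<eta>)"
    unfolding q_def by (intro nn_integral_mono) (auto simp: indicator_def)
  then have "q y0 < \<infinity>" using A_fin by (simp add: le_less_trans)
  then obtain r where r: "q y0 = ennreal r" "0 < r" using y0(2)
    by (cases "q y0") (auto simp: less_le)
  obtain U where U: "openin T U" "\<one> \<in> U" "\<forall>z\<in>U. emeasure \<eta> (moved z A) \<le> ennreal (r / 2)"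
    using tc r(2) unfolding translation_continuous_def by (meson half_gt_zero)
  have q_lower: "ennreal (r / 2) \<le> q (z \<otimes> y0)" if z: "z \<in> U" for z
  proof -
    have zG [measurable]: "z \<in> carrier G" using z open_subset[OF U(1)] by auto
    note [measurable] = y0(1)
    have "ennreal (r / 2) + ennreal (r / 2) = q y0"
      using r by (simp add: ennreal_plus[symmetric] del: ennreal_plus)
    \<comment> \<open>A point x of A either satisfies z x \<in> A and is counted by the first
      summand, or it is moved by z.\<close>
    also have "\<dots> \<le> (\<integral>\<^sup>+x. indicator A (z \<otimes> x) * indicator A (inv x \<otimes> y0) + indicator (moved z A) x \<partial>\<eta>)"
      unfolding q_def by (intro nn_integral_mono) (auto simp: indicator_def moved_def)
    also have "\<dots> = (\<integral>\<^sup>+x. indicator A (z \<otimes> x) * indicator A (inv x \<otimes> y0) \<partial>\<eta>) + emeasure \<eta> (moved z A)"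
      using moved_sets[OF zG A] by (subst nn_integral_add) auto
    also have "(\<integral>\<^sup>+x. indicator A (z \<otimes> x) * indicator A (inv x \<otimes> y0) \<partial>\<eta>)
        = (\<integral>\<^sup>+x. indicator A (z \<otimes> x) * indicator A (inv (z \<otimes> x) \<otimes> (z \<otimes> y0)) \<partial>\<eta>)"
      using zG y0 by (intro nn_integral_cong) (simp add: inv_mult_group m_assoc inv_mult_cancel)
    also have "\<dots> = q (z \<otimes> y0)"
      unfolding q_def using zG y0 by (intro haar_left) auto
    also have "q (z \<otimes> y0) + emeasure \<eta> (moved z A) \<le> q (z \<otimes> y0) + ennreal (r / 2)"
      using U z by (intro add_mono) auto
    finally show ?thesis by (simp add: add.commute)
  qed
  let ?W = "{y \<in> carrier G. \<one> \<otimes> y \<otimes> inv y0 \<in> U}"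
  have W: "openin T ?W" using U y0 by (intro open_translate) auto
  then have Ws [measurable]: "?W \<in> sets \<eta>" by (rule open_sets)
  define c0 where "c0 = ennreal (1 / Suc n)"
  show thesis
  proof (rule that[of ?W "c0 * c0 * ennreal (r / 2)"])
    show "openin T ?W" by fact
    have "y0 \<in> ?W" using y0 U by simp
    then show "?W \<noteq> {}" by blast
    show "0 < c0 * c0 * ennreal (r / 2)" using r by (simp add: c0_def ennreal_mult[symmetric])
    fix \<phi> :: "'g \<Rightarrow> ennreal" assume [measurable]: "\<phi> \<in> borel_measurable \<eta>"
    have lower: "c0 * indicator A x \<le> ennreal (f x)" for x
      by (auto simp: c0_def A_def B_def indicator_def intro!: ennreal_leI)
    have "(\<integral>\<^sup>+y. \<phi> y * indicator ?W y \<partial>\<eta>) * ennreal (r / 2) = (\<integral>\<^sup>+y. \<phi> y * indicator ?W y * ennreal (r / 2) \<partial>\<eta>)"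
      by (intro nn_integral_multc[symmetric]) measurable
    also have "\<dots> \<le> (\<integral>\<^sup>+y. \<phi> y * q y \<partial>\<eta>)"
    proof (rule nn_integral_mono)
      fix y assume "y \<in> space \<eta>"
      then show "\<phi> y * indicator ?W y * ennreal (r / 2) \<le> \<phi> y * q y"
        using q_lower[of "y \<otimes> inv y0"] y0(1)
        by (auto simp: indicator_def m_assoc intro!: mult_left_mono)
    qed
    also have "\<dots> = (\<integral>\<^sup>+y. (\<integral>\<^sup>+x. \<phi> y * (indicator A x * indicator A (inv x \<otimes> y)) \<partial>\<eta>) \<partial>\<eta>)"
      unfolding q_def by (intro nn_integral_cong nn_integral_cmult[symmetric]) auto
    also have "\<dots> = (\<integral>\<^sup>+x. (\<integral>\<^sup>+y. \<phi> y * (indicator A x * indicator A (inv x \<otimes> y)) \<partial>\<eta>) \<partial>\<eta>)"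
      by (intro haar2.Fubini') measurable
    also have "\<dots> = (\<integral>\<^sup>+x. (\<integral>\<^sup>+y. \<phi> (x \<otimes> y) * (indicator A x * indicator A y) \<partial>\<eta>) \<partial>\<eta>)"
    proof (rule nn_integral_cong)
      fix x assume "x \<in> space \<eta>"
      then have x [measurable]: "x \<in> carrier G" by simp
      have "(\<integral>\<^sup>+y. \<phi> y * (indicator A x * indicator A (inv x \<otimes> y)) \<partial>\<eta>)
         = (\<integral>\<^sup>+y. \<phi> (x \<otimes> y) * (indicator A x * indicator A (inv x \<otimes> (x \<otimes> y))) \<partial>\<eta>)"
        using x by (intro haar_left[symmetric]) auto
      also have "\<dots> = (\<integral>\<^sup>+y. \<phi> (x \<otimes> y) * (indicator A x * indicator A y) \<partial>\<eta>)"
        using x by (intro nn_integral_cong) (simp add: inv_mult_cancel)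
      finally show "(\<integral>\<^sup>+y. \<phi> y * (indicator A x * indicator A (inv x \<otimes> y)) \<partial>\<eta>)
         = (\<integral>\<^sup>+y. \<phi> (x \<otimes> y) * (indicator A x * indicator A y) \<partial>\<eta>)" .
    qed
    finally have "c0 * c0 * ((\<integral>\<^sup>+y. \<phi> y * indicator ?W y \<partial>\<eta>) * ennreal (r / 2))
      \<le> c0 * c0 * (\<integral>\<^sup>+x. (\<integral>\<^sup>+y. \<phi> (x \<otimes> y) * (indicator A x * indicator A y) \<partial>\<eta>) \<partial>\<eta>)"
      by (rule mult_left_mono) simp
    also have "\<dots> = (\<integral>\<^sup>+x. (\<integral>\<^sup>+y. \<phi> (x \<otimes> y) * (c0 * indicator A y) \<partial>\<eta>) * (c0 * indicator A x) \<partial>\<eta>)"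
      by (simp add: nn_integral_cmult[symmetric] nn_integral_multc[symmetric] ac_simps cong: nn_integral_cong_simp)
    also have "\<dots> \<le> (\<integral>\<^sup>+x. (\<integral>\<^sup>+y. \<phi> (x \<otimes> y) * ennreal (f y) \<partial>\<eta>) * ennreal (f x) \<partial>\<eta>)"
      by (intro nn_integral_mono mult_mono lower) auto
    also have "\<dots> = iter [\<lambda>x. ennreal (f x), \<lambda>x. ennreal (f x)] \<phi> \<one>"
      by (auto intro!: nn_integral_cong)
    finally show "c0 * c0 * ennreal (r / 2) * (\<integral>\<^sup>+x. \<phi> x * indicator ?W x \<partial>\<eta>)
      \<le> iter [\<lambda>x. ennreal (f x), \<lambda>x. ennreal (f x)] \<phi> \<one>" by (simp add: ac_simps)
  qed
qed

end

lemma le_inverse_ennreal: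
  fixes c I :: ennreal
  assumes "c * I \<le> 1" "0 < c" shows "I \<le> 1 / c"
proof (cases "c = \<top>")
  case True
  then have "I = 0" using assms(1) by (cases "I = 0") (auto simp: ennreal_top_mult top_unique)
  then show ?thesis by simp
next
  case False
  then have "I = c * I / c" using assms by (metis ennreal_mult_divide_eq less_irrefl mult.commute)
  also have "\<dots> \<le> 1 / c" using assms(1) by (rule divide_right_mono_ennreal)
  finally show ?thesis .
qed

section \<open>The random walk with a compactly supported density\<close>

locale compact_density = lcsc_haar +
  fixes f :: "'a \<Rightarrow> real" and K :: "'a set"
  assumes f_measurable [measurable]: "f \<in> borel_measurable \<eta>" and f_nonneg: "0 \<le> f x"
    and K: "compactin T K" and f_support: "x \<in> carrier G \<Longrightarrow> x \<notin> K \<Longrightarrow> f x = 0"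
    and f_int: "(\<integral>\<^sup>+x. ennreal (f x) \<partial>\<eta>) = 1"
    and generating: "closedin T S \<Longrightarrow> (\<And>x y. x \<in> S \<Longrightarrow> y \<in> S \<Longrightarrow> x \<otimes> y \<in> S) \<Longrightarrow>
      (\<integral>\<^sup>+x. ennreal (f x) * indicator (carrier G - S) x \<partial>\<eta>) = 0 \<Longrightarrow> S = carrier G"
begin

definition walk :: "nat \<Rightarrow> ('a \<Rightarrow> ennreal) \<Rightarrow> 'a \<Rightarrow> ennreal" where
  "walk n = iter (replicate n (\<lambda>x. ennreal (f x)))"

lemma walk_measurable [measurable]: "\<phi> \<in> borel_measurable \<eta> \<Longrightarrow> walk n \<phi> \<in> borel_measurable \<eta>"
  unfolding walk_def by (intro iter_measurable) auto

lemma walk_add: "walk (m + n) \<phi> = walk m (walk n \<phi>)"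
  by (simp add: walk_def replicate_add iter_append)

lemma walk_Suc: "walk (Suc n) \<phi> g = (\<integral>\<^sup>+h. walk n \<phi> (g \<otimes> h) * ennreal (f h) \<partial>\<eta>)"
  by (simp add: walk_def)

lemma walk_0 [simp]: "walk 0 \<phi> = \<phi>"
  by (simp add: walk_def)

text \<open>S consists of the points of which every neighbourhood is charged by some convolution
  power with n \<ge> 1, that is, the closure of the union of their supports. It is closed; a
  neighbourhood of a product of two of its points is reached at the sum of the two times; and it
  carries the density f. By admissibility S is the whole group.\<close>

lemma walk_reaches_open:
  assumes U: "openin T U" "U \<noteq> {}"
  shows "\<exists>n\<ge>1. walk n (indicator U) \<one> \<noteq> 0"
proof -
  define S where "S = {x \<in> carrier G. \<forall>U. openin T U \<longrightarrow> x \<in> U \<longrightarrow> (\<exists>n\<ge>1. walk n (indicator U) \<one> \<noteq> 0)}"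
  have outside: "\<exists>V. openin T V \<and> x \<in> V \<and> (V \<subseteq> carrier G - S \<and> (\<forall>n\<ge>1. walk n (indicator V) \<one> = 0))"
    if x: "x \<in> carrier G - S" for x
  proof -
    obtain V where V: "openin T V" "x \<in> V" "\<forall>n\<ge>1. walk n (indicator V) \<one> = 0"
      using x by (auto simp: S_def)
    then have "V \<subseteq> carrier G - S" using open_subset[OF V(1)] by (auto simp: S_def)
    with V show ?thesis by blast
  qed
  have "S = carrier G"
  proof (rule generating)
    have "openin T (carrier G - S)" by (subst openin_subopen) (use outside in blast)
    moreover have "S \<subseteq> carrier G" by (auto simp: S_def)
    ultimately show "closedin T S" by (simp add: closedin_def topspace_eq)
  next
    fix x y assume x: "x \<in> S" and y: "y \<in> S"
    then have xyG: "x \<in> carrier G" "y \<in> carrier G" by (auto simp: S_def)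
    have "\<exists>n\<ge>1. walk n (indicator U) \<one> \<noteq> 0" if U: "openin T U" "x \<otimes> y \<in> U" for U
    proof -
      have "openin (prod_topology T T) {p \<in> topspace (prod_topology T T). (case p of (x, y) \<Rightarrow> x \<otimes> y) \<in> U}"
        using continuous_mult U(1) by (rule openin_continuous_map_preimage)
      moreover have "(x, y) \<in> {p \<in> topspace (prod_topology T T). (case p of (x, y) \<Rightarrow> x \<otimes> y) \<in> U}"
        using xyG U topspace_eq by simp
      ultimately obtain V W where VW: "openin T V" "openin T W" "x \<in> V" "y \<in> W"
        "V \<times> W \<subseteq> {p \<in> topspace (prod_topology T T). (case p of (x, y) \<Rightarrow> x \<otimes> y) \<in> U}"
        unfolding openin_prod_topology_alt by meson
      have prod: "v \<otimes> w \<in> U" if "v \<in> V" "w \<in> W" for v w using VW(5) that by auto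
      obtain m n where mn: "m \<ge> 1" "walk m (indicator V) \<one> \<noteq> 0" "n \<ge> 1" "walk n (indicator W) \<one> \<noteq> 0"
        using x y VW unfolding S_def by blast
      have VWs: "V \<in> sets \<eta>" "W \<in> sets \<eta>" using VW open_sets by auto
      have "walk n (indicator W) \<one> * walk m (indicator V) \<one> = walk m (\<lambda>v. walk n (indicator W) \<one> * indicator V v) \<one>"
        unfolding walk_def using VWs by (intro iter_cmult[symmetric]) auto
      also have "\<dots> \<le> walk m (walk n (indicator U)) \<one>"
        unfolding walk_def
      proof (rule iter_mono)
        fix v assume v: "v \<in> carrier G"
        have "iter (replicate n (\<lambda>x. ennreal (f x))) (indicator W) \<one> \<le> iter (replicate n (\<lambda>x. ennreal (f x))) (indicator U) v" if "v \<in> V"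
        proof -
          have "iter (replicate n (\<lambda>x. ennreal (f x))) (indicator W) \<one> \<le> iter (replicate n (\<lambda>x. ennreal (f x))) (\<lambda>w. indicator U (v \<otimes> w)) \<one>"
            using prod[OF that] by (intro iter_mono) (auto simp: indicator_def)
          also have "\<dots> = iter (replicate n (\<lambda>x. ennreal (f x))) (indicator U) (v \<otimes> \<one>)"
            using v by (intro iter_translate[symmetric]) auto
          finally show ?thesis using v by simp
        qed
        then show "iter (replicate n (\<lambda>x. ennreal (f x))) (indicator W) \<one> * indicator V v
          \<le> iter (replicate n (\<lambda>x. ennreal (f x))) (indicator U) v" by (auto simp: indicator_def)
      qed simp
      also have "\<dots> = walk (m + n) (indicator U) \<one>" by (simp add: walk_add)
      finally have "walk (m + n) (indicator U) \<one> \<noteq> 0" using mn(2,4) by auto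
      then show ?thesis using mn by (intro exI[of _ "m + n"]) auto
    qed
    then show "x \<otimes> y \<in> S" using xyG by (auto simp: S_def)
  next
    \<comment> \<open>Countably many missed neighbourhoods cover the complement of S, so their
      exceptional null sets can be united. That they are missed at time 1 says that f vanishes
      almost everywhere on them.\<close>
    from Lindelof_cover[of "carrier G - S" "\<lambda>V. V \<subseteq> carrier G - S \<and> (\<forall>n\<ge>1. walk n (indicator V) \<one> = 0)", OF Diff_subset outside]
    obtain \<U> where \<U>: "countable \<U>" "\<And>V. V \<in> \<U> \<Longrightarrow> openin T V \<and> V \<subseteq> carrier G - S \<and> (\<forall>n\<ge>1. walk n (indicator V) \<one> = 0)"
      "carrier G - S \<subseteq> \<Union>\<U>" by (metis (no_types, lifting))
    have "AE x in \<eta>. \<forall>V\<in>\<U>. ennreal (f x) * indicator V x = 0"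
    proof (subst AE_ball_countable[OF \<U>(1)], intro ballI)
      fix V assume V: "V \<in> \<U>"
      have Vs [measurable]: "V \<in> sets \<eta>" using \<U>(2)[OF V] open_sets by auto
      have "walk 1 (indicator V) \<one> = (\<integral>\<^sup>+x. ennreal (f x) * indicator V x \<partial>\<eta>)"
        unfolding One_nat_def walk_Suc by (intro nn_integral_cong) (simp add: mult.commute)
      then have "(\<integral>\<^sup>+x. ennreal (f x) * indicator V x \<partial>\<eta>) = 0" using \<U>(2)[OF V] by simp
      then show "AE x in \<eta>. ennreal (f x) * indicator V x = 0"
        by (subst (asm) nn_integral_0_iff_AE) auto
    qed
    then have "AE x in \<eta>. ennreal (f x) * indicator (carrier G - S) x = 0"
    proof (rule AE_mp, intro AE_I2 impI)
      fix x assume x: "\<forall>V\<in>\<U>. ennreal (f x) * indicator V x = 0"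
      show "ennreal (f x) * indicator (carrier G - S) x = 0"
      proof (cases "x \<in> carrier G - S")
        case True
        then obtain V where "V \<in> \<U>" "x \<in> V" using \<U>(3) by auto
        then show ?thesis using bspec[OF x \<open>V \<in> \<U>\<close>] by simp
      qed simp
    qed
    then have "(\<integral>\<^sup>+x. ennreal (f x) * indicator (carrier G - S) x \<partial>\<eta>) = (\<integral>\<^sup>+x. 0 \<partial>\<eta>)"
      by (rule nn_integral_cong_AE)
    then show "(\<integral>\<^sup>+x. ennreal (f x) * indicator (carrier G - S) x \<partial>\<eta>) = 0" by simp
  qed
  then have "U \<inter> S \<noteq> {}" using U open_subset by auto
  then show ?thesis using U(1) by (auto simp: S_def)
qed

text \<open>Let y0 be a point of the open set W of \<open>convolution_square_lower_bound\<close>.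
  Two steps charge W with at least c times Haar measure, and k more steps fall near y0^-1 x with
  positive probability. For y in X and h in Y the point y h^-1 lies in W, so every point of X is
  reached in this way.\<close>

lemma walk_lower_bound:
  assumes x: "x \<in> carrier G"
  shows "\<exists>X. openin T X \<and> x \<in> X \<and> (\<exists>k c. 0 < c \<and> (\<forall>\<phi>\<in>borel_measurable \<eta>.
    c * (\<integral>\<^sup>+y. \<phi> y * indicator X y \<partial>\<eta>) \<le> walk k \<phi> \<one>))"
proof -
  have "0 < (\<integral>\<^sup>+x. ennreal (f x) \<partial>\<eta>)" by (simp add: f_int)
  from convolution_square_lower_bound[OF f_measurable this]
  obtain W c where W: "openin T W" "W \<noteq> {}" "0 < c"
    "\<And>\<phi>. \<phi> \<in> borel_measurable \<eta> \<Longrightarrow>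
      c * (\<integral>\<^sup>+x. \<phi> x * indicator W x \<partial>\<eta>) \<le> iter [\<lambda>x. ennreal (f x), \<lambda>x. ennreal (f x)] \<phi> \<one>"
    by metis
  have Ws [measurable]: "W \<in> sets \<eta>" using W(1) open_sets by auto
  obtain y0 where y0: "y0 \<in> W" using W by blast
  then have y0G: "y0 \<in> carrier G" using open_subset[OF W(1)] by auto
  from openin_continuous_map_preimage[OF continuous_quotient W(1)]
  have "openin (prod_topology T T) {p \<in> topspace (prod_topology T T). (case p of (x, y) \<Rightarrow> x \<otimes> inv y) \<in> W}" .
  moreover have "(x, inv y0 \<otimes> x) \<in> {p \<in> topspace (prod_topology T T). (case p of (x, y) \<Rightarrow> x \<otimes> inv y) \<in> W}"
    using x y0 y0G topspace_eq by (simp add: inv_mult_group m_assoc[symmetric])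
  ultimately obtain X Y where XY: "openin T X" "openin T Y" "x \<in> X" "inv y0 \<otimes> x \<in> Y"
    "X \<times> Y \<subseteq> {p \<in> topspace (prod_topology T T). (case p of (x, y) \<Rightarrow> x \<otimes> inv y) \<in> W}"
    unfolding openin_prod_topology_alt by meson
  have quot: "a \<otimes> inv b \<in> W" if "a \<in> X" "b \<in> Y" for a b using XY(5) that by auto
  have [measurable]: "X \<in> sets \<eta>" "Y \<in> sets \<eta>" using XY open_sets by auto
  obtain k where k: "k \<ge> 1" "walk k (indicator Y) \<one> \<noteq> 0" using walk_reaches_open[of Y] XY by blast
  have "replicate k (\<lambda>x. ennreal (f x)) \<noteq> []" using k by simp
  from iter_density[OF this]
  obtain l where l [measurable]: "l \<in> borel_measurable \<eta>"
    and walk_l: "\<And>\<phi> g. \<phi> \<in> borel_measurable \<eta> \<Longrightarrow> g \<in> carrier G \<Longrightarrow> walk k \<phi> g = (\<integral>\<^sup>+h. \<phi> (g \<otimes> h) * l h \<partial>\<eta>)"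
    unfolding walk_def by auto
  obtain m where m: "\<And>h (\<phi> :: 'a \<Rightarrow> ennreal). h \<in> carrier G \<Longrightarrow> \<phi> \<in> borel_measurable \<eta> \<Longrightarrow>
      (\<integral>\<^sup>+x. \<phi> (x \<otimes> h) \<partial>\<eta>) = m h * (\<integral>\<^sup>+x. \<phi> x \<partial>\<eta>)"
    "\<And>h. h \<in> carrier G \<Longrightarrow> 0 < m h" and [measurable]: "m \<in> borel_measurable \<eta>"
    by (rule modular_exists) blast
  \<comment> \<open>For a fixed last displacement h the points y h with y in W are integrated over
    y, and the right translation by h contributes the factor m(h). As m is positive, the mass on Y
    stays positive after this weighting.\<close>
  define d where "d = (\<integral>\<^sup>+h. indicator Y h * l h * m h \<partial>\<eta>)"
  have "d \<noteq> 0"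
  proof
    assume "d = 0"
    then have "AE h in \<eta>. indicator Y h * l h * m h = 0"
      unfolding d_def by (subst (asm) nn_integral_0_iff_AE) auto
    then have "AE h in \<eta>. indicator Y h * l h = 0"
    proof (rule AE_mp, intro AE_I2 impI)
      fix h assume "h \<in> space \<eta>" "indicator Y h * l h * m h = 0"
      then show "indicator Y h * l h = 0" using m(2)[of h] by auto
    qed
    then have "(\<integral>\<^sup>+h. indicator Y h * l h \<partial>\<eta>) = 0" by (subst nn_integral_0_iff_AE) auto
    moreover have "walk k (indicator Y) \<one> = (\<integral>\<^sup>+h. indicator Y h * l h \<partial>\<eta>)"
      by (subst walk_l) (auto intro!: nn_integral_cong)
    ultimately show False using k by simp
  qed
  have "c * d * (\<integral>\<^sup>+y. \<phi> y * indicator X y \<partial>\<eta>) \<le> walk (2 + k) \<phi> \<one>"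
    if \<phi> [measurable]: "\<phi> \<in> borel_measurable \<eta>" for \<phi>
  proof -
    have "d * (\<integral>\<^sup>+y. \<phi> y * indicator X y \<partial>\<eta>)
        = (\<integral>\<^sup>+h. indicator Y h * l h * (m h * (\<integral>\<^sup>+y. \<phi> y * indicator X y \<partial>\<eta>)) \<partial>\<eta>)"
      unfolding d_def by (subst nn_integral_multc[symmetric]) (auto simp: mult.assoc)
    also have "\<dots> = (\<integral>\<^sup>+h. indicator Y h * l h * (\<integral>\<^sup>+y. \<phi> (y \<otimes> h) * indicator X (y \<otimes> h) \<partial>\<eta>) \<partial>\<eta>)"
    proof (rule nn_integral_cong)
      fix h assume "h \<in> space \<eta>"
      then have h: "h \<in> carrier G" by simp
      show "indicator Y h * l h * (m h * (\<integral>\<^sup>+y. \<phi> y * indicator X y \<partial>\<eta>))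
          = indicator Y h * l h * (\<integral>\<^sup>+y. \<phi> (y \<otimes> h) * indicator X (y \<otimes> h) \<partial>\<eta>)"
        by (subst m(1)[OF h, of "\<lambda>y. \<phi> y * indicator X y"]) auto
    qed
    also have "\<dots> = (\<integral>\<^sup>+h. (\<integral>\<^sup>+y. indicator Y h * l h * (\<phi> (y \<otimes> h) * indicator X (y \<otimes> h)) \<partial>\<eta>) \<partial>\<eta>)"
      by (intro nn_integral_cong nn_integral_cmult[symmetric]) auto
    also have "\<dots> = (\<integral>\<^sup>+y. (\<integral>\<^sup>+h. indicator Y h * l h * (\<phi> (y \<otimes> h) * indicator X (y \<otimes> h)) \<partial>\<eta>) \<partial>\<eta>)"
      by (intro haar2.Fubini') measurable
    also have "\<dots> \<le> (\<integral>\<^sup>+y. (\<integral>\<^sup>+h. \<phi> (y \<otimes> h) * l h * indicator W y \<partial>\<eta>) \<partial>\<eta>)"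
    proof (intro nn_integral_mono)
      fix y h assume y: "y \<in> space \<eta>" "h \<in> space \<eta>"
      show "indicator Y h * l h * (\<phi> (y \<otimes> h) * indicator X (y \<otimes> h)) \<le> \<phi> (y \<otimes> h) * l h * indicator W y"
      proof (cases "h \<in> Y \<and> y \<otimes> h \<in> X")
        case True
        then have "y \<in> W" using quot[of "y \<otimes> h" h] y by (simp add: m_assoc)
        then show ?thesis using True by (simp add: mult.commute)
      qed (auto simp: indicator_def)
    qed
    also have "\<dots> = (\<integral>\<^sup>+y. walk k \<phi> y * indicator W y \<partial>\<eta>)"
      by (intro nn_integral_cong) (simp add: walk_l nn_integral_multc)
    finally have "c * (d * (\<integral>\<^sup>+y. \<phi> y * indicator X y \<partial>\<eta>)) \<le> c * (\<integral>\<^sup>+y. walk k \<phi> y * indicator W y \<partial>\<eta>)"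
      by (rule mult_left_mono) simp
    also have "\<dots> \<le> walk 2 (walk k \<phi>) \<one>"
    proof -
      have "walk 2 (walk k \<phi>) = iter [\<lambda>x. ennreal (f x), \<lambda>x. ennreal (f x)] (walk k \<phi>)"
        by (simp add: walk_def numeral_2_eq_2)
      then show ?thesis using W(4)[OF walk_measurable[OF \<phi>]] by simp
    qed
    finally show ?thesis unfolding walk_add mult.assoc .
  qed
  moreover have "0 < c * d" using W(3) \<open>d \<noteq> 0\<close> by (simp add: ennreal_zero_less_mult_iff less_le)
  ultimately show ?thesis using XY by blast
qed

text \<open>Each local bound of \<open>walk_lower_bound\<close> turns
  \<open>walk k \<phi> \<one> \<le> 1\<close> into a bound 1/c for the integral of \<phi> near a
  point; finitely many neighbourhoods cover L.\<close>

lemma compact_upper_bound: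
  assumes L: "compactin T L"
  shows "\<exists>C<\<infinity>. \<forall>\<phi>\<in>borel_measurable \<eta>. (\<forall>n. walk n \<phi> \<one> \<le> 1) \<longrightarrow> (\<integral>\<^sup>+y. \<phi> y * indicator L y \<partial>\<eta>) \<le> C"
proof -
  define good where "good X \<longleftrightarrow> (\<exists>k c. 0 < c \<and> (\<forall>\<phi>\<in>borel_measurable \<eta>.
    c * (\<integral>\<^sup>+y. \<phi> y * indicator X y \<partial>\<eta>) \<le> walk k \<phi> \<one>))" for X
  let ?\<U> = "{X. openin T X \<and> good X}"
  have LG: "L \<subseteq> carrier G" using compactin_subset_topspace[OF L] topspace_eq by simp
  have "L \<subseteq> \<Union>?\<U>"
  proof
    fix x assume "x \<in> L"
    then have "x \<in> carrier G" using LG by blast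
    from walk_lower_bound[OF this] show "x \<in> \<Union>?\<U>" unfolding good_def by blast
  qed
  then have "\<exists>\<F>. finite \<F> \<and> \<F> \<subseteq> ?\<U> \<and> L \<subseteq> \<Union>\<F>"
    using L unfolding compactin_def by (metis (no_types, lifting) mem_Collect_eq)
  then obtain \<F> where \<F>: "finite \<F>" "\<F> \<subseteq> ?\<U>" "L \<subseteq> \<Union>\<F>" by blast
  then have "\<forall>X\<in>\<F>. \<exists>c. 0 < c \<and> (\<exists>k. \<forall>\<phi>\<in>borel_measurable \<eta>. c * (\<integral>\<^sup>+y. \<phi> y * indicator X y \<partial>\<eta>) \<le> walk k \<phi> \<one>)"
    unfolding good_def by blast
  from bchoice[OF this] obtain c where c: "\<And>X. X \<in> \<F> \<Longrightarrow> 0 < c X"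
    "\<And>X. X \<in> \<F> \<Longrightarrow> \<exists>k. \<forall>\<phi>\<in>borel_measurable \<eta>. c X * (\<integral>\<^sup>+y. \<phi> y * indicator X y \<partial>\<eta>) \<le> walk k \<phi> \<one>" by blast
  show ?thesis
  proof (intro exI[of _ "\<Sum>X\<in>\<F>. 1 / c X"] conjI ballI impI)
    show "(\<Sum>X\<in>\<F>. 1 / c X) < \<infinity>"
      using \<F>(1) by (auto simp: less_top[symmetric] ennreal_divide_eq_top_iff dest!: c(1))
    fix \<phi> assume \<phi> [measurable]: "\<phi> \<in> borel_measurable \<eta>" and walk: "\<forall>n. walk n \<phi> \<one> \<le> 1"
    have Xs [measurable]: "X \<in> sets \<eta>" if "X \<in> \<F>" for X using that \<F>(2) open_sets by blast
    have "(\<integral>\<^sup>+y. \<phi> y * indicator L y \<partial>\<eta>) \<le> (\<integral>\<^sup>+y. (\<Sum>X\<in>\<F>. \<phi> y * indicator X y) \<partial>\<eta>)"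
    proof (rule nn_integral_mono)
      fix y show "\<phi> y * indicator L y \<le> (\<Sum>X\<in>\<F>. \<phi> y * indicator X y)"
      proof (cases "y \<in> L")
        case True
        then obtain X where X: "X \<in> \<F>" "y \<in> X" using \<F>(3) by blast
        then have "\<phi> y * indicator X y \<le> (\<Sum>X\<in>\<F>. \<phi> y * indicator X y)"
          using \<F>(1) by (intro member_le_sum) auto
        then show ?thesis using X True by simp
      qed simp
    qed
    also have "\<dots> = (\<Sum>X\<in>\<F>. \<integral>\<^sup>+y. \<phi> y * indicator X y \<partial>\<eta>)"
      using Xs by (intro nn_integral_sum) auto
    also have "\<dots> \<le> (\<Sum>X\<in>\<F>. 1 / c X)"
    proof (rule sum_mono)
      fix X assume X: "X \<in> \<F>"
      obtain k where "c X * (\<integral>\<^sup>+y. \<phi> y * indicator X y \<partial>\<eta>) \<le> walk k \<phi> \<one>" using c(2)[OF X] \<phi> by blast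
      also have "\<dots> \<le> 1" using walk by simp
      finally show "(\<integral>\<^sup>+y. \<phi> y * indicator X y \<partial>\<eta>) \<le> 1 / c X"
        using c(1)[OF X] by (rule le_inverse_ennreal)
    qed
    finally show "(\<integral>\<^sup>+y. \<phi> y * indicator L y \<partial>\<eta>) \<le> (\<Sum>X\<in>\<F>. 1 / c X)" .
  qed
qed

end

context lcsc_haar begin

lemma compact_mult:
  assumes "compactin T K" "compactin T L"
  shows "compactin T ((\<lambda>(x, y). x \<otimes> y) ` (K \<times> L))"
  using assms by (intro image_compactin[OF _ continuous_mult]) (simp add: compactin_Times)

end

context compact_density begin

text \<open>Displacements outside K have density 0, so n steps from M visit only the compact set M K
  ... K.\<close>

lemma walk_local:
  assumes "compactin T M"
  shows "\<exists>L. compactin T L \<and> (\<forall>\<phi> \<psi>. (\<forall>x\<in>L. \<phi> x = \<psi> x) \<longrightarrow> (\<forall>g\<in>M. walk n \<phi> g = walk n \<psi> g))"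
  using assms
proof (induct n arbitrary: M)
  case 0
  then show ?case by (intro exI[of _ M]) simp
next
  case (Suc n)
  have MG: "M \<subseteq> carrier G" using compactin_subset_topspace[OF Suc(2)] topspace_eq by simp
  from Suc(1)[OF compact_mult[OF Suc(2) K]] obtain L where L: "compactin T L"
    "\<And>\<phi> \<psi> g. (\<forall>x\<in>L. \<phi> x = \<psi> x) \<Longrightarrow> g \<in> (\<lambda>(x, y). x \<otimes> y) ` (M \<times> K) \<Longrightarrow> walk n \<phi> g = walk n \<psi> g"
    by blast
  show ?case
  proof (intro exI[of _ L] conjI allI impI ballI L(1))
    fix \<phi> \<psi> :: "'a \<Rightarrow> ennreal" and g assume eq: "\<forall>x\<in>L. \<phi> x = \<psi> x" and g: "g \<in> M"
    show "walk (Suc n) \<phi> g = walk (Suc n) \<psi> g"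
      unfolding walk_Suc
    proof (rule nn_integral_cong)
      fix h assume h: "h \<in> space \<eta>"
      show "walk n \<phi> (g \<otimes> h) * ennreal (f h) = walk n \<psi> (g \<otimes> h) * ennreal (f h)"
      proof (cases "h \<in> K")
        case True
        then have "walk n \<phi> (g \<otimes> h) = walk n \<psi> (g \<otimes> h)"
          using g by (intro L(2)[OF eq]) auto
        then show ?thesis by simp
      next
        case False
        then show ?thesis using f_support[of h] h by simp
      qed
    qed
  qed
qed

lemma harnack_walk:
  assumes n: "2 \<le> n" and fin: "(\<integral>\<^sup>+x. ennreal (f x powr (real n / (real n - 1))) \<partial>\<eta>) < \<infinity>"
    and g: "g \<in> carrier G"
  shows "\<exists>C<\<infinity>. \<forall>\<phi>\<in>borel_measurable \<eta>. (\<forall>k. \<forall>x\<in>carrier G. walk k \<phi> x = \<phi> x) \<longrightarrow> \<phi> \<one> = 1 \<longrightarrow> \<phi> g \<le> C"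
proof -
  obtain C where C: "C < \<infinity>" "\<And>\<phi> g. \<phi> \<in> borel_measurable \<eta> \<Longrightarrow> g \<in> carrier G \<Longrightarrow>
    walk n \<phi> g \<le> C * (\<integral>\<^sup>+x. \<phi> x \<partial>\<eta>)"
    unfolding walk_def using iter_le_haar[OF f_measurable f_nonneg K f_support n fin] by metis
  have "compactin T {g}" using g topspace_eq by (intro finite_imp_compactin) auto
  from walk_local[OF this, of n] obtain L where L: "compactin T L"
    "\<And>\<phi> \<psi>. (\<forall>x\<in>L. \<phi> x = \<psi> x) \<Longrightarrow> walk n \<phi> g = walk n \<psi> g" by auto
  obtain D where D: "D < \<infinity>" "\<And>\<phi>. \<phi> \<in> borel_measurable \<eta> \<Longrightarrow> (\<forall>n. walk n \<phi> \<one> \<le> 1) \<Longrightarrow>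
    (\<integral>\<^sup>+y. \<phi> y * indicator L y \<partial>\<eta>) \<le> D"
    using compact_upper_bound[OF L(1)] by blast
  show ?thesis
  proof (intro exI[of _ "C * D"] conjI ballI impI)
    show "C * D < \<infinity>" using C D by (simp add: ennreal_mult_less_top)
    fix \<phi> assume \<phi> [measurable]: "\<phi> \<in> borel_measurable \<eta>" and inv: "\<forall>k. \<forall>x\<in>carrier G. walk k \<phi> x = \<phi> x"
      and 1: "\<phi> \<one> = 1"
    have [measurable]: "L \<in> sets \<eta>" using L(1) compact_sets by blast
    have "\<phi> g = walk n \<phi> g" using inv g by simp
    \<comment> \<open>The cutoff is what makes the upper bound useful: the integral of \<phi> over
      the whole group may be infinite, its integral over L is at most D.\<close>
    also have "\<dots> = walk n (\<lambda>x. \<phi> x * indicator L x) g" by (rule L(2)) simp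
    also have "\<dots> \<le> C * (\<integral>\<^sup>+x. \<phi> x * indicator L x \<partial>\<eta>)" using g by (intro C(2)) auto
    also have "\<dots> \<le> C * D" using inv 1 by (intro mult_left_mono D(2)) auto
    finally show "\<phi> g \<le> C * D" .
  qed
qed

end

text \<open>This transfers \<open>harnack_walk\<close> to real-valued harmonic functions: a positive
  harmonic u is a fixed point of every \<open>walk k\<close> when its values are read as extended
  nonnegative reals.\<close>

lemma harnack_compact_Lp:
  fixes G :: "('g, 'm) monoid_scheme" and f :: "'g \<Rightarrow> real"
  assumes mg: "measured_group G T \<theta>" and haar: "left_haar_measure G T \<eta>" and p: "1 < p"
    and f: "f \<in> Lp_compact p T \<eta>" "AE x in \<eta>. 0 \<le> f x" and \<theta>: "\<theta> = density \<eta> (\<lambda>x. ennreal (f x))"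
  shows "harnack_inequality G T \<theta>"
proof -
  interpret lcsc_haar G T \<eta>
    using mg haar by unfold_locales (auto simp: measured_group_def)
  interpret prob_space \<theta> using mg by (simp add: measured_group_def)
  have fm [measurable]: "f \<in> borel_measurable \<eta>" using f by (auto simp: Lp_compact_def Lp_def)
  obtain K where K: "compactin T K" "AE x in \<eta>. x \<notin> K \<longrightarrow> f x = 0" using f by (auto simp: Lp_compact_def)
  have Ks [measurable]: "K \<in> sets \<eta>" using K compact_sets by blast
  \<comment> \<open>The conditions on f hold almost everywhere only; the locale asks for a version
    that satisfies them at every point.\<close>
  define f' where "f' x = (if x \<in> K then max 0 (f x) else 0)" for x
  have f'm [measurable]: "f' \<in> borel_measurable \<eta>" unfolding f'_def by measurable
  have f'f: "AE x in \<eta>. f' x = f x" using f(2) K(2) by eventually_elim (auto simp: f'_def)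
  have \<theta>': "\<theta> = density \<eta> (\<lambda>x. ennreal (f' x))"
    unfolding \<theta> using f'f by (intro density_cong) auto
  have \<theta>_int: "(\<integral>\<^sup>+x. \<phi> x \<partial>\<theta>) = (\<integral>\<^sup>+x. \<phi> x * ennreal (f' x) \<partial>\<eta>)" if "\<phi> \<in> borel_measurable \<eta>" for \<phi>
    unfolding \<theta>' using that by (subst nn_integral_density) (auto simp: mult.commute)
  interpret compact_density G T \<eta> f' K
  proof unfold_locales
    show "f' \<in> borel_measurable \<eta>" by fact
    show "0 \<le> f' x" for x by (simp add: f'_def)
    show "compactin T K" by fact
    show "f' x = 0" if "x \<notin> K" for x using that by (simp add: f'_def)
    show "(\<integral>\<^sup>+x. ennreal (f' x) \<partial>\<eta>) = 1"
      using \<theta>_int[of "\<lambda>_. 1"] emeasure_space_1 by simp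
    fix S assume S: "closedin T S" "\<And>x y. x \<in> S \<Longrightarrow> y \<in> S \<Longrightarrow> x \<otimes>\<^bsub>G\<^esub> y \<in> S"
      "(\<integral>\<^sup>+x. ennreal (f' x) * indicator (carrier G - S) x \<partial>\<eta>) = 0"
    have "openin T (carrier G - S)" using S(1) topspace_eq by (metis closedin_def)
    then have [measurable]: "carrier G - S \<in> sets \<eta>" by (rule open_sets)
    have "emeasure \<theta> (carrier G - S) = 0"
      using S(3) by (simp add: \<theta>' emeasure_density)
    moreover have "S \<subseteq> carrier G" using S(1) closedin_subset topspace_eq by blast
    moreover have "\<not> (\<exists>S. closedin T S \<and> S \<subset> carrier G \<and> (\<forall>x\<in>S. \<forall>y\<in>S. x \<otimes>\<^bsub>G\<^esub> y \<in> S) \<and>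
            emeasure \<theta> (carrier G - S) = 0)"
      using mg unfolding measured_group_def admissible_def by (elim conjE)
    ultimately show "S = carrier G" using S(1,2) by blast
  qed
  have "\<exists>n\<ge>2. (\<integral>\<^sup>+x. ennreal (f' x powr (real n / (real n - 1))) \<partial>\<eta>) < \<infinity>"
  proof (cases "p = \<infinity>")
    case True
    then have fin: "Linf_norm \<eta> f < \<infinity>" using f by (auto simp: Lp_compact_def Lp_def)
    then obtain M where M: "Linf_norm \<eta> f = ennreal M" "0 \<le> M" by (cases "Linf_norm \<eta> f") auto
    have "AE x in \<eta>. ennreal \<bar>f x\<bar> \<le> ennreal M"
      unfolding M(1)[symmetric] Linf_norm_def by (rule esssup_AE)
    \<comment> \<open>For p = \<infinity> the choice n = 2, with exponent 2, already works.\<close>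
    then have "AE x in \<eta>. ennreal (f' x powr (real 2 / (real 2 - 1))) \<le> ennreal (M powr 2) * indicator K x"
      by eventually_elim (use M(2) in \<open>auto simp: f'_def intro!: ennreal_leI powr_mono2\<close>)
    then have "(\<integral>\<^sup>+x. ennreal (f' x powr (real 2 / (real 2 - 1))) \<partial>\<eta>) \<le> (\<integral>\<^sup>+x. ennreal (M powr 2) * indicator K x \<partial>\<eta>)"
      by (rule nn_integral_mono_AE)
    also have "\<dots> < \<infinity>" using haar_compact[OF K(1)] by (simp add: nn_integral_cmult_indicator ennreal_mult_less_top)
    finally show ?thesis by (intro exI[of _ 2]) simp
  next
    case False
    then obtain r where r: "p = ennreal r" "1 < r" using p
      by (cases p) (auto simp: ennreal_less_iff simp flip: ennreal_1)
    have fin: "(\<integral>\<^sup>+x. ennreal (\<bar>f x\<bar> powr r) \<partial>\<eta>) < \<infinity>" using f False r by (auto simp: Lp_compact_def Lp_def)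
    \<comment> \<open>The condition n/(n-1) \<le> r amounts to n - 1 \<ge> 1/(r-1); taking n = m + 2
      also secures n \<ge> 2.\<close>
    obtain m :: nat where m: "1 / (r - 1) < real m" using reals_Archimedean2 by blast
    define n where "n = m + 2"
    have "1 / (r - 1) \<le> real n - 1" using m by (simp add: n_def)
    then have q: "real n / (real n - 1) \<le> r" using r by (simp add: n_def field_simps)
    have "AE x in \<eta>. ennreal (f' x powr (real n / (real n - 1))) \<le> indicator K x + ennreal (\<bar>f x\<bar> powr r)"
    proof (rule AE_I2)
      fix x
      show "ennreal (f' x powr (real n / (real n - 1))) \<le> indicator K x + ennreal (\<bar>f x\<bar> powr r)"
      proof (cases "x \<in> K \<and> 0 < f x")
        case True
        \<comment> \<open>The smaller power is at most 1 where f \<le> 1 and at most the larger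
          power elsewhere. The constant 1 is integrable on the compact set K.\<close>
        have "f x powr (real n / (real n - 1)) \<le> 1 + f x powr r"
        proof (cases "f x \<le> 1")
          case True
          then have "f x powr (real n / (real n - 1)) \<le> 1"
            using \<open>x \<in> K \<and> 0 < f x\<close> by (intro powr_le1) (auto simp: n_def)
          then show ?thesis by (simp add: add_increasing2)
        next
          case False
          then have "f x powr (real n / (real n - 1)) \<le> f x powr r"
            using q by (intro powr_mono) auto
          then show ?thesis by simp
        qed
        then have "ennreal (f x powr (real n / (real n - 1))) \<le> ennreal (1 + f x powr r)" by (rule ennreal_leI)
        then show ?thesis using True by (simp add: f'_def max_def)
      qed (auto simp: f'_def max_def)
    qed
    then have "(\<integral>\<^sup>+x. ennreal (f' x powr (real n / (real n - 1))) \<partial>\<eta>) \<le> (\<integral>\<^sup>+x. indicator K x + ennreal (\<bar>f x\<bar> powr r) \<partial>\<eta>)"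
      by (rule nn_integral_mono_AE)
    also have "\<dots> < \<infinity>" using haar_compact[OF K(1)] fin by (subst nn_integral_add) auto
    finally show ?thesis by (intro exI[of _ n]) (simp add: n_def)
  qed
  then obtain n where n: "2 \<le> n" "(\<integral>\<^sup>+x. ennreal (f' x powr (real n / (real n - 1))) \<partial>\<eta>) < \<infinity>" by blast
  show ?thesis
    unfolding harnack_inequality_def
  proof (intro ballI)
    fix g assume g: "g \<in> carrier G"
    obtain C where C: "C < \<infinity>" "\<And>\<phi>. \<phi> \<in> borel_measurable \<eta> \<Longrightarrow>
      (\<forall>k. \<forall>x\<in>carrier G. walk k \<phi> x = \<phi> x) \<Longrightarrow> \<phi> \<one>\<^bsub>G\<^esub> = 1 \<Longrightarrow> \<phi> g \<le> C"
      using harnack_walk[OF n g] by blast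
    have "ennreal (u g) \<le> C" if "u \<in> positive_harmonic G T \<theta>" for u
    proof -
      have u: "u \<in> borel_measurable (borel_of T)" "\<And>x. x \<in> carrier G \<Longrightarrow> 0 < u x" "u \<one>\<^bsub>G\<^esub> = 1"
        "\<And>x. x \<in> carrier G \<Longrightarrow> integrable \<theta> (\<lambda>h. u (x \<otimes>\<^bsub>G\<^esub> h))"
        "\<And>x. x \<in> carrier G \<Longrightarrow> (\<integral>h. u (x \<otimes>\<^bsub>G\<^esub> h) \<partial>\<theta>) = u x"
        using that by (auto simp: positive_harmonic_def harmonic_def)
      have um [measurable]: "u \<in> borel_measurable \<eta>" using u(1) by (simp cong: measurable_cong_sets add: sets_haar)
      have step: "(\<integral>\<^sup>+h. ennreal (u (x \<otimes>\<^bsub>G\<^esub> h)) * ennreal (f' h) \<partial>\<eta>) = ennreal (u x)" if x: "x \<in> carrier G" for x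
      proof -
        have "(\<integral>\<^sup>+h. ennreal (u (x \<otimes>\<^bsub>G\<^esub> h)) * ennreal (f' h) \<partial>\<eta>) = (\<integral>\<^sup>+h. ennreal (u (x \<otimes>\<^bsub>G\<^esub> h)) \<partial>\<theta>)"
          using x by (intro \<theta>_int[symmetric]) auto
        also have "\<dots> = ennreal (\<integral>h. u (x \<otimes>\<^bsub>G\<^esub> h) \<partial>\<theta>)"
          using x u(2) by (intro nn_integral_eq_integral u(4) AE_I2) (auto simp: \<theta> intro: less_imp_le)
        finally show ?thesis using u(5)[OF x] by simp
      qed
      have "walk k (\<lambda>x. ennreal (u x)) x = ennreal (u x)" if "x \<in> carrier G" for k x
        using that
      proof (induct k arbitrary: x)
        case (Suc k)
        have "walk (Suc k) (\<lambda>x. ennreal (u x)) x = (\<integral>\<^sup>+h. ennreal (u (x \<otimes>\<^bsub>G\<^esub> h)) * ennreal (f' h) \<partial>\<eta>)"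
          unfolding walk_Suc using Suc by (intro nn_integral_cong) simp
        then show ?case using step[OF Suc(2)] by simp
      qed simp
      then show ?thesis using u(3) by (intro C(2)) auto
    qed
    then have "harmonic_majorant G T \<theta> g \<le> C" unfolding harmonic_majorant_def by (intro SUP_least)
    then show "harmonic_majorant G T \<theta> g < \<infinity>" using C(1) by (rule le_less_trans)
  qed
qed

section \<open>A random affine recursion\<close>

text \<open>The exponent -2/3 makes both \<open>A\<close> and \<open>B\<close> so likely to be small that the law of the series
  below is not bounded by Lebesgue measure near 0; the exponent -3 gives \<open>A\<close> and \<open>B\<close> a mean.
  Any pair of powers makes \<open>log A\<close> a Laplace variable.\<close>

definition scale_density :: "real \<Rightarrow> real" where
  "scale_density a = (if a \<le> 0 then 0 else 2 / 7 * (if a < 1 then a powr (-2/3) else a powr -3))"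

definition scale_law :: "real measure" where
  "scale_law = density lborel (\<lambda>a. ennreal (scale_density a))"

definition shift_law :: "real measure" where
  "shift_law = density lborel (\<lambda>b. ennreal (scale_density \<bar>b\<bar> / 2))"

definition step_law :: "(real \<times> real) measure" where
  "step_law = scale_law \<Otimes>\<^sub>M shift_law"

lemma scale_density_measurable [measurable]: "scale_density \<in> borel_measurable borel"
  unfolding scale_density_def by measurable

lemma scale_density_nonneg: "0 \<le> scale_density a"
  by (simp add: scale_density_def)

lemma scale_density_pos: "0 < a \<Longrightarrow> 0 < scale_density a"
  by (simp add: scale_density_def)

lemma sets_scale_law [measurable_cong, simp]: "sets scale_law = sets borel"
  and sets_shift_law [measurable_cong, simp]: "sets shift_law = sets borel"
  by (simp_all add: scale_law_def shift_law_def)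

lemma space_scale_law [simp]: "space scale_law = UNIV"
  and space_shift_law [simp]: "space shift_law = UNIV"
  by (simp_all add: scale_law_def shift_law_def)

lemma sets_step_law [measurable_cong]: "sets step_law = sets (borel \<Otimes>\<^sub>M borel)"
  unfolding step_law_def by (intro sets_pair_measure_cong) simp_all

lemma space_step_law [simp]: "space step_law = UNIV"
  by (simp add: step_law_def space_pair_measure)

lemma nn_integral_powr_0:
  assumes "a > -1" "c \<ge> 0"
  shows "(\<integral>\<^sup>+x. ennreal (x powr a) * indicator {0..c} x \<partial>lborel) = ennreal (c powr (a + 1) / (a + 1))"
  using has_integral_powr_from_0[OF assms] by (intro nn_integral_has_integral_lebesgue') auto

lemma nn_integral_powr_inf:
  assumes "a < -1" "c > 0"
  shows "(\<integral>\<^sup>+x. ennreal (x powr a) * indicator {c..} x \<partial>lborel) = ennreal (- (c powr (a + 1)) / (a + 1))"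
  using has_integral_powr_to_inf[OF assms] by (intro nn_integral_has_integral_lebesgue') auto

text \<open>For k = 0 the bracket is 3 + 1/2 = 7/2, which explains the normalising factor 2/7; for k
  = 1 it is 3/4 + 1 = 7/4, which gives the mean 1/2.\<close>

lemma nn_integral_scale_moment:
  assumes k: "k < 2" "k \<ge> 0"
  shows "(\<integral>\<^sup>+x. ennreal (x powr k * scale_density x) \<partial>lborel) = ennreal (2 / 7 * (1 / (k + 1/3) + 1 / (2 - k)))"
proof -
  have "(\<integral>\<^sup>+x. ennreal (x powr k * scale_density x) \<partial>lborel)
    = (\<integral>\<^sup>+x. ennreal (2/7) * (ennreal (x powr (k - 2/3)) * indicator {0..1} x + ennreal (x powr (k - 3)) * indicator {1..} x) \<partial>lborel)"
  proof (rule nn_integral_cong_AE)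
    have "AE x in lborel. x \<noteq> (1::real)" by (rule AE_lborel_singleton)
    then show "AE x in lborel. ennreal (x powr k * scale_density x)
      = ennreal (2/7) * (ennreal (x powr (k - 2/3)) * indicator {0..1} x + ennreal (x powr (k - 3)) * indicator {1..} x)"
      by eventually_elim
        (auto simp: scale_density_def indicator_def ennreal_mult[symmetric] powr_add[symmetric] mult.left_commute)
  qed
  also have "\<dots> = ennreal (2/7) * (ennreal (1 / (k + 1/3)) + ennreal (1 / (2 - k)))"
    using k nn_integral_powr_0[of "k - 2/3" 1] nn_integral_powr_inf[of "k - 3" 1]
    by (simp add: nn_integral_cmult nn_integral_add minus_divide_right add.commute[of "1/3"])
  also have "\<dots> = ennreal (2 / 7 * (1 / (k + 1/3) + 1 / (2 - k)))"
    using k by (simp add: ennreal_mult[symmetric] ennreal_plus[symmetric] del: ennreal_plus)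
  finally show ?thesis .
qed

lemma nn_integral_scale_density: "(\<integral>\<^sup>+x. ennreal (scale_density x) \<partial>lborel) = 1"
proof -
  have "ennreal (x powr 0 * scale_density x) = ennreal (scale_density x)" for x
    by (cases "x = 0") (auto simp: scale_density_def)
  then show ?thesis using nn_integral_scale_moment[of 0] by simp
qed

lemma nn_integral_scale_mean: "(\<integral>\<^sup>+x. ennreal (x * scale_density x) \<partial>lborel) = ennreal (1/2)"
proof -
  have "ennreal (x powr 1 * scale_density x) = ennreal (x * scale_density x)" for x
    by (cases "0 < x") (auto simp: scale_density_def)
  then show ?thesis using nn_integral_scale_moment[of 1] by simp
qed

lemma nn_integral_even:
  fixes f :: "real \<Rightarrow> ennreal"
  assumes [measurable]: "f \<in> borel_measurable borel" and f: "f 0 = 0"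
  shows "(\<integral>\<^sup>+x. f \<bar>x\<bar> \<partial>lborel) = 2 * (\<integral>\<^sup>+x. f x * indicator {0..} x \<partial>lborel)"
proof -
  have "(\<integral>\<^sup>+x. f \<bar>x\<bar> \<partial>lborel)
    = (\<integral>\<^sup>+x. f x * indicator {0..} x + f (- x) * indicator {0..} (- x) \<partial>lborel)"
    using f by (intro nn_integral_cong) (auto simp: indicator_def abs_if)
  also have "\<dots> = (\<integral>\<^sup>+x. f x * indicator {0..} x \<partial>lborel) + (\<integral>\<^sup>+x. f (- x) * indicator {0..} (- x) \<partial>lborel)"
    by (intro nn_integral_add) auto
  also have "(\<integral>\<^sup>+x. f (- x) * indicator {0..} (- x) \<partial>lborel) = (\<integral>\<^sup>+x. f x * indicator {0..} x \<partial>lborel)"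
    using nn_integral_real_affine[of "\<lambda>x. f x * indicator {0..} x" "-1" 0] by simp
  finally show ?thesis by (simp add: mult_2)
qed

lemma nn_integral_shift_law:
  assumes [measurable]: "f \<in> borel_measurable borel"
  shows "(\<integral>\<^sup>+x. f \<bar>x\<bar> \<partial>shift_law) = (\<integral>\<^sup>+x. f x \<partial>scale_law)"
proof -
  let ?f = "\<lambda>x. ennreal (scale_density x / 2) * f x"
  have "(\<integral>\<^sup>+x. f \<bar>x\<bar> \<partial>shift_law) = (\<integral>\<^sup>+x. ?f \<bar>x\<bar> \<partial>lborel)"
    unfolding shift_law_def by (subst nn_integral_density) auto
  also have "\<dots> = (\<integral>\<^sup>+x. 2 * (?f x * indicator {0..} x) \<partial>lborel)"
    by (subst nn_integral_even) (auto simp: scale_density_def nn_integral_cmult)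
  also have "\<dots> = (\<integral>\<^sup>+x. ennreal (scale_density x) * f x \<partial>lborel)"
  proof (rule nn_integral_cong)
    fix x :: real
    have "2 * ennreal (scale_density x / 2) = ennreal (scale_density x)"
      using scale_density_nonneg[of x] ennreal_mult[of 2 "scale_density x / 2"] by simp
    then show "2 * (?f x * indicator {0..} x) = ennreal (scale_density x) * f x"
      by (cases "0 \<le> x") (auto simp: scale_density_def mult.assoc[symmetric])
  qed
  also have "\<dots> = (\<integral>\<^sup>+x. f x \<partial>scale_law)"
    unfolding scale_law_def by (subst nn_integral_density) auto
  finally show ?thesis .
qed

interpretation scale: prob_space scale_law
  by (rule prob_spaceI) (simp add: scale_law_def emeasure_density nn_integral_scale_density)

interpretation shift: prob_space shift_law
proof (rule prob_spaceI)
  have "emeasure shift_law (space shift_law) = (\<integral>\<^sup>+x. 1 \<partial>shift_law)" by simp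
  also have "\<dots> = (\<integral>\<^sup>+x. 1 \<partial>scale_law)" by (rule nn_integral_shift_law) simp
  finally show "emeasure shift_law (space shift_law) = 1" using scale.emeasure_space_1 by simp
qed

interpretation step: pair_prob_space scale_law shift_law ..

interpretation step_law: prob_space step_law
  unfolding step_law_def by (rule step.prob_space_axioms)

lemma nn_integral_step_law:
  assumes "f \<in> borel_measurable (borel \<Otimes>\<^sub>M borel)"
  shows "(\<integral>\<^sup>+h. f h \<partial>step_law) = (\<integral>\<^sup>+a. (\<integral>\<^sup>+b. f (a, b) \<partial>shift_law) \<partial>scale_law)"
proof -
  have "f \<in> borel_measurable (scale_law \<Otimes>\<^sub>M shift_law)"
    using assms by (simp cong: measurable_cong_sets add: sets_pair_measure_cong[OF sets_scale_law sets_shift_law])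
  then show ?thesis unfolding step_law_def by (rule shift.nn_integral_fst[symmetric])
qed

lemma AE_scale_law_pos: "AE a in scale_law. 0 < a"
proof -
  have "AE a in lborel. 0 < ennreal (scale_density a) \<longrightarrow> 0 < a"
    by (auto simp: scale_density_def)
  then show ?thesis unfolding scale_law_def by (subst AE_density) auto
qed

lemma scale_law_mean: "(\<integral>\<^sup>+a. ennreal \<bar>a\<bar> \<partial>scale_law) = ennreal (1/2)"
proof -
  have "(\<integral>\<^sup>+a. ennreal \<bar>a\<bar> \<partial>scale_law) = (\<integral>\<^sup>+a. ennreal (a * scale_density a) \<partial>lborel)"
    unfolding scale_law_def
    by (subst nn_integral_density)
      (auto intro!: nn_integral_cong simp: ennreal_mult[symmetric] scale_density_def mult.commute)
  then show ?thesis by (simp add: nn_integral_scale_mean)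
qed

lemma shift_law_mean: "(\<integral>\<^sup>+b. ennreal \<bar>b\<bar> \<partial>shift_law) = ennreal (1/2)"
proof -
  have "(\<integral>\<^sup>+b. ennreal \<bar>b\<bar> \<partial>shift_law) = (\<integral>\<^sup>+b. ennreal b \<partial>scale_law)"
    by (rule nn_integral_shift_law) simp
  also have "\<dots> = (\<integral>\<^sup>+b. ennreal \<bar>b\<bar> \<partial>scale_law)"
    using AE_scale_law_pos by (intro nn_integral_cong_AE) auto
  finally show ?thesis by (simp add: scale_law_mean)
qed

lemma scale_law_near_0:
  assumes "0 < e" "e \<le> 1"
  shows "ennreal (6/7 * e powr (1/3)) \<le> emeasure scale_law {..<e}"
proof -
  have "ennreal (6/7 * e powr (1/3)) = ennreal (2/7) * ennreal (e powr (-2/3 + 1) / (-2/3 + 1))"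
    using assms by (simp add: ennreal_mult[symmetric])
  also have "\<dots> = (\<integral>\<^sup>+x. ennreal (2/7) * (ennreal (x powr (-2/3)) * indicator {0..e} x) \<partial>lborel)"
    using assms nn_integral_powr_0[of "-2/3" e] by (subst nn_integral_cmult) auto
  also have "\<dots> = (\<integral>\<^sup>+x. ennreal (scale_density x) * indicator {..<e} x \<partial>lborel)"
  proof (rule nn_integral_cong_AE)
    have "AE x in lborel. x \<noteq> e" by (rule AE_lborel_singleton)
    then show "AE x in lborel. ennreal (2/7) * (ennreal (x powr (-2/3)) * indicator {0..e} x)
        = ennreal (scale_density x) * indicator {..<e} x"
      by eventually_elim
       (use assms in \<open>auto simp: scale_density_def indicator_def ennreal_mult[symmetric]\<close>)
  qed
  also have "\<dots> = emeasure scale_law {..<e}"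
    unfolding scale_law_def by (subst emeasure_density) auto
  finally show ?thesis by simp
qed

lemma shift_law_near_0:
  assumes "0 < e" "e \<le> 1"
  shows "ennreal (6/7 * e powr (1/3)) \<le> emeasure shift_law {-e<..<e}"
proof -
  have "emeasure scale_law {..<e} = (\<integral>\<^sup>+x. indicator {..<e} x \<partial>scale_law)" by simp
  also have "\<dots> = (\<integral>\<^sup>+x. indicator {..<e} \<bar>x\<bar> \<partial>shift_law)" by (rule nn_integral_shift_law[symmetric]) simp
  also have "\<dots> = (\<integral>\<^sup>+x. indicator {-e<..<e} x \<partial>shift_law)"
    by (intro nn_integral_cong) (auto simp: indicator_def abs_less_iff)
  finally show ?thesis using scale_law_near_0[OF assms] by simp
qed

section \<open>The random series and its law\<close>

definition series_term :: "nat \<Rightarrow> (real \<times> real) stream \<Rightarrow> real" where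
  "series_term n \<omega> = (\<Prod>k<n. fst (\<omega> !! k)) * snd (\<omega> !! n)"

definition limit_point :: "(real \<times> real) stream \<Rightarrow> real" where
  "limit_point \<omega> = (\<Sum>n. series_term n \<omega>)"

definition hitting_measure :: "real measure" where
  "hitting_measure = distr (stream_space step_law) borel limit_point"

lemma series_term_measurable [measurable]: "series_term n \<in> borel_measurable (stream_space step_law)"
  unfolding series_term_def by measurable

lemma limit_point_measurable [measurable]: "limit_point \<in> borel_measurable (stream_space step_law)"
  unfolding limit_point_def by measurable

lemma series_term_0: "series_term 0 (h ## \<omega>) = snd h"
  by (simp add: series_term_def)

lemma series_term_Suc: "series_term (Suc n) (h ## \<omega>) = fst h * series_term n \<omega>"
  unfolding series_term_def by (subst prod.lessThan_Suc_shift) simp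

interpretation paths: prob_space "stream_space step_law"
  by (rule step_law.prob_space_stream_space)

text \<open>The term is a product of n + 1 independent factors, n scales and one shift, each with
  mean absolute value 1/2. The induction splits off the first step of the path.\<close>

lemma series_term_mean: "(\<integral>\<^sup>+\<omega>. ennreal \<bar>series_term n \<omega>\<bar> \<partial>stream_space step_law) = ennreal ((1/2) ^ Suc n)"
proof (induct n)
  case 0
  have "(\<integral>\<^sup>+\<omega>. ennreal \<bar>series_term 0 \<omega>\<bar> \<partial>stream_space step_law) = (\<integral>\<^sup>+h. ennreal \<bar>snd h\<bar> \<partial>step_law)"
    by (subst step_law.nn_integral_stream_space) (simp_all add: series_term_0 paths.emeasure_space_1)
  also have "\<dots> = ennreal (1/2)"
    by (subst nn_integral_step_law) (simp_all add: shift_law_mean scale.emeasure_space_1[simplified])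
  finally show ?case by simp
next
  case (Suc n)
  have "(\<integral>\<^sup>+\<omega>. ennreal \<bar>series_term (Suc n) \<omega>\<bar> \<partial>stream_space step_law)
      = (\<integral>\<^sup>+h. (\<integral>\<^sup>+\<omega>. ennreal \<bar>fst h\<bar> * ennreal \<bar>series_term n \<omega>\<bar> \<partial>stream_space step_law) \<partial>step_law)"
    by (subst step_law.nn_integral_stream_space) (simp_all add: series_term_Suc abs_mult ennreal_mult)
  also have "\<dots> = (\<integral>\<^sup>+h. ennreal \<bar>fst h\<bar> * ennreal ((1/2) ^ Suc n) \<partial>step_law)"
    by (intro nn_integral_cong) (subst nn_integral_cmult, simp_all only: Suc, measurable)
  also have "\<dots> = (\<integral>\<^sup>+h. ennreal \<bar>fst h\<bar> \<partial>step_law) * ennreal ((1/2) ^ Suc n)"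
    by (intro nn_integral_multc) measurable
  also have "(\<integral>\<^sup>+h. ennreal \<bar>fst h\<bar> \<partial>step_law) = ennreal (1/2)"
    by (subst nn_integral_step_law) (simp_all add: scale_law_mean shift.emeasure_space_1[simplified])
  also have "ennreal (1/2) * ennreal ((1/2) ^ Suc n) = ennreal ((1/2) ^ Suc (Suc n))"
    by (subst ennreal_mult[symmetric]) auto
  finally show ?case .
qed

lemma series_abs_mean: "(\<integral>\<^sup>+\<omega>. (\<Sum>n. ennreal \<bar>series_term n \<omega>\<bar>) \<partial>stream_space step_law) = 1"
proof -
  have "(\<integral>\<^sup>+\<omega>. (\<Sum>n. ennreal \<bar>series_term n \<omega>\<bar>) \<partial>stream_space step_law) = (\<Sum>n. ennreal ((1/2) ^ Suc n))"
    by (subst nn_integral_suminf) (simp_all add: series_term_mean)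
  also have "\<dots> = ennreal (\<Sum>n. (1/2) ^ Suc n)"
    by (intro suminf_ennreal2) (auto intro!: summable_mult summable_geometric)
  also have "(\<Sum>n. (1/2) ^ Suc n) = (1::real)" using sums_unique[OF power_half_series] by simp
  finally show ?thesis by simp
qed

lemma AE_summable_series: "AE \<omega> in stream_space step_law. summable (\<lambda>n. \<bar>series_term n \<omega>\<bar>)"
proof -
  have "AE \<omega> in stream_space step_law. (\<Sum>n. ennreal \<bar>series_term n \<omega>\<bar>) \<noteq> \<infinity>"
    using series_abs_mean by (intro nn_integral_PInf_AE) auto
  then show ?thesis
    by eventually_elim (auto intro: summable_suminf_not_top)
qed

text \<open>This recursion is the source of stationarity. \<open>suminf\<close> has no specified
  value on a divergent series, so the recursion is confined to paths with a summable series, which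
  have full measure.\<close>

lemma limit_point_Stream:
  assumes "summable (\<lambda>n. \<bar>series_term n \<omega>\<bar>)"
  shows "limit_point (h ## \<omega>) = fst h * limit_point \<omega> + snd h"
proof -
  have s: "summable (\<lambda>n. series_term n \<omega>)" using assms by (rule summable_rabs_cancel)
  then have "summable (\<lambda>n. series_term (Suc n) (h ## \<omega>))"
    unfolding series_term_Suc by (rule summable_mult)
  then have "summable (\<lambda>n. series_term n (h ## \<omega>))" by (rule iffD1[OF summable_Suc_iff])
  from suminf_split_head[OF this] show ?thesis
    using suminf_mult[OF s, of "fst h"] by (simp add: limit_point_def series_term_Suc series_term_0)
qed

lemma sets_hitting_measure [measurable_cong, simp]: "sets hitting_measure = sets borel"
  and space_hitting_measure [simp]: "space hitting_measure = UNIV"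
  by (simp_all add: hitting_measure_def)

interpretation hitting: prob_space hitting_measure
  unfolding hitting_measure_def by (rule paths.prob_space_distr) measurable

lemma hitting_stationary:
  assumes [measurable]: "\<phi> \<in> borel_measurable borel"
  shows "(\<integral>\<^sup>+x. \<phi> x \<partial>hitting_measure) = (\<integral>\<^sup>+h. (\<integral>\<^sup>+x. \<phi> (fst h * x + snd h) \<partial>hitting_measure) \<partial>step_law)"
proof -
  have "(\<integral>\<^sup>+x. \<phi> x \<partial>hitting_measure) = (\<integral>\<^sup>+\<omega>. \<phi> (limit_point \<omega>) \<partial>stream_space step_law)"
    unfolding hitting_measure_def by (intro nn_integral_distr) measurable
  also have "\<dots> = (\<integral>\<^sup>+h. (\<integral>\<^sup>+\<omega>. \<phi> (limit_point (h ## \<omega>)) \<partial>stream_space step_law) \<partial>step_law)"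
    by (intro step_law.nn_integral_stream_space) measurable
  also have "\<dots> = (\<integral>\<^sup>+h. (\<integral>\<^sup>+\<omega>. \<phi> (fst h * limit_point \<omega> + snd h) \<partial>stream_space step_law) \<partial>step_law)"
  proof (rule nn_integral_cong, rule nn_integral_cong_AE)
    fix h
    show "AE \<omega> in stream_space step_law. \<phi> (limit_point (h ## \<omega>)) = \<phi> (fst h * limit_point \<omega> + snd h)"
      using AE_summable_series by eventually_elim (simp add: limit_point_Stream)
  qed
  also have "\<dots> = (\<integral>\<^sup>+h. (\<integral>\<^sup>+x. \<phi> (fst h * x + snd h) \<partial>hitting_measure) \<partial>step_law)"
    unfolding hitting_measure_def by (intro nn_integral_cong nn_integral_distr[symmetric]) measurable
  finally show ?thesis .
qed

lemma hitting_mean: "(\<integral>\<^sup>+x. ennreal \<bar>x\<bar> \<partial>hitting_measure) \<le> 1"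
proof -
  have "(\<integral>\<^sup>+x. ennreal \<bar>x\<bar> \<partial>hitting_measure) = (\<integral>\<^sup>+\<omega>. ennreal \<bar>limit_point \<omega>\<bar> \<partial>stream_space step_law)"
    unfolding hitting_measure_def by (intro nn_integral_distr) measurable
  also have "\<dots> \<le> (\<integral>\<^sup>+\<omega>. (\<Sum>n. ennreal \<bar>series_term n \<omega>\<bar>) \<partial>stream_space step_law)"
  proof (rule nn_integral_mono_AE)
    show "AE \<omega> in stream_space step_law. ennreal \<bar>limit_point \<omega>\<bar> \<le> (\<Sum>n. ennreal \<bar>series_term n \<omega>\<bar>)"
      using AE_summable_series
      by eventually_elim (simp add: limit_point_def suminf_ennreal2 summable_rabs ennreal_leI)
  qed
  finally show ?thesis by (simp add: series_abs_mean)
qed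

section \<open>Null sets and small intervals under the hitting measure\<close>

lemma emeasure_translate_lborel:
  fixes E :: "real set"
  assumes "E \<in> sets borel"
  shows "(\<integral>\<^sup>+x. indicator E (t + x) \<partial>lborel) = emeasure lborel E"
  using nn_integral_real_affine[of "indicator E" 1 t] assms by simp

text \<open>The density of B vanishes only at 0, so the law of t + B has exactly the Lebesgue null
  sets.\<close>

lemma shift_law_null_iff:
  fixes E :: "real set"
  assumes [measurable]: "E \<in> sets borel"
  shows "(\<integral>\<^sup>+b. indicator E (t + b) \<partial>shift_law) = 0 \<longleftrightarrow> emeasure lborel E = 0"
proof -
  have "(\<integral>\<^sup>+b. indicator E (t + b) \<partial>shift_law) = (\<integral>\<^sup>+b. ennreal (scale_density \<bar>b\<bar> / 2) * indicator E (t + b) \<partial>lborel)"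
    unfolding shift_law_def by (subst nn_integral_density) auto
  also have "\<dots> = 0 \<longleftrightarrow> (AE b in lborel. ennreal (scale_density \<bar>b\<bar> / 2) * indicator E (t + b) = 0)"
    by (intro nn_integral_0_iff_AE) measurable
  also have "\<dots> \<longleftrightarrow> (AE b in lborel. indicator E (t + b) = (0::ennreal))"
  proof -
    have "AE b in lborel. b \<noteq> (0::real)" by (rule AE_lborel_singleton)
    then have "AE b in lborel. ennreal (scale_density \<bar>b\<bar> / 2) * indicator E (t + b) = 0 \<longleftrightarrow> indicator E (t + b) = (0::ennreal)"
    proof eventually_elim
      fix b :: real assume "b \<noteq> 0"
      then have "ennreal (scale_density \<bar>b\<bar> / 2) \<noteq> 0" using scale_density_pos[of "\<bar>b\<bar>"] by (simp add: ennreal_eq_0_iff)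
      then show "ennreal (scale_density \<bar>b\<bar> / 2) * indicator E (t + b) = 0 \<longleftrightarrow> indicator E (t + b) = (0::ennreal)" by simp
    qed
    then show ?thesis by (rule eventually_subst)
  qed
  also have "\<dots> \<longleftrightarrow> (\<integral>\<^sup>+b. indicator E (t + b) \<partial>lborel) = 0"
    by (intro nn_integral_0_iff_AE[symmetric]) measurable
  finally show ?thesis by (simp add: emeasure_translate_lborel)
qed

interpretation shift_hitting: pair_sigma_finite shift_law hitting_measure ..

lemma emeasure_hitting:
  assumes [measurable]: "E \<in> sets borel"
  shows "emeasure hitting_measure E
    = (\<integral>\<^sup>+a. (\<integral>\<^sup>+x. (\<integral>\<^sup>+b. indicator E (a * x + b) \<partial>shift_law) \<partial>hitting_measure) \<partial>scale_law)"
proof -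
  have "emeasure hitting_measure E = (\<integral>\<^sup>+x. indicator E x \<partial>hitting_measure)" by simp
  also have "\<dots> = (\<integral>\<^sup>+h. (\<integral>\<^sup>+x. indicator E (fst h * x + snd h) \<partial>hitting_measure) \<partial>step_law)"
    by (rule hitting_stationary) measurable
  also have "\<dots> = (\<integral>\<^sup>+a. (\<integral>\<^sup>+b. (\<integral>\<^sup>+x. indicator E (a * x + b) \<partial>hitting_measure) \<partial>shift_law) \<partial>scale_law)"
    by (subst nn_integral_step_law) simp_all
  also have "\<dots> = (\<integral>\<^sup>+a. (\<integral>\<^sup>+x. (\<integral>\<^sup>+b. indicator E (a * x + b) \<partial>shift_law) \<partial>hitting_measure) \<partial>scale_law)"
    by (intro nn_integral_cong shift_hitting.Fubini'[symmetric]) measurable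
  finally show ?thesis .
qed

text \<open>By stationarity the hitting measure is a mixture, over a and x, of the laws of a x + B,
  and each of these is equivalent to Lebesgue measure. For the direction from left to right a single
  pair (a, x) with vanishing mass suffices.\<close>

lemma hitting_null_iff:
  assumes E [measurable]: "E \<in> sets borel"
  shows "emeasure hitting_measure E = 0 \<longleftrightarrow> emeasure lborel E = 0"
proof
  assume "emeasure lborel E = 0"
  then have "(\<integral>\<^sup>+b. indicator E (t + b) \<partial>shift_law) = 0" for t
    unfolding shift_law_null_iff[OF E] .
  then show "emeasure hitting_measure E = 0" unfolding emeasure_hitting[OF E] by (simp only: nn_integral_const mult_zero_left)
next
  assume "emeasure hitting_measure E = 0"
  then have "AE a in scale_law. (\<integral>\<^sup>+x. (\<integral>\<^sup>+b. indicator E (a * x + b) \<partial>shift_law) \<partial>hitting_measure) = 0"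
    unfolding emeasure_hitting[OF E] by (subst (asm) nn_integral_0_iff_AE) auto
  then have "\<exists>a. (\<integral>\<^sup>+x. (\<integral>\<^sup>+b. indicator E (a * x + b) \<partial>shift_law) \<partial>hitting_measure) = 0"
    by (rule eventually_happens'[OF scale.ae_filter_bot])
  then obtain a where "(\<integral>\<^sup>+x. (\<integral>\<^sup>+b. indicator E (a * x + b) \<partial>shift_law) \<partial>hitting_measure) = 0" by blast
  then have "AE x in hitting_measure. (\<integral>\<^sup>+b. indicator E (a * x + b) \<partial>shift_law) = 0"
    by (subst (asm) nn_integral_0_iff_AE) auto
  then have "\<exists>x. (\<integral>\<^sup>+b. indicator E (a * x + b) \<partial>shift_law) = 0"
    by (rule eventually_happens'[OF hitting.ae_filter_bot])
  then show "emeasure lborel E = 0" unfolding shift_law_null_iff[OF E] by blast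
qed

text \<open>By stationarity the measure is the law of A X + B with X independent of A and B. If A <
  e/4, |X| \<le> 2 and |B| < e/2, then |A X + B| < e. The events for A and B have probabilities of
  order e^(1/3); the event for X has probability at least 1/2 by Markov's inequality. For the
  constant, (e/4)^(1/3) (e/2)^(1/3) = e^(2/3)/2 and (6/7)^2 (1/2) (1/2) = 9/49 > 1/16.\<close>

lemma hitting_near_0:
  assumes e: "0 < e" "e \<le> 1"
  shows "ennreal (e powr (2/3) / 16) \<le> emeasure hitting_measure {-e<..<e}"
proof -
  have half: "ennreal (1/2) \<le> emeasure hitting_measure {-2..2}"
  proof -
    have "2 * emeasure hitting_measure (- {-2..2}) = (\<integral>\<^sup>+x. 2 * indicator (- {-2..2}) x \<partial>hitting_measure)"
      by (subst nn_integral_cmult) auto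
    also have "\<dots> \<le> (\<integral>\<^sup>+x. ennreal \<bar>x\<bar> \<partial>hitting_measure)"
      by (intro nn_integral_mono) (auto simp: indicator_def simp flip: ennreal_numeral intro!: ennreal_leI)
    finally have "2 * emeasure hitting_measure (- {-2..2}) \<le> 1" using hitting_mean by simp
    then have "2 * hitting.prob (- {-2..2}) \<le> 1"
      by (simp add: hitting.emeasure_eq_measure ennreal_mult[symmetric] flip: ennreal_numeral ennreal_1)
    moreover have "hitting.prob (- {-2..2}) = 1 - hitting.prob {-2..2}"
      using hitting.prob_compl[of "{-2..2}"] by (simp add: Compl_eq_Diff_UNIV)
    ultimately have "1/2 \<le> hitting.prob {-2..2}" by simp
    then show ?thesis unfolding hitting.emeasure_eq_measure by (rule ennreal_leI)
  qed
  let ?A = "{..<e/4}" and ?B = "{-(e/2)<..<e/2}"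
  have "ennreal (e powr (2/3) / 16) \<le> ennreal (6/7 * (e/4) powr (1/3)) * ennreal (6/7 * (e/2) powr (1/3)) * ennreal (1/2)"
  proof -
    have "(e/4) powr (1/3) * (e/2) powr (1/3) = (e^2 / 8) powr (1/3)"
      using e by (subst powr_mult[symmetric]) (auto simp: power2_eq_square)
    also have "\<dots> = (e^2) powr (1/3) / 8 powr (1/3)" using e by (subst powr_divide) auto
    also have "(e^2) powr (1/3) = e powr (2/3)" using e by (simp add: powr_powr flip: powr_numeral)
    also have "8 powr (1/3) = (2 powr 3) powr (1/3::real)" by simp
    also have "\<dots> = 2" by (subst powr_powr) simp
    finally have eq: "(e/4) powr (1/3) * (e/2) powr (1/3) = e powr (2/3) / 2" .
    have "e powr (2/3) / 16 \<le> (6/7)^2 * (e powr (2/3) / 2) * (1/2)" by (simp add: power2_eq_square)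
    also have "\<dots> = 6/7 * (e/4) powr (1/3) * (6/7 * (e/2) powr (1/3)) * (1/2)"
      unfolding eq[symmetric] by (simp add: power2_eq_square)
    finally have "ennreal (e powr (2/3) / 16) \<le> ennreal (6/7 * (e/4) powr (1/3) * (6/7 * (e/2) powr (1/3)) * (1/2))"
      by (rule ennreal_leI)
    also have "\<dots> = ennreal (6/7 * (e/4) powr (1/3)) * ennreal (6/7 * (e/2) powr (1/3)) * ennreal (1/2)"
      by (simp only: ennreal_mult mult_nonneg_nonneg powr_ge_zero divide_nonneg_nonneg zero_le_numeral zero_le_one)
    finally show ?thesis .
  qed
  also have "\<dots> \<le> emeasure scale_law ?A * emeasure shift_law ?B * emeasure hitting_measure {-2..2}"
    using e half by (intro mult_mono scale_law_near_0 shift_law_near_0) auto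
  also have "\<dots> = (\<integral>\<^sup>+a. indicator ?A a * (emeasure shift_law ?B * emeasure hitting_measure {-2..2}) \<partial>scale_law)"
    by (subst nn_integral_multc) (auto simp: mult.assoc)
  also have "\<dots> = (\<integral>\<^sup>+a. (\<integral>\<^sup>+x. indicator ?A a * (emeasure shift_law ?B * indicator {-2..2} x) \<partial>hitting_measure) \<partial>scale_law)"
    by (intro nn_integral_cong) (simp add: nn_integral_cmult)
  also have "\<dots> = (\<integral>\<^sup>+a. (\<integral>\<^sup>+x. (\<integral>\<^sup>+b. indicator ?A a * (indicator {-2..2} x * indicator ?B b) \<partial>shift_law) \<partial>hitting_measure) \<partial>scale_law)"
    by (intro nn_integral_cong) (simp add: nn_integral_cmult mult.commute)
  also have "\<dots> \<le> (\<integral>\<^sup>+a. (\<integral>\<^sup>+x. (\<integral>\<^sup>+b. indicator {-e<..<e} (a * x + b) \<partial>shift_law) \<partial>hitting_measure) \<partial>scale_law)"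
  proof (rule nn_integral_mono_AE)
    show "AE a in scale_law. (\<integral>\<^sup>+x. (\<integral>\<^sup>+b. indicator ?A a * (indicator {-2..2} x * indicator ?B b) \<partial>shift_law) \<partial>hitting_measure)
      \<le> (\<integral>\<^sup>+x. (\<integral>\<^sup>+b. indicator {-e<..<e} (a * x + b) \<partial>shift_law) \<partial>hitting_measure)"
      using AE_scale_law_pos
    proof eventually_elim
      fix a :: real assume a: "0 < a"
      show "(\<integral>\<^sup>+x. (\<integral>\<^sup>+b. indicator ?A a * (indicator {-2..2} x * indicator ?B b) \<partial>shift_law) \<partial>hitting_measure)
        \<le> (\<integral>\<^sup>+x. (\<integral>\<^sup>+b. indicator {-e<..<e} (a * x + b) \<partial>shift_law) \<partial>hitting_measure)"
      proof (intro nn_integral_mono)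
        fix x b :: real
        have "a * x + b \<in> {-e<..<e}" if "a < e/4" "\<bar>x\<bar> \<le> 2" "\<bar>b\<bar> < e/2"
        proof -
          have "\<bar>a * x\<bar> \<le> e/4 * 2" unfolding abs_mult using a that by (intro mult_mono) auto
          then show ?thesis using that by (auto simp: abs_if split: if_splits)
        qed
        then show "indicator ?A a * (indicator {-2..2} x * indicator ?B b) \<le> (indicator {-e<..<e} (a * x + b) :: ennreal)"
          by (auto simp: indicator_def abs_le_iff abs_less_iff)
      qed
    qed
  qed
  also have "\<dots> = emeasure hitting_measure {-e<..<e}" by (rule emeasure_hitting[symmetric]) simp
  finally show ?thesis .
qed

section \<open>Averages over scales\<close>

definition scale_avg :: "(real \<Rightarrow> real) \<Rightarrow> real \<Rightarrow> real" where
  "scale_avg U a = (\<integral>x. U (a * x) \<partial>scale_law)"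

text \<open>The substitution w = a x splits the average at w = a into an integral over [0, a] and
  one over [a, \<infinity>) whose integrands no longer contain a. For this reason the average is
  continuous in a, and differentiable when U is continuous.\<close>

definition lower_part :: "(real \<Rightarrow> real) \<Rightarrow> real \<Rightarrow> real" where
  "lower_part U a = integral {0..a} (\<lambda>w. U w * w powr (-2/3))"

definition upper_part :: "(real \<Rightarrow> real) \<Rightarrow> real \<Rightarrow> real" where
  "upper_part U a = integral {a..} (\<lambda>w. U w * w powr -3)"

lemma set_integrable_powr_0: 
  fixes b :: real
  assumes "0 \<le> b" shows "set_integrable lborel {0..b} (\<lambda>w. w powr (-2/3))"
  and "(LINT w:{0..b}|lborel. w powr (-2/3)) = 3 * b powr (1/3)"
proof -
  have h: "((\<lambda>w. w powr (-2/3)) has_integral (b powr (-2/3 + 1) / (-2/3 + 1))) {0..b}"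
    using assms by (intro has_integral_powr_from_0) auto
  have "(\<lambda>w::real. w powr (-2/3)) absolutely_integrable_on {0..b}"
    using h by (intro nonnegative_absolutely_integrable_1) auto
  then show s: "set_integrable lborel {0..b} (\<lambda>w::real. w powr (-2/3))"
    by (simp add: set_integrable_def integrable_completion)
  show "(LINT w:{0..b}|lborel. w powr (-2/3)) = 3 * b powr (1/3)"
    using set_borel_integral_eq_integral(2)[OF s] integral_unique[OF h] by simp
qed

lemma set_integrable_powr_inf: 
  fixes c :: real
  assumes "0 < c" shows "set_integrable lborel {c..} (\<lambda>w. w powr -3)"
  and "(LINT w:{c..}|lborel. w powr -3) = c powr -2 / 2"
proof -
  have h: "((\<lambda>w. w powr -3) has_integral (- (c powr (-3 + 1)) / (-3 + 1))) {c..}"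
    using assms by (intro has_integral_powr_to_inf) auto
  have "(\<lambda>w::real. w powr -3) absolutely_integrable_on {c..}"
    using h by (intro nonnegative_absolutely_integrable_1) auto
  then show s: "set_integrable lborel {c..} (\<lambda>w::real. w powr -3)"
    by (simp add: set_integrable_def integrable_completion)
  show "(LINT w:{c..}|lborel. w powr -3) = c powr -2 / 2"
    using set_borel_integral_eq_integral(2)[OF s] integral_unique[OF h] by simp
qed

context
  fixes U :: "real \<Rightarrow> real" and M :: real
  assumes Um [measurable]: "U \<in> borel_measurable borel" and Ub: "\<And>x. \<bar>U x\<bar> \<le> M"
begin

lemma set_integrable_bounded_mult:
  fixes w :: "real \<Rightarrow> real"
  assumes [measurable]: "S \<in> sets borel" and w: "set_integrable lborel S w"
  shows "set_integrable lborel S (\<lambda>x. U x * w x)"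
proof -
  have "integrable lborel (\<lambda>x. U x * (indicator S x *\<^sub>R w x))"
  proof (rule Bochner_Integration.integrable_bound[where f = "\<lambda>x. M * (indicator S x *\<^sub>R w x)"])
    show "integrable lborel (\<lambda>x. M * (indicator S x *\<^sub>R w x))"
      using w unfolding set_integrable_def by (rule integrable_mult_right)
    have [measurable]: "(\<lambda>x. indicator S x * w x) \<in> borel_measurable borel"
      using borel_measurable_integrable[OF w[unfolded set_integrable_def]] by simp
    show "(\<lambda>x. U x * (indicator S x *\<^sub>R w x)) \<in> borel_measurable lborel" by simp
    show "AE x in lborel. norm (U x * (indicator S x *\<^sub>R w x)) \<le> norm (M * (indicator S x *\<^sub>R w x))"
    proof (rule AE_I2)
      fix x
      have "\<bar>U x\<bar> \<le> \<bar>M\<bar>" using Ub[of x] by linarith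
      then show "norm (U x * (indicator S x *\<^sub>R w x)) \<le> norm (M * (indicator S x *\<^sub>R w x))"
        unfolding norm_mult by (intro mult_right_mono) auto
    qed
  qed
  then show ?thesis unfolding set_integrable_def by (simp add: ac_simps)
qed

lemma lower_integrable: "0 \<le> b \<Longrightarrow> set_integrable lborel {0..b} (\<lambda>w. U w * w powr (-2/3))"
  by (intro set_integrable_bounded_mult set_integrable_powr_0) auto

lemma upper_integrable: "0 < c \<Longrightarrow> set_integrable lborel {c..} (\<lambda>w. U w * w powr -3)"
  by (intro set_integrable_bounded_mult set_integrable_powr_inf) auto

lemma weighted_integral_bound:
  fixes w :: "real \<Rightarrow> real"
  assumes S: "S \<in> sets borel" and w: "set_integrable lborel S w" "\<And>x. 0 \<le> w x"
  shows "\<bar>integral S (\<lambda>x. U x * w x)\<bar> \<le> M * (LINT x:S|lborel. w x)"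
proof -
  note i = set_integrable_bounded_mult[OF S w(1)]
  have "integral S (\<lambda>x. U x * w x) = (LINT x:S|lborel. U x * w x)"
    using set_borel_integral_eq_integral(2)[OF i] by simp
  also have "\<bar>\<dots>\<bar> \<le> (LINT x:S|lborel. \<bar>U x * w x\<bar>)"
    using set_integral_norm_bound[OF i] by simp
  also have "\<dots> \<le> (LINT x:S|lborel. M * w x)"
    using i w Ub
    by (intro set_integral_mono set_integrable_abs set_integrable_mult_right)
      (auto simp: abs_mult intro!: mult_right_mono)
  finally show ?thesis by simp
qed

lemma lower_part_bound: "0 < a \<Longrightarrow> \<bar>lower_part U a\<bar> \<le> M * (3 * a powr (1/3))"
  using weighted_integral_bound[of "{0..a}" "\<lambda>w. w powr (-2/3)"] set_integrable_powr_0[of a]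
  unfolding lower_part_def by simp

lemma upper_part_bound: "0 < a \<Longrightarrow> \<bar>upper_part U a\<bar> \<le> M * (a powr -2 / 2)"
  using weighted_integral_bound[of "{a..}" "\<lambda>w. w powr -3"] set_integrable_powr_inf[of a]
  unfolding upper_part_def by simp

lemma scale_avg_eq:
  assumes a: "0 < a"
  shows "scale_avg U a = 2/7 * (a powr (-1/3) * lower_part U a + a powr 2 * upper_part U a)"
proof -
  let ?f = "\<lambda>w. scale_density (w / a) / a * U w"
  have "scale_avg U a = (\<integral>x. scale_density x * U (a * x) \<partial>lborel)"
    unfolding scale_avg_def scale_law_def using scale_density_nonneg
    by (subst integral_density) auto
  also have "\<dots> = \<bar>a\<bar> *\<^sub>R (\<integral>x. ?f (0 + a * x) \<partial>lborel)"
    using a by simp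
  also have "\<dots> = (\<integral>x. ?f x \<partial>lborel)"
    using a by (intro lborel_integral_real_affine[symmetric]) simp
  also have "\<dots> = (\<integral>w. 2/7 * (a powr (-1/3) * (indicator {0..a} w *\<^sub>R (U w * w powr (-2/3)))
        + a powr 2 * (indicator {a..} w *\<^sub>R (U w * w powr -3))) \<partial>lborel)"
  proof (rule integral_cong_AE)
    have "AE w in lborel. w \<noteq> a" by (rule AE_lborel_singleton)
    then show "AE w in lborel. ?f w = 2/7 * (a powr (-1/3) * (indicator {0..a} w *\<^sub>R (U w * w powr (-2/3)))
        + a powr 2 * (indicator {a..} w *\<^sub>R (U w * w powr -3)))"
    proof eventually_elim
      fix w assume w: "w \<noteq> a"
      have lower: "(w / a) powr (-2/3) / a = a powr (-1/3) * w powr (-2/3)" if "0 < w"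
      proof -
        have "(w / a) powr (-2/3) / a = w powr (-2/3) * (a powr (2/3) / a powr 1)"
          using a that by (simp add: powr_divide powr_minus field_simps)
        also have "a powr (2/3) / a powr 1 = a powr (2/3 - 1)" by (rule powr_diff[symmetric])
        finally show ?thesis by (simp add: mult.commute)
      qed
      have upper: "(w / a) powr -3 / a = a powr 2 * w powr -3" if "0 < w"
      proof -
        have "(w / a) powr -3 / a = w powr -3 * (a powr 3 / a powr 1)"
          using a that by (simp add: powr_divide powr_minus field_simps)
        also have "a powr 3 / a powr 1 = a powr (3 - 1)" by (rule powr_diff[symmetric])
        finally show ?thesis by (simp add: mult.commute)
      qed
      show "?f w = 2/7 * (a powr (-1/3) * (indicator {0..a} w *\<^sub>R (U w * w powr (-2/3)))
        + a powr 2 * (indicator {a..} w *\<^sub>R (U w * w powr -3)))"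
      proof (cases "0 < w")
        case True
        then consider "w < a" | "a < w" using w by linarith
        then show ?thesis
        proof cases
          case 1
          have "?f w = 2/7 * ((w / a) powr (-2/3) / a) * U w" using 1 a True by (simp add: scale_density_def divide_le_0_iff)
          also have "\<dots> = 2/7 * (a powr (-1/3) * w powr (-2/3)) * U w"
            by (simp only: lower[OF True])
          finally show ?thesis using 1 True by (simp add: ac_simps)
        next
          case 2
          have "?f w = 2/7 * ((w / a) powr -3 / a) * U w" using 2 a True by (simp add: scale_density_def divide_le_0_iff)
          also have "\<dots> = 2/7 * (a powr 2 * w powr -3) * U w"
            by (simp only: upper[OF True])
          finally show ?thesis using 2 True by (simp add: ac_simps)
        qed
      next
        case False
        then have "scale_density (w / a) = 0" using a by (simp add: scale_density_def divide_le_0_iff)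
        then show ?thesis using False a w by (cases "w = 0") (auto simp: indicator_def)
      qed
    qed
  qed measurable
  also have "\<dots> = 2/7 * (a powr (-1/3) * (LINT w:{0..a}|lborel. U w * w powr (-2/3))
        + a powr 2 * (LINT w:{a..}|lborel. U w * w powr -3))"
    using lower_integrable[of a] upper_integrable[of a] a
    by (simp add: set_lebesgue_integral_def set_integrable_def)
  also have "\<dots> = 2/7 * (a powr (-1/3) * lower_part U a + a powr 2 * upper_part U a)"
    unfolding lower_part_def upper_part_def
    using set_borel_integral_eq_integral(2)[OF lower_integrable] set_borel_integral_eq_integral(2)[OF upper_integrable] a by simp
  finally show ?thesis .
qed

text \<open>Fixing a base point c > 0 separates the singularity at 0 from the dependence on x, which
  becomes that of an integral over a compact interval.\<close>

lemma lower_part_split: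
  assumes "0 < c" "c \<le> x"
  shows "lower_part U x = lower_part U c + integral {c..x} (\<lambda>w. U w * w powr (-2/3))"
  unfolding lower_part_def using assms set_borel_integral_eq_integral(1)[OF lower_integrable, of x]
  by (intro Henstock_Kurzweil_Integration.integral_combine[symmetric]) auto

lemma upper_part_split:
  assumes "0 < c" "c \<le> x"
  shows "upper_part U c = integral {c..x} (\<lambda>w. U w * w powr -3) + upper_part U x"
proof -
  let ?g = "\<lambda>w. U w * w powr -3"
  have i: "?g integrable_on {c..}" "?g integrable_on {x..}"
    using set_borel_integral_eq_integral(1)[OF upper_integrable] assms by auto
  have "?g integrable_on {c..x}"
    using set_borel_integral_eq_integral(1)[OF set_integrable_subset[OF upper_integrable]] assms by auto
  then have "(?g has_integral (integral {c..x} ?g + integral {x..} ?g)) ({c..x} \<union> {x..})"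
    using i by (intro has_integral_Un integrable_integral) (auto simp: assms intro: negligible_subset[of "{x}"])
  moreover have "{c..x} \<union> {x..} = {c..}" using assms by auto
  ultimately show ?thesis unfolding upper_part_def by (simp add: integral_unique)
qed

lemma scale_avg_bound: "\<bar>scale_avg U a\<bar> \<le> M"
proof -
  have "\<bar>scale_avg U a\<bar> \<le> (\<integral>x. \<bar>U (a * x)\<bar> \<partial>scale_law)"
    unfolding scale_avg_def by (rule integral_abs_bound)
  also have "\<dots> \<le> (\<integral>x. M \<partial>scale_law)"
    using Ub order_trans[OF abs_ge_zero Ub]
    by (intro integral_mono scale.integrable_const_bound[where B = M]) auto
  finally show ?thesis using scale.prob_space by simp
qed

text \<open>Indefinite integrals are continuous. Averaging thus supplies the regularity that a
  merely measurable U lacks.\<close>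

lemma continuous_scale_avg: "continuous_on {0<..} (scale_avg U)"
proof (rule continuous_at_imp_continuous_on, rule ballI)
  fix t :: real assume "t \<in> {0<..}"
  then have t: "0 < t" by simp
  have lo: "(\<lambda>w. U w * w powr (-2/3)) integrable_on {t/2..2*t}"
    using set_borel_integral_eq_integral(1)[OF set_integrable_subset[OF lower_integrable[of "2*t"]]] t by auto
  have up: "(\<lambda>w. U w * w powr -3) integrable_on {t/2..2*t}"
    using set_borel_integral_eq_integral(1)[OF set_integrable_subset[OF upper_integrable[of "t/2"]]] t by auto
  have "continuous_on {t/2..2*t} (\<lambda>x. 2/7 * (x powr (-1/3) * (lower_part U (t/2) + integral {t/2..x} (\<lambda>w. U w * w powr (-2/3)))
      + x powr 2 * (upper_part U (t/2) - integral {t/2..x} (\<lambda>w. U w * w powr -3))))"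
    using t by (intro continuous_intros indefinite_integral_continuous_1 lo up) auto
  also have "?this \<longleftrightarrow> continuous_on {t/2..2*t} (scale_avg U)"
  proof (rule continuous_on_cong[OF refl])
    fix x assume "x \<in> {t/2..2*t}"
    then have x: "0 < t/2" "t/2 \<le> x" "0 < x" using t by auto
    show "2/7 * (x powr (-1/3) * (lower_part U (t/2) + integral {t/2..x} (\<lambda>w. U w * w powr (-2/3)))
      + x powr 2 * (upper_part U (t/2) - integral {t/2..x} (\<lambda>w. U w * w powr -3))) = scale_avg U x"
      unfolding scale_avg_eq[OF x(3)] using lower_part_split[OF x(1,2)] upper_part_split[OF x(1,2)] by simp
  qed
  finally have "continuous_on {t/2..2*t} (scale_avg U)" .
  then show "isCont (scale_avg U) t"
    using t by (intro continuous_on_interior[of "{t/2..2*t}"]) auto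
qed

end

lemma powr_shift: "0 < a \<Longrightarrow> a powr x * a powr y = a powr (x + y)" for a :: real
  by (simp add: powr_add)

lemma powr_pred: "0 < t \<Longrightarrow> t powr (x - 1) = t powr x / t" for t :: real
  by (simp add: powr_diff)

text \<open>The two parts \<open>P\<close>, \<open>Q\<close> of the average satisfy a linear differential system with source \<open>r\<close>;
  \<open>J\<close> and \<open>D\<close> are its eigenvectors, for the exponents 0 and 5/3.\<close>

lemma scale_avg_limit_continuous:
  fixes V :: "real \<Rightarrow> real"
  assumes Vm [measurable]: "V \<in> borel_measurable borel" and Vb: "\<And>x. \<bar>V x\<bar> \<le> M"
    and cont: "continuous_on {0<..} V" and C: "\<And>a. 0 < a \<Longrightarrow> \<bar>V a - scale_avg V a\<bar> \<le> C * a"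
  shows "\<exists>l. \<forall>a>0. \<bar>V a - l\<bar> \<le> 2 * C * a"
proof -
  have C0: "0 \<le> C" using C[of 1] by linarith
  define r where "r a = V a - scale_avg V a" for a
  define P where "P a = a powr (-1/3) * lower_part V a" for a
  define Q where "Q a = a powr 2 * upper_part V a" for a
  have V_eq: "V a = 2/7 * (P a + Q a) + r a" if "0 < a" for a
    using scale_avg_eq[OF Vm Vb that] by (simp add: r_def P_def Q_def)
  have lower_deriv: "(lower_part V has_real_derivative V t * t powr (-2/3)) (at t)" if t: "0 < t" for t
  proof -
    have "continuous_on {t/2..2*t} (\<lambda>w. V w * w powr (-2/3))"
      using t by (intro continuous_intros continuous_on_subset[OF cont]) auto
    from integral_has_real_derivative[OF this, of t]
    have "((\<lambda>x. integral {t/2..x} (\<lambda>w. V w * w powr (-2/3))) has_real_derivative V t * t powr (-2/3)) (at t within {t/2..2*t})"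
      using t by auto
    then have "((\<lambda>x. lower_part V (t/2) + integral {t/2..x} (\<lambda>w. V w * w powr (-2/3))) has_real_derivative V t * t powr (-2/3)) (at t)"
      using t by (subst (asm) at_within_interior) (auto intro!: derivative_eq_intros)
    then show ?thesis
    proof (rule DERIV_cong_ev[THEN iffD1, rotated -1])
      have "\<forall>\<^sub>F x in nhds t. x \<in> {t/2<..}" using t by (intro eventually_nhds_in_open) auto
      then show "\<forall>\<^sub>F x in nhds t. lower_part V (t/2) + integral {t/2..x} (\<lambda>w. V w * w powr (-2/3)) = lower_part V x"
      proof eventually_elim
        fix x assume "x \<in> {t/2<..}"
        then show "lower_part V (t/2) + integral {t/2..x} (\<lambda>w. V w * w powr (-2/3)) = lower_part V x"
          using t by (intro lower_part_split[OF Vm Vb, symmetric]) auto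
      qed
    qed auto
  qed
  have upper_deriv: "(upper_part V has_real_derivative - (V t * t powr -3)) (at t)" if t: "0 < t" for t
  proof -
    have "continuous_on {t/2..2*t} (\<lambda>w. V w * w powr -3)"
      using t by (intro continuous_intros continuous_on_subset[OF cont]) auto
    from integral_has_real_derivative[OF this, of t]
    have "((\<lambda>x. integral {t/2..x} (\<lambda>w. V w * w powr -3)) has_real_derivative V t * t powr -3) (at t within {t/2..2*t})"
      using t by auto
    then have "((\<lambda>x. upper_part V (t/2) - integral {t/2..x} (\<lambda>w. V w * w powr -3)) has_real_derivative - (V t * t powr -3)) (at t)"
      using t by (subst (asm) at_within_interior) (auto intro!: derivative_eq_intros)
    then show ?thesis
    proof (rule DERIV_cong_ev[THEN iffD1, rotated -1])
      have "\<forall>\<^sub>F x in nhds t. x \<in> {t/2<..}" using t by (intro eventually_nhds_in_open) auto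
      then show "\<forall>\<^sub>F x in nhds t. upper_part V (t/2) - integral {t/2..x} (\<lambda>w. V w * w powr -3) = upper_part V x"
      proof eventually_elim
        fix x assume "x \<in> {t/2<..}"
        then show "upper_part V (t/2) - integral {t/2..x} (\<lambda>w. V w * w powr -3) = upper_part V x"
          using t upper_part_split[OF Vm Vb, of "t/2" x] by auto
      qed
    qed auto
  qed
  have P_deriv: "(P has_real_derivative (V t - P t / 3) / t) (at t)" if t: "0 < t" for t
  proof -
    have "(P has_real_derivative (-1/3) * t powr (-1/3 - 1) * lower_part V t + V t * t powr (-2/3) * t powr (-1/3)) (at t)"
      unfolding P_def by (rule DERIV_mult[OF has_real_derivative_powr[OF t] lower_deriv[OF t]])
    also have "(-1/3) * t powr (-1/3 - 1) * lower_part V t + V t * t powr (-2/3) * t powr (-1/3)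
        = (V t - P t / 3) / t"
    proof -
      have "t powr (-1/3 - 1) = t powr (-1/3) / t" by (rule powr_pred[OF t])
      moreover have "t powr (-2/3) * t powr (-1/3) = 1 / t"
        using t by (simp add: powr_shift powr_minus field_simps)
      ultimately show ?thesis unfolding P_def by (simp add: mult.assoc diff_divide_distrib)
    qed
    finally show ?thesis .
  qed
  have Q_deriv: "(Q has_real_derivative (2 * Q t - V t) / t) (at t)" if t: "0 < t" for t
  proof -
    have "(Q has_real_derivative 2 * t powr (2 - 1) * upper_part V t + - (V t * t powr -3) * t powr 2) (at t)"
      unfolding Q_def by (rule DERIV_mult[OF has_real_derivative_powr[OF t] upper_deriv[OF t]])
    also have "2 * t powr (2 - 1) * upper_part V t + - (V t * t powr -3) * t powr 2 = (2 * Q t - V t) / t"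
    proof -
      have "t powr (2 - 1) = t powr 2 / t" by (rule powr_pred[OF t])
      moreover have "t powr -3 * t powr 2 = 1 / t"
        unfolding powr_shift[OF t] using t by (simp add: powr_minus_divide)
      ultimately show ?thesis unfolding Q_def by (simp add: mult.assoc diff_divide_distrib)
    qed
    finally show ?thesis .
  qed
  define J where "J a = 2 * P a - Q a / 3" for a
  define D where "D a = P a / 3 - 2 * Q a" for a
  have J_deriv: "(J has_real_derivative 7/3 * r t / t) (at t)" if t: "0 < t" for t
  proof -
    have "(J has_real_derivative 2 * ((V t - P t / 3) / t) - ((2 * Q t - V t) / t) / 3) (at t)"
      unfolding J_def by (intro DERIV_diff DERIV_cmult DERIV_cdivide P_deriv Q_deriv t)
    also have "2 * ((V t - P t / 3) / t) - ((2 * Q t - V t) / t) / 3 = 7/3 * r t / t"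
      unfolding V_eq[OF t] using t by (simp add: field_simps)
    finally show ?thesis .
  qed
  have D_deriv: "(D has_real_derivative (5/3 * D t + 7/3 * r t) / t) (at t)" if t: "0 < t" for t
  proof -
    have "(D has_real_derivative ((V t - P t / 3) / t) / 3 - 2 * ((2 * Q t - V t) / t)) (at t)"
      unfolding D_def by (intro DERIV_diff DERIV_cmult DERIV_cdivide P_deriv Q_deriv t)
    also have "((V t - P t / 3) / t) / 3 - 2 * ((2 * Q t - V t) / t) = (5/3 * D t + 7/3 * r t) / t"
      unfolding V_eq[OF t] D_def using t by (simp add: field_simps)
    finally show ?thesis .
  qed
  have r_bound: "\<bar>r t\<bar> \<le> C * t" if "0 < t" for t using C[OF that] by (simp add: r_def)
  \<comment> \<open>Since r(t) = O(t), the derivative of J is bounded. Hence J is Lipschitz and has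
    a limit L at 0.\<close>
  have J_lip: "\<bar>J a - J b\<bar> \<le> 7/3 * C * \<bar>a - b\<bar>" if "0 < a" "0 < b" for a b
  proof -
    have "norm (J a - J b) \<le> 7/3 * C * norm (a - b)"
    proof (rule field_differentiable_bound[where S = "{0<..}" and f' = "\<lambda>t. 7/3 * r t / t"])
      fix t :: real assume t: "t \<in> {0<..}"
      then show "(J has_field_derivative 7/3 * r t / t) (at t within {0<..})"
        by (intro has_field_derivative_at_within[OF J_deriv]) auto
      show "norm (7/3 * r t / t) \<le> 7/3 * C"
        using r_bound[of t] t by (simp add: abs_mult field_simps)
    qed (use that in auto)
    then show ?thesis by simp
  qed
  have "\<exists>L. \<forall>a>0. \<bar>J a - L\<bar> \<le> 7/3 * C * a"
  proof -
    define s where "s n = J (1 / Suc n)" for n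
    have "Cauchy s"
    proof (rule CauchyI)
      fix e :: real assume e: "0 < e"
      obtain N :: nat where N: "(7/3 * C + 1) / e < N" using reals_Archimedean2 by blast
      show "\<exists>M. \<forall>m\<ge>M. \<forall>n\<ge>M. norm (s m - s n) < e"
      proof (intro exI allI impI)
        fix m n assume mn: "N \<le> m" "N \<le> n"
        have "0 < (7/3 * C + 1) / e" using C0 e by (intro divide_pos_pos) auto
        then have N0: "0 < real N" using N by linarith
        have "1 / Suc m \<le> 1 / N" "1 / Suc n \<le> 1 / N" using mn N0 by (auto intro!: divide_left_mono)
        moreover have "0 \<le> 1 / Suc m" "0 \<le> 1 / Suc n" by auto
        ultimately have "\<bar>1 / Suc m - 1 / Suc n\<bar> \<le> 1 / N" by linarith
        then have "7/3 * C * \<bar>1 / Suc m - 1 / Suc n\<bar> \<le> 7/3 * C * (1 / N)"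
          using C0 by (intro mult_left_mono) auto
        moreover have "norm (s m - s n) \<le> 7/3 * C * \<bar>1 / Suc m - 1 / Suc n\<bar>"
          unfolding s_def real_norm_def by (rule J_lip) auto
        ultimately have "norm (s m - s n) \<le> 7/3 * C * (1 / N)" by linarith
        also have "\<dots> < e" using N N0 e C0 by (simp add: field_simps)
        finally show "norm (s m - s n) < e" .
      qed
    qed
    then obtain L where L: "s \<longlonglongrightarrow> L" using Cauchy_convergent convergent_def by blast
    have "\<bar>J a - L\<bar> \<le> 7/3 * C * a" if a: "0 < a" for a
    proof (rule LIMSEQ_le)
      show "(\<lambda>n. \<bar>J a - s n\<bar>) \<longlonglongrightarrow> \<bar>J a - L\<bar>" by (intro tendsto_intros L)
      have "(\<lambda>n. 7/3 * C * \<bar>a - 1 / real (Suc n)\<bar>) \<longlonglongrightarrow> 7/3 * C * \<bar>a - 0\<bar>"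
        by (intro tendsto_intros LIMSEQ_Suc[OF lim_1_over_n])
      then show "(\<lambda>n. 7/3 * C * \<bar>a - 1 / real (Suc n)\<bar>) \<longlonglongrightarrow> 7/3 * C * a" using a by simp
      show "\<exists>N. \<forall>n\<ge>N. \<bar>J a - s n\<bar> \<le> 7/3 * C * \<bar>a - 1 / real (Suc n)\<bar>"
        using a unfolding s_def by (intro exI[of _ 0] allI impI J_lip) auto
    qed
    then show ?thesis by blast
  qed
  then obtain L where L: "\<And>a. 0 < a \<Longrightarrow> \<bar>J a - L\<bar> \<le> 7/3 * C * a" by blast
  have P_bound: "\<bar>P a\<bar> \<le> 3 * M" if a: "0 < a" for a
  proof -
    have "\<bar>P a\<bar> = a powr (-1/3) * \<bar>lower_part V a\<bar>" by (simp add: P_def abs_mult)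
    also have "\<dots> \<le> a powr (-1/3) * (M * (3 * a powr (1/3)))"
      by (intro mult_left_mono lower_part_bound[OF Vm Vb a]) auto
    also have "\<dots> = 3 * M * (a powr (-1/3) * a powr (1/3))" by simp
    also have "a powr (-1/3) * a powr (1/3) = 1" unfolding powr_shift[OF a] using a by simp
    finally show ?thesis by simp
  qed
  have Q_bound: "\<bar>Q a\<bar> \<le> M / 2" if a: "0 < a" for a
  proof -
    have "\<bar>Q a\<bar> = a powr 2 * \<bar>upper_part V a\<bar>" by (simp add: Q_def abs_mult)
    also have "\<dots> \<le> a powr 2 * (M * (a powr -2 / 2))"
      by (intro mult_left_mono upper_part_bound[OF Vm Vb a]) auto
    also have "\<dots> = M / 2 * (a powr 2 * a powr -2)" by simp
    also have "a powr 2 * a powr -2 = 1" unfolding powr_shift[OF a] using a by simp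
    finally show ?thesis by simp
  qed
  have D_bound: "\<bar>D a\<bar> \<le> 2 * M" if "0 < a" for a
    using P_bound[OF that] Q_bound[OF that] unfolding D_def by (auto simp: abs_le_iff)
  \<comment> \<open>The homogeneous solution a^(5/3) is unbounded whereas D is bounded, so D is
    governed by its source alone: E tends to 0 at infinity, and integrating the bound (7/3) C
    t^(-5/3) for its derivative from a to infinity gives h(a).\<close>
  define E where "E a = a powr (-5/3) * D a" for a
  define h where "h a = 7/2 * C * a powr (-2/3)" for a
  have E_deriv: "(E has_real_derivative 7/3 * r t * t powr (-8/3)) (at t)" if t: "0 < t" for t
  proof -
    have "(E has_real_derivative (-5/3) * t powr (-5/3 - 1) * D t + (5/3 * D t + 7/3 * r t) / t * t powr (-5/3)) (at t)"
      unfolding E_def by (rule DERIV_mult[OF has_real_derivative_powr[OF t] D_deriv[OF t]])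
    also have "(-5/3) * t powr (-5/3 - 1) * D t + (5/3 * D t + 7/3 * r t) / t * t powr (-5/3)
      = 7/3 * r t * (t powr (-5/3) / t)"
      unfolding powr_pred[OF t] using t by (simp add: field_simps)
    also have "t powr (-5/3) / t = t powr (-5/3 - 1)" by (rule powr_pred[OF t, symmetric])
    finally show ?thesis by simp
  qed
  have h_deriv: "(h has_real_derivative - (7/3 * C * t powr (-5/3))) (at t)" if t: "0 < t" for t
  proof -
    have "(h has_real_derivative 7/2 * C * ((-2/3) * t powr (-2/3 - 1))) (at t)"
      unfolding h_def by (intro DERIV_cmult has_real_derivative_powr t)
    then show ?thesis by (simp add: mult.assoc)
  qed
  have E'_bound: "\<bar>7/3 * r t * t powr (-8/3)\<bar> \<le> 7/3 * C * t powr (-5/3)" if t: "0 < t" for t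
  proof -
    have "\<bar>7/3 * r t * t powr (-8/3)\<bar> = 7/3 * \<bar>r t\<bar> * t powr (-8/3)" by (simp add: abs_mult)
    also have "\<dots> \<le> 7/3 * (C * t) * t powr (-8/3)"
      by (intro mult_left_mono mult_right_mono r_bound t) auto
    also have "\<dots> = 7/3 * C * (t powr 1 * t powr (-8/3))" using t by simp
    also have "t powr 1 * t powr (-8/3) = t powr (-5/3)" unfolding powr_shift[OF t] by simp
    finally show ?thesis .
  qed
  have small: "\<bar>E b\<bar> \<le> 2 * M * b powr (-5/3)" if "0 < b" for b
    using D_bound[OF that] unfolding E_def abs_mult
    by (simp add: mult.commute[of "b powr _"] mult_right_mono)
  have lim: "((\<lambda>b::real. K * b powr (-e)) \<longlongrightarrow> 0) at_top" if "0 < e" for K e :: real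
    by (rule tendsto_mult_right_zero, rule tendsto_neg_powr) (use that in \<open>auto intro: filterlim_ident\<close>)
  have small': "\<bar>E b\<bar> \<le> 2 * M * b powr (-(5/3))" if "0 < b" for b
    using small[OF that] by simp
  have h0: "0 \<le> h b" for b using C0 by (simp add: h_def)
  have E_upper: "E a \<le> h a" and E_lower: "- h a \<le> E a" if a: "0 < a" for a
  proof -
    have up: "E a - h a \<le> 2 * M * b powr (-(5/3)) + 0" if b: "a \<le> b" for b
    proof -
      have "E a - h a \<le> E b - h b"
      proof (rule DERIV_nonneg_imp_nondecreasing[OF b])
        fix t assume "a \<le> t" "t \<le> b"
        then have t: "0 < t" using a by linarith
        show "\<exists>y. ((\<lambda>a. E a - h a) has_real_derivative y) (at t) \<and> 0 \<le> y"
          using E'_bound[OF t] by (intro exI[of _ "7/3 * r t * t powr (-8/3) - - (7/3 * C * t powr (-5/3))"] conjI DERIV_diff E_deriv h_deriv t) (auto simp: abs_le_iff)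
      qed
      also have "\<dots> \<le> 2 * M * b powr (-(5/3)) + 0"
        using small'[of b] h0[of b] a b by linarith
      finally show ?thesis .
    qed
    have "E a - h a \<le> 0 + 0"
    proof (rule tendsto_lowerbound)
      show "((\<lambda>b. 2 * M * b powr (-(5/3)) + 0) \<longlongrightarrow> 0 + 0) at_top" by (intro tendsto_add lim tendsto_const) auto
      show "\<forall>\<^sub>F b in at_top. E a - h a \<le> 2 * M * b powr (-(5/3)) + 0"
        using eventually_ge_at_top[of a] by eventually_elim (rule up)
    qed auto
    then show "E a \<le> h a" by simp
    have lo: "- (2 * M * b powr (-(5/3))) \<le> E a + h a" if b: "a \<le> b" for b
    proof -
      have "- (2 * M * b powr (-(5/3))) \<le> E b + h b"
        using small'[of b] h0[of b] a b by linarith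
      also have "E b + h b \<le> E a + h a"
      proof (rule DERIV_nonpos_imp_nonincreasing[OF b])
        fix t assume "a \<le> t" "t \<le> b"
        then have t: "0 < t" using a by linarith
        show "\<exists>y. ((\<lambda>a. E a + h a) has_real_derivative y) (at t) \<and> y \<le> 0"
          using E'_bound[OF t] by (intro exI[of _ "7/3 * r t * t powr (-8/3) + - (7/3 * C * t powr (-5/3))"] conjI DERIV_add E_deriv h_deriv t) (auto simp: abs_le_iff)
      qed
      finally show ?thesis .
    qed
    have "- 0 \<le> E a + h a"
    proof (rule tendsto_upperbound)
      show "((\<lambda>b. - (2 * M * b powr (-(5/3)))) \<longlongrightarrow> - 0) at_top" by (intro tendsto_minus lim) auto
      show "\<forall>\<^sub>F b in at_top. - (2 * M * b powr (-(5/3))) \<le> E a + h a"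
        using eventually_ge_at_top[of a] by eventually_elim (rule lo)
    qed auto
    then show "- h a \<le> E a" by simp
  qed
  have D_small: "\<bar>D a\<bar> \<le> 7/2 * C * a" if a: "0 < a" for a
  proof -
    have "D a = a powr (5/3) * E a" using a by (simp add: E_def mult.assoc[symmetric] powr_shift)
    then have "\<bar>D a\<bar> = a powr (5/3) * \<bar>E a\<bar>" by (simp add: abs_mult)
    also have "\<dots> \<le> a powr (5/3) * h a" using E_upper[OF a] E_lower[OF a] by (intro mult_left_mono) (auto simp: abs_le_iff)
    also have "\<dots> = 7/2 * C * (a powr (5/3) * a powr (-2/3))" by (simp add: h_def)
    also have "a powr (5/3) * a powr (-2/3) = a" unfolding powr_shift[OF a] using a by simp
    finally show ?thesis .
  qed
  show ?thesis
  proof (intro exI[of _ "6/35 * L"] allI impI)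
    fix a :: real assume a: "0 < a"
    \<comment> \<open>Solving for P + Q gives (6/35)(J - D) = (2/7)(P + Q) = V - r. The errors are
      (6/35)(7/3) = 2/5 from J, (6/35)(7/2) = 3/5 from D and 1 from r, altogether 2 times C
      a.\<close>
    have "V a - 6/35 * L = 6/35 * (J a - L) - 6/35 * D a + r a"
      unfolding V_eq[OF a] J_def D_def by (simp add: field_simps)
    then show "\<bar>V a - 6/35 * L\<bar> \<le> 2 * C * a"
      using L[OF a] D_small[OF a] r_bound[OF a] unfolding abs_le_iff by argo
  qed
qed

lemma scale_avg_measurable [measurable]:
  assumes [measurable]: "U \<in> borel_measurable borel"
  shows "scale_avg U \<in> borel_measurable borel"
  unfolding scale_avg_def by measurable

lemma integrable_scale_abs: "integrable scale_law (\<lambda>x. \<bar>x\<bar>)"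
  and integral_scale_abs: "(\<integral>x. \<bar>x\<bar> \<partial>scale_law) = 1/2"
  using scale_law_mean nn_integral_eq_integrable[of "\<lambda>x. \<bar>x\<bar>" scale_law "1/2"] by auto

text \<open>The average V of U is continuous, and averaging the hypothesis once more halves its
  constant because A has mean 1/2. So V lies within C a of a limit l, and U lies within another C a
  of V.\<close>

lemma scale_avg_limit:
  fixes U :: "real \<Rightarrow> real"
  assumes Um [measurable]: "U \<in> borel_measurable borel" and Ub: "\<And>x. \<bar>U x\<bar> \<le> M"
    and C: "\<And>a. 0 < a \<Longrightarrow> \<bar>U a - scale_avg U a\<bar> \<le> C * a"
  shows "\<exists>l. \<forall>a>0. \<bar>U a - l\<bar> \<le> 2 * C * a"
proof -
  let ?V = "scale_avg U"
  have int: "integrable scale_law (\<lambda>x. W (a * x))" if [measurable]: "W \<in> borel_measurable borel" and "\<And>x. \<bar>W x\<bar> \<le> M" for W a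
    using that(2) by (intro scale.integrable_const_bound[where B = M]) auto
  have "\<bar>?V a - scale_avg ?V a\<bar> \<le> (C/2) * a" if a: "0 < a" for a
  proof -
    note id = integrable_scale_abs and mean = integral_scale_abs
    have "?V a - scale_avg ?V a = (\<integral>x. U (a * x) - ?V (a * x) \<partial>scale_law)"
      unfolding scale_avg_def[of ?V a] unfolding scale_avg_def[of U a]
      by (intro Bochner_Integration.integral_diff[symmetric] int Ub scale_avg_bound[OF Um Ub]) auto
    also have "\<bar>\<dots>\<bar> \<le> (\<integral>x. \<bar>U (a * x) - ?V (a * x)\<bar> \<partial>scale_law)" by (rule integral_abs_bound)
    also have "\<dots> \<le> (\<integral>x. C * a * \<bar>x\<bar> \<partial>scale_law)"
    proof (rule integral_mono_AE)
      show "AE x in scale_law. \<bar>U (a * x) - ?V (a * x)\<bar> \<le> C * a * \<bar>x\<bar>"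
        using AE_scale_law_pos by eventually_elim (use a C[of "a * _"] in \<open>auto simp: mult.assoc\<close>)
      show "integrable scale_law (\<lambda>x. \<bar>U (a * x) - ?V (a * x)\<bar>)"
        by (intro integrable_abs Bochner_Integration.integrable_diff int Ub scale_avg_bound[OF Um Ub]) auto
    qed (use id in auto)
    also have "\<dots> = (C/2) * a" using mean by simp
    finally show ?thesis .
  qed
  from scale_avg_limit_continuous[OF scale_avg_measurable[OF Um] scale_avg_bound[OF Um Ub] continuous_scale_avg[OF Um Ub] this]
  obtain l where l: "\<And>a. 0 < a \<Longrightarrow> \<bar>?V a - l\<bar> \<le> 2 * (C/2) * a" by blast
  show ?thesis
  proof (intro exI[of _ l] allI impI)
    fix a :: real assume a: "0 < a"
    show "\<bar>U a - l\<bar> \<le> 2 * C * a" using l[OF a] C[OF a] unfolding abs_le_iff by (simp add: algebra_simps)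
  qed
qed

section \<open>Bounded harmonic functions on the half-plane\<close>

definition bounded_borel :: "real \<Rightarrow> (real \<Rightarrow> real) \<Rightarrow> bool" where
  "bounded_borel M g \<longleftrightarrow> g \<in> borel_measurable borel \<and> (\<forall>x. \<bar>g x\<bar> \<le> M)"

lemma bounded_borelD:
  assumes "bounded_borel M g"
  shows "g \<in> borel_measurable borel" "\<bar>g x\<bar> \<le> M" "0 \<le> M"
  using assms order_trans[OF abs_ge_zero, of "g 0" M] by (auto simp: bounded_borel_def)

lemma emeasure_lborel_Ioo_finite: "emeasure lborel {x<..<y :: real} < \<infinity>"
  by (cases "x \<le> y") auto

lemma bounded_borel_integrable:
  assumes "bounded_borel M g"
  shows "interval_lebesgue_integrable lborel (ereal x) (ereal y) g"
    and "set_integrable lborel {x<..<y} g"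
proof -
  note [measurable] = bounded_borelD(1)[OF assms]
  have "set_integrable lborel {x<..<y} g" for x y
    unfolding set_integrable_def using bounded_borelD[OF assms]
    by (intro integrableI_bounded_set[where A = "{x<..<y}" and B = M])
      (auto simp: indicator_def emeasure_lborel_Ioo_finite[unfolded infinity_ennreal_def])
  then show "interval_lebesgue_integrable lborel (ereal x) (ereal y) g" "set_integrable lborel {x<..<y} g"
    by (auto simp: interval_lebesgue_integrable_def)
qed

lemma interval_integral_bound:
  assumes g: "bounded_borel M g"
  shows "\<bar>LBINT b=ereal x..ereal y. g b\<bar> \<le> M * \<bar>y - x\<bar>"
proof -
  have *: "\<bar>LBINT b=ereal x..ereal y. g b\<bar> \<le> M * \<bar>y - x\<bar>" if "x \<le> y" for x y
  proof -
    have "\<bar>LBINT b=ereal x..ereal y. g b\<bar> = \<bar>LBINT b:{x<..<y}. g b\<bar>"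
      using that by (simp add: interval_lebesgue_integral_def)
    also have "\<dots> \<le> (LBINT b:{x<..<y}. \<bar>g b\<bar>)"
      using set_integral_norm_bound[OF bounded_borel_integrable(2)[OF g]] by simp
    also have "\<dots> \<le> (LBINT b:{x<..<y}. M)"
      using bounded_borelD[OF g] bounded_borel_integrable(2)[OF g]
      by (intro set_integral_mono set_integrable_abs) (auto simp: set_integrable_def emeasure_lborel_Ioo_finite[unfolded infinity_ennreal_def])
    also have "\<dots> = M * \<bar>y - x\<bar>"
      using that by (simp add: set_lebesgue_integral_def)
    finally show ?thesis .
  qed
  show ?thesis
  proof (cases "x \<le> y")
    case False
    then have "\<bar>LBINT b=ereal y..ereal x. g b\<bar> \<le> M * \<bar>x - y\<bar>" by (intro *) auto
    then show ?thesis by (subst interval_integral_endpoints_reverse) (simp add: abs_minus_commute)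
  qed (rule *)
qed

lemma interval_integral_add:
  assumes g: "bounded_borel M g"
  shows "(LBINT b=ereal x..ereal y. g b) + (LBINT b=ereal y..ereal z. g b) = (LBINT b=ereal x..ereal z. g b)"
proof -
  have "interval_lebesgue_integrable lborel (min (ereal x) (min (ereal y) (ereal z))) (max (ereal x) (max (ereal y) (ereal z))) g"
    using bounded_borel_integrable(1)[OF g] by (simp only: ereal_min[symmetric] ereal_max[symmetric])
  then show ?thesis by (rule interval_integral_sum)
qed

text \<open>The two integrals differ only by end pieces of length |t|. The bound is therefore
  independent of the length of the interval, and later errors O(a) hold for all intervals at
  once.\<close>

lemma interval_integral_shift_bound:
  assumes g: "bounded_borel M g"
  shows "\<bar>(LBINT b=ereal (x + t)..ereal (y + t). g b) - (LBINT b=ereal x..ereal y. g b)\<bar> \<le> 2 * M * \<bar>t\<bar>"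
proof -
  have "(LBINT b=ereal (x + t)..ereal (y + t). g b) - (LBINT b=ereal x..ereal y. g b)
    = (LBINT b=ereal y..ereal (y + t). g b) - (LBINT b=ereal x..ereal (x + t). g b)"
    using interval_integral_add[OF g, of x "x + t" "y + t"] interval_integral_add[OF g, of x y "y + t"] by linarith
  then show ?thesis
    using interval_integral_bound[OF g, of y "y + t"] interval_integral_bound[OF g, of x "x + t"] by auto
qed

lemma interval_integral_translate:
  fixes g :: "real \<Rightarrow> real"
  assumes "x \<le> y"
  shows "(LBINT b=ereal x..ereal y. g (t + b)) = (LBINT b=ereal (x + t)..ereal (y + t). g b)"
proof -
  have "(LBINT b=ereal (x + t)..ereal (y + t). g b) = (\<integral>b. indicator {x + t<..<y + t} b *\<^sub>R g b \<partial>lborel)"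
    using assms by (simp add: interval_lebesgue_integral_def set_lebesgue_integral_def)
  also have "\<dots> = \<bar>1\<bar> *\<^sub>R (\<integral>b. indicator {x + t<..<y + t} (t + 1 * b) *\<^sub>R g (t + 1 * b) \<partial>lborel)"
    by (rule lborel_integral_real_affine) simp
  also have "\<dots> = (\<integral>b. indicator {x<..<y} b *\<^sub>R g (t + b) \<partial>lborel)"
    by (auto intro!: Bochner_Integration.integral_cong simp: indicator_def)
  also have "\<dots> = (LBINT b=ereal x..ereal y. g (t + b))"
    using assms by (simp add: interval_lebesgue_integral_def set_lebesgue_integral_def)
  finally show ?thesis ..
qed

text \<open>The function 1 + g/(M+1) is a nonnegative density whose integral over each interval is
  the length of the interval. The measure it defines is Lebesgue measure, so the density is 1 almost
  everywhere. Dividing by M + 1 rather than M covers the case M = 0.\<close>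

lemma AE_zero_of_interval_integrals:
  assumes g: "bounded_borel M g" and 0: "\<And>x y. x \<le> y \<Longrightarrow> (LBINT b=ereal x..ereal y. g b) = 0"
  shows "AE x in lborel. g x = 0"
proof -
  note [measurable] = bounded_borelD(1)[OF g]
  define h where "h x = 1 + g x / (M + 1)" for x
  have M: "0 < M + 1" using bounded_borelD(3)[OF g] by simp
  have h0: "0 \<le> h x" for x
    using bounded_borelD(2)[OF g, of x] M by (auto simp: h_def abs_le_iff field_simps)
  have [measurable]: "h \<in> borel_measurable borel" unfolding h_def by measurable
  have "lborel = density lborel (\<lambda>x. ennreal (h x))"
  proof (rule lborel_eqI)
    fix l u :: real assume "\<And>b. b \<in> Basis \<Longrightarrow> l \<bullet> b \<le> u \<bullet> b"
    then have lu: "l \<le> u" by simp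
    have i: "set_integrable lborel {l<..<u} (\<lambda>x. 1 :: real)" by (simp add: set_integrable_def emeasure_lborel_Ioo_finite[unfolded infinity_ennreal_def])
    have ig: "set_integrable lborel {l<..<u} (\<lambda>x. g x / (M + 1))"
      using bounded_borel_integrable(2)[OF g] by (rule set_integrable_divide)
    have ih: "set_integrable lborel {l<..<u} h" unfolding h_def by (intro set_integral_add i ig)
    have "emeasure (density lborel (\<lambda>x. ennreal (h x))) (box l u) = (\<integral>\<^sup>+x. ennreal (h x) * indicator {l<..<u} x \<partial>lborel)"
      by (subst emeasure_density) (auto simp: box_real)
    also have "\<dots> = (\<integral>\<^sup>+x. ennreal (indicator {l<..<u} x *\<^sub>R h x) \<partial>lborel)"
      by (intro nn_integral_cong) (simp add: indicator_def)
    also have "\<dots> = ennreal (LBINT x:{l<..<u}. h x)"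
      unfolding set_lebesgue_integral_def using ih h0
      by (intro nn_integral_eq_integral) (auto simp: set_integrable_def)
    also have "(LBINT x:{l<..<u}. h x) = (LBINT x:{l<..<u}. 1) + (LBINT x:{l<..<u}. g x / (M + 1))"
      unfolding h_def by (intro set_integral_add i ig)
    also have "(LBINT x:{l<..<u}. g x / (M + 1)) = (LBINT x:{l<..<u}. g x) / (M + 1)" by simp
    also have "(LBINT x:{l<..<u}. g x) = 0"
      using 0[OF lu] lu by (simp add: interval_lebesgue_integral_def)
    finally show "emeasure (density lborel (\<lambda>x. ennreal (h x))) (box l u) = (\<Prod>b\<in>Basis. (u - l) \<bullet> b)"
      using lu by (simp add: set_lebesgue_integral_def)
  qed simp
  then have "density lborel (\<lambda>x. 1) = density lborel (\<lambda>x. ennreal (h x))" by (simp add: density_1)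
  then have "AE x in lborel. 1 = ennreal (h x)"
    by (subst (asm) sigma_finite_measure.density_unique_iff[OF sigma_finite_lborel]) auto
  then show ?thesis
  proof eventually_elim
    fix x assume "1 = ennreal (h x)"
    then have "h x = 1" using h0[of x] by (metis ennreal_1 ennreal_inj zero_le_one)
    then show "g x = 0" using M by (simp add: h_def)
  qed
qed

section \<open>Bounded densities of Lipschitz functions\<close>

lemma emeasure_sum_measure:
  assumes "sets N = sets M"
  shows "emeasure (measure_of (space M) (sets M) (\<lambda>A. emeasure M A + emeasure N A)) A
    = (if A \<in> sets M then emeasure M A + emeasure N A else 0)"
proof (cases "A \<in> sets M")
  case True
  have "emeasure (measure_of (space M) (sets M) (\<lambda>A. emeasure M A + emeasure N A)) A = emeasure M A + emeasure N A"
  proof (rule emeasure_measure_of_sigma)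
    show "sigma_algebra (space M) (sets M)" by (rule sets.sigma_algebra_axioms)
    show "positive (sets M) (\<lambda>A. emeasure M A + emeasure N A)" by (simp add: positive_def)
    show "countably_additive (sets M) (\<lambda>A. emeasure M A + emeasure N A)"
    proof (rule countably_additiveI)
      fix A :: "nat \<Rightarrow> _" assume A: "range A \<subseteq> sets M" "disjoint_family A"
      have "(\<Sum>i. emeasure M (A i) + emeasure N (A i)) = (\<Sum>i. emeasure M (A i)) + (\<Sum>i. emeasure N (A i))"
        by (intro suminf_add[symmetric]) auto
      then show "(\<Sum>i. emeasure M (A i) + emeasure N (A i)) = emeasure M (\<Union>i. A i) + emeasure N (\<Union>i. A i)"
        using A assms by (simp add: suminf_emeasure)
    qed
  qed (rule True)
  then show ?thesis using True by simp
qed (simp add: emeasure_notin_sets)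

text \<open>The interval measures of \<open>F\<close> and of \<open>x - F x\<close> add up to Lebesgue measure.\<close>

lemma lipschitz_monotone_density:
  fixes F :: "real \<Rightarrow> real"
  assumes F: "\<And>x y. x \<le> y \<Longrightarrow> F x \<le> F y" "\<And>x y. x \<le> y \<Longrightarrow> F y - F x \<le> y - x"
  shows "\<exists>f\<in>borel_measurable borel. (\<forall>x. 0 \<le> f x \<and> f x \<le> 1) \<and> (\<forall>x y. x \<le> y \<longrightarrow> (LBINT b=ereal x..ereal y. f b) = F y - F x)"
proof -
  define H where "H x = x - F x" for x
  have H: "H x \<le> H y" if "x \<le> y" for x y using F(2)[OF that] by (simp add: H_def)
  have cont: "continuous_on UNIV G" if "\<And>x y. x \<le> y \<Longrightarrow> G x \<le> G y \<and> G y - G x \<le> y - x" for G :: "real \<Rightarrow> real"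
  proof (rule lipschitz_on_continuous_on[of 1], rule lipschitz_onI)
    fix x y :: real
    show "dist (G x) (G y) \<le> 1 * dist x y"
      using that[of x y] that[of y x] by (cases "x \<le> y") (auto simp: dist_real_def)
  qed simp
  have cF: "continuous_on UNIV F" using F by (intro cont) auto
  have cH: "continuous_on UNIV H" using F H by (intro cont) (auto simp: H_def)
  have Ioo: "emeasure (interval_measure G) {l<..<u} = ennreal (G u - G l)"
    if "\<And>x y. x \<le> y \<Longrightarrow> G x \<le> G y" "continuous_on UNIV G" "l \<le> u" for G l u
  proof -
    have c: "continuous (at_right a) G" for a
      using that(2) by (simp add: continuous_on_eq_continuous_at continuous_at_imp_continuous_at_within)
    have "emeasure (interval_measure G) {u..u} = ennreal (G u - G u)"
      using that by (intro emeasure_interval_measure_Icc) (auto intro: continuous_on_subset)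
    then have z: "emeasure (interval_measure G) {u} = 0" by simp
    show ?thesis
    proof (cases "l = u")
      case False
      then have "l < u" using that by simp
      have "emeasure (interval_measure G) {l<..u} = ennreal (G u - G l)"
        using that c by (intro emeasure_interval_measure_Ioc) auto
      moreover have "{l<..u} = {l<..<u} \<union> {u}" using \<open>l < u\<close> by auto
      moreover have "emeasure (interval_measure G) ({l<..<u} \<union> {u}) = emeasure (interval_measure G) {l<..<u}"
        using z by (intro emeasure_Un_null_set) (auto intro: null_setsI)
      ultimately show ?thesis by simp
    qed simp
  qed
  let ?F = "interval_measure F" and ?H = "interval_measure H"
  have sum: "emeasure lborel A = emeasure ?F A + emeasure ?H A" if A: "A \<in> sets borel" for A
  proof -
    let ?S = "measure_of (space ?F) (sets ?F) (\<lambda>A. emeasure ?F A + emeasure ?H A)"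
    have S: "emeasure ?S A = emeasure ?F A + emeasure ?H A" if "A \<in> sets borel" for A
      using emeasure_sum_measure[of ?H ?F A] that by simp
    have "lborel = ?S"
    proof (rule lborel_eqI)
      fix l u :: real assume "\<And>b. b \<in> Basis \<Longrightarrow> l \<bullet> b \<le> u \<bullet> b"
      then have lu: "l \<le> u" by simp
      have "emeasure ?S (box l u) = ennreal (F u - F l) + ennreal (H u - H l)"
        using S[of "{l<..<u}"] Ioo[OF F(1) cF lu] Ioo[OF H cH lu] by (simp add: box_real)
      also have "\<dots> = ennreal (u - l)"
        using F(1)[OF lu] H[OF lu] by (subst ennreal_plus[symmetric]) (auto simp: H_def)
      finally show "emeasure ?S (box l u) = (\<Prod>b\<in>Basis. (u - l) \<bullet> b)" by simp
    qed (use sets.sigma_sets_eq[of borel] in \<open>simp add: sets_measure_of_conv\<close>)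
    then show ?thesis using S[OF A] by metis
  qed
  \<comment> \<open>As the two interval measures add up to Lebesgue measure, each of them vanishes
    on Lebesgue null sets.\<close>
  have ac: "absolutely_continuous lborel ?F" "absolutely_continuous lborel ?H"
    unfolding absolutely_continuous_def null_sets_def using sum by auto
  define p where "p = RN_deriv lborel ?F"
  define q where "q = RN_deriv lborel ?H"
  have [measurable]: "p \<in> borel_measurable borel" "q \<in> borel_measurable borel"
    unfolding p_def q_def using borel_measurable_RN_deriv[of lborel] by simp_all
  have p: "density lborel p = ?F" unfolding p_def using ac by (intro sigma_finite_measure.density_RN_deriv[OF sigma_finite_lborel]) auto
  have q: "density lborel q = ?H" unfolding q_def using ac by (intro sigma_finite_measure.density_RN_deriv[OF sigma_finite_lborel]) auto
  have "density lborel (\<lambda>x. p x + q x) = density lborel (\<lambda>x. 1)"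
  proof (rule measure_eqI)
    fix A assume "A \<in> sets (density lborel (\<lambda>x. p x + q x))"
    then have A [measurable]: "A \<in> sets borel" by simp
    have "emeasure (density lborel (\<lambda>x. p x + q x)) A = (\<integral>\<^sup>+x. p x * indicator A x + q x * indicator A x \<partial>lborel)"
      by (subst emeasure_density) (auto simp: distrib_right)
    also have "\<dots> = (\<integral>\<^sup>+x. p x * indicator A x \<partial>lborel) + (\<integral>\<^sup>+x. q x * indicator A x \<partial>lborel)"
      by (intro nn_integral_add) auto
    also have "\<dots> = emeasure ?F A + emeasure ?H A"
      unfolding p[symmetric] q[symmetric] by (simp add: emeasure_density)
    also have "\<dots> = emeasure (density lborel (\<lambda>x. 1)) A"
      using sum[OF A] by (simp add: density_1)
    finally show "emeasure (density lborel (\<lambda>x. p x + q x)) A = emeasure (density lborel (\<lambda>x. 1)) A" .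
  qed simp
  then have "AE x in lborel. p x + q x = 1"
    by (subst (asm) sigma_finite_measure.density_unique_iff[OF sigma_finite_lborel]) auto
  \<comment> \<open>The identity p + q = 1 bounds p by 1 almost everywhere; truncation at 1 then
    gives a version that is bounded at every point.\<close>
  then have le: "AE x in lborel. p x = ennreal (min 1 (enn2real (p x)))"
  proof eventually_elim
    fix x assume pq: "p x + q x = 1"
    have "p x \<le> p x + q x" by simp
    then have "p x \<le> 1" unfolding pq .
    then show "p x = ennreal (min 1 (enn2real (p x)))"
      by (cases "p x") (auto simp: min_def top_unique)
  qed
  define f where "f x = min 1 (enn2real (p x))" for x
  have fm [measurable]: "f \<in> borel_measurable borel" unfolding f_def by measurable
  have f01: "0 \<le> f x \<and> f x \<le> 1" for x by (simp add: f_def)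
  then have bb: "bounded_borel 1 f" using fm by (simp add: bounded_borel_def)
  show ?thesis
  proof (intro bexI[of _ f] conjI allI impI fm)
    fix x y :: real assume xy: "x \<le> y"
    have "ennreal (LBINT b:{x<..<y}. f b) = (\<integral>\<^sup>+b. ennreal (indicator {x<..<y} b *\<^sub>R f b) \<partial>lborel)"
      unfolding set_lebesgue_integral_def using bounded_borel_integrable(2)[OF bb] f01
      by (intro nn_integral_eq_integral[symmetric]) (auto simp: set_integrable_def)
    also have "\<dots> = (\<integral>\<^sup>+b. p b * indicator {x<..<y} b \<partial>lborel)"
      using le by (intro nn_integral_cong_AE) (auto simp: f_def indicator_def)
    also have "\<dots> = emeasure ?F {x<..<y}" unfolding p[symmetric] by (simp add: emeasure_density)
    also have "\<dots> = ennreal (F y - F x)" by (rule Ioo[OF F(1) cF xy])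
    finally have "(LBINT b:{x<..<y}. f b) = F y - F x"
      using F(1)[OF xy] f01 by (subst (asm) ennreal_inj) (auto simp: set_lebesgue_integral_def intro!: integral_nonneg_AE)
    then show "(LBINT b=ereal x..ereal y. f b) = F y - F x"
      using xy by (simp add: interval_lebesgue_integral_def)
  qed (use f01 in auto)
qed

text \<open>Adding M x and dividing by 2 M produces a monotone function with slopes in [0, 1]; its
  density is scaled back to 2 M f - M. For M = 0 the function F is constant and the division is
  meaningless.\<close>

lemma lipschitz_density:
  fixes F :: "real \<Rightarrow> real"
  assumes M: "0 \<le> M" and F: "\<And>x y. x \<le> y \<Longrightarrow> \<bar>F y - F x\<bar> \<le> M * (y - x)"
  shows "\<exists>f. bounded_borel M f \<and> (\<forall>x y. x \<le> y \<longrightarrow> (LBINT b=ereal x..ereal y. f b) = F y - F x)"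
proof (cases "M = 0")
  case True
  then have "F y - F x = 0" if "x \<le> y" for x y using F[OF that] by simp
  then show ?thesis by (intro exI[of _ "\<lambda>_. 0"]) (simp add: True bounded_borel_def)
next
  case False
  then have M': "0 < M" using M by simp
  define G where "G x = (F x + M * x) / (2 * M)" for x
  have 1: "G x \<le> G y" if "x \<le> y" for x y
    using F[OF that] M' unfolding G_def by (intro divide_right_mono) (auto simp: abs_le_iff algebra_simps)
  have 2: "G y - G x \<le> y - x" if "x \<le> y" for x y
  proof -
    have "G y - G x = (F y - F x + M * (y - x)) / (2 * M)" by (simp add: G_def diff_divide_distrib[symmetric] algebra_simps)
    also have "\<dots> \<le> (2 * M * (y - x)) / (2 * M)"
      using F[OF that] M' by (intro divide_right_mono) (auto simp: abs_le_iff algebra_simps)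
    also have "\<dots> = y - x" using M' by simp
    finally show ?thesis .
  qed
  obtain f where f: "f \<in> borel_measurable borel" "\<And>x. 0 \<le> f x \<and> f x \<le> 1"
    "\<And>x y. x \<le> y \<Longrightarrow> (LBINT b=ereal x..ereal y. f b) = G y - G x"
    using lipschitz_monotone_density[of G] 1 2 by blast
  have bb: "bounded_borel 1 f" using f by (auto simp: bounded_borel_def)
  show ?thesis
  proof (intro exI[of _ "\<lambda>x. 2 * M * f x - M"] conjI allI impI)
    have "0 \<le> 2 * M * f x" "2 * M * f x \<le> 2 * M * 1" for x
      using f(2)[of x] M' by (auto intro!: mult_nonneg_nonneg mult_left_mono)
    then show "bounded_borel M (\<lambda>x. 2 * M * f x - M)"
      using f(1) by (fastforce simp: bounded_borel_def abs_le_iff)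
    fix x y :: real assume xy: "x \<le> y"
    have i: "interval_lebesgue_integrable lborel (ereal x) (ereal y) (\<lambda>b. M)"
      using M by (intro bounded_borel_integrable(1)[of M]) (simp add: bounded_borel_def)
    have "(LBINT b=ereal x..ereal y. 2 * M * f b - M) = 2 * M * (LBINT b=ereal x..ereal y. f b) - (LBINT b=ereal x..ereal y. M)"
      using bounded_borel_integrable(1)[OF bb] i by (subst interval_lebesgue_integral_diff) auto
    also have "\<dots> = 2 * M * (G y - G x) - M * (y - x)" using f(3)[OF xy] by simp
    also have "\<dots> = F y - F x" using M' by (simp add: G_def field_simps)
    finally show "(LBINT b=ereal x..ereal y. 2 * M * f b - M) = F y - F x" .
  qed
qed

section \<open>Bounded harmonic functions and their interval integrals\<close>

text \<open>The values of \<open>u\<close> outside the half-plane \<open>a > 0\<close> only have to be bounded and measurable.\<close>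

definition bharm :: "real \<Rightarrow> (real \<times> real \<Rightarrow> real) \<Rightarrow> bool" where
  "bharm M u \<longleftrightarrow> u \<in> borel_measurable (borel \<Otimes>\<^sub>M borel) \<and> (\<forall>z. \<bar>u z\<bar> \<le> M) \<and>
    (\<forall>a>0. \<forall>b. u (a, b) = (\<integral>h. u (a * fst h, a * snd h + b) \<partial>step_law))"

definition slice_int :: "(real \<times> real \<Rightarrow> real) \<Rightarrow> real \<Rightarrow> real \<Rightarrow> real \<Rightarrow> real" where
  "slice_int u a x y = (LBINT b=ereal x..ereal y. u (a, b))"

lemma bharmD:
  assumes "bharm M u"
  shows "u \<in> borel_measurable (borel \<Otimes>\<^sub>M borel)" "\<bar>u z\<bar> \<le> M" "0 \<le> M"
    "0 < a \<Longrightarrow> u (a, b) = (\<integral>h. u (a * fst h, a * snd h + b) \<partial>step_law)"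
proof -
  show "u \<in> borel_measurable (borel \<Otimes>\<^sub>M borel)" and le: "\<bar>u z\<bar> \<le> M"
    using assms unfolding bharm_def by blast+
  show "0 \<le> M" using order_trans[OF abs_ge_zero le] .
  show "0 < a \<Longrightarrow> u (a, b) = (\<integral>h. u (a * fst h, a * snd h + b) \<partial>step_law)"
    using assms unfolding bharm_def by blast
qed

lemma bharm_slice: "bharm M u \<Longrightarrow> bounded_borel M (\<lambda>b. u (a, b))"
  by (auto simp: bharm_def bounded_borel_def)

lemma slice_int_eq: "x \<le> y \<Longrightarrow> slice_int u a x y = (\<integral>b. indicator {x<..<y} b * u (a, b) \<partial>lborel)"
  by (simp add: slice_int_def interval_lebesgue_integral_def set_lebesgue_integral_def)

lemma slice_int_bound: "bharm M u \<Longrightarrow> \<bar>slice_int u a x y\<bar> \<le> M * \<bar>y - x\<bar>"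
  unfolding slice_int_def by (intro interval_integral_bound bharm_slice)

lemma step_law_fst: "U \<in> borel_measurable borel \<Longrightarrow> (\<integral>h. U (fst h) \<partial>step_law) = (\<integral>a. U a \<partial>scale_law)" for U :: "real \<Rightarrow> real"
proof -
  assume [measurable]: "U \<in> borel_measurable borel"
  have "(\<integral>h. U (fst h) \<partial>step_law) = (\<integral>a. U a \<partial>distr step_law scale_law fst)"
    unfolding step_law_def by (intro integral_distr[symmetric]) measurable
  also have "distr step_law scale_law fst = scale_law"
    unfolding step_law_def by (rule shift.distr_pair_fst)
  finally show ?thesis .
qed

lemma step_law_snd_mean: "integrable step_law (\<lambda>h. \<bar>snd h\<bar>)" "(\<integral>h. \<bar>snd h\<bar> \<partial>step_law) = 1/2"
  and step_law_fst_mean: "integrable step_law (\<lambda>h. \<bar>fst h\<bar>)" "(\<integral>h. \<bar>fst h\<bar> \<partial>step_law) = 1/2"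
proof -
  have "(\<integral>\<^sup>+h. ennreal \<bar>snd h\<bar> \<partial>step_law) = ennreal (1/2)"
    by (subst nn_integral_step_law) (simp_all add: shift_law_mean scale.emeasure_space_1[simplified])
  then show "integrable step_law (\<lambda>h. \<bar>snd h\<bar>)" "(\<integral>h. \<bar>snd h\<bar> \<partial>step_law) = 1/2"
    using nn_integral_eq_integrable[of "\<lambda>h. \<bar>snd h\<bar>" step_law "1/2"] by auto
  have "(\<integral>\<^sup>+h. ennreal \<bar>fst h\<bar> \<partial>step_law) = ennreal (1/2)"
    by (subst nn_integral_step_law) (simp_all add: scale_law_mean shift.emeasure_space_1[simplified])
  then show "integrable step_law (\<lambda>h. \<bar>fst h\<bar>)" "(\<integral>h. \<bar>fst h\<bar> \<partial>step_law) = 1/2"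
    using nn_integral_eq_integrable[of "\<lambda>h. \<bar>fst h\<bar>" step_law "1/2"] by auto
qed

lemma AE_step_law_pos: "AE h in step_law. 0 < fst h"
proof -
  have "(\<integral>\<^sup>+h. indicator {..0} (fst h) \<partial>step_law) = (\<integral>\<^sup>+a. indicator {..0} a \<partial>scale_law)"
    by (subst nn_integral_step_law) (simp_all add: shift.emeasure_space_1[simplified])
  also have "\<dots> = (\<integral>\<^sup>+a. 0 \<partial>scale_law)"
    using AE_scale_law_pos by (intro nn_integral_cong_AE) (auto simp: indicator_def)
  finally have "(\<integral>\<^sup>+h. indicator {..0} (fst h) \<partial>step_law) = 0" by simp
  then have "AE h in step_law. indicator {..0} (fst h) = (0::ennreal)"
    by (subst (asm) nn_integral_0_iff_AE) auto
  then show ?thesis by eventually_elim (auto simp: indicator_def split: if_splits)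
qed

interpretation lborel_step: pair_sigma_finite lborel step_law ..

lemma step_integrable:
  assumes "f \<in> borel_measurable step_law" "\<And>h. \<bar>f h\<bar> \<le> (M::real)"
  shows "integrable step_law f"
  using assms by (intro step_law.integrable_const_bound[where B = M]) auto

lemma slice_int_step_integrand:
  assumes u: "bharm M u" and xy: "x \<le> y"
  shows "(\<integral>b. indicator {x<..<y} b * u (a * fst h, a * snd h + b) \<partial>lborel)
    = slice_int u (a * fst h) (x + a * snd h) (y + a * snd h)"
  using interval_integral_translate[OF xy, of "\<lambda>b. u (a * fst h, b)" "a * snd h"] xy
  unfolding slice_int_def by (simp add: interval_lebesgue_integral_def set_lebesgue_integral_def)

lemma slice_int_step_measurable:
  assumes u: "bharm M u" and xy: "x \<le> y"
  shows "(\<lambda>h. slice_int u (a * fst h) (x + a * snd h) (y + a * snd h)) \<in> borel_measurable step_law"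
proof -
  note [measurable] = bharmD(1)[OF u]
  show ?thesis unfolding slice_int_step_integrand[OF u xy, symmetric] by measurable
qed

text \<open>Harmonicity is integrated over b: the scale A of a step changes the height a to a A, and
  the shift B moves the interval by a B.\<close>

lemma slice_int_step:
  assumes u: "bharm M u" and a: "0 < a" and xy: "x \<le> y"
  shows "slice_int u a x y = (\<integral>h. slice_int u (a * fst h) (x + a * snd h) (y + a * snd h) \<partial>step_law)"
proof -
  note [measurable] = bharmD(1)[OF u]
  let ?f = "\<lambda>b h. indicator {x<..<y} b * u (a * fst h, a * snd h + b)"
  have int: "integrable (lborel \<Otimes>\<^sub>M step_law) (case_prod ?f)"
  proof (rule integrableI_bounded_set[where A = "{x<..<y} \<times> UNIV" and B = M])
    show "{x<..<y} \<times> UNIV \<in> sets (lborel \<Otimes>\<^sub>M step_law)"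
      using sets.top[of step_law] by (intro pair_measureI) auto
    have "emeasure (lborel \<Otimes>\<^sub>M step_law) ({x<..<y} \<times> UNIV) = emeasure lborel {x<..<y} * emeasure step_law UNIV"
      using sets.top[of step_law] by (intro step_law.emeasure_pair_measure_Times) auto
    then show "emeasure (lborel \<Otimes>\<^sub>M step_law) ({x<..<y} \<times> UNIV) < \<infinity>"
      using xy step_law.emeasure_space_1 by simp
  qed (use bharmD(2)[OF u] in \<open>auto simp: indicator_def\<close>)
  have "slice_int u a x y = (\<integral>b. (\<integral>h. ?f b h \<partial>step_law) \<partial>lborel)"
    unfolding slice_int_eq[OF xy] by (intro Bochner_Integration.integral_cong refl) (simp add: bharmD(4)[OF u a])
  also have "\<dots> = (\<integral>h. (\<integral>b. ?f b h \<partial>lborel) \<partial>step_law)"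
    by (rule lborel_step.Fubini_integral[OF int, symmetric])
  finally show ?thesis unfolding slice_int_step_integrand[OF u xy] .
qed

text \<open>Undoing the move of the interval by a B costs 2 M a |B|, on average M a because |B| has
  mean 1/2. What remains is the approximate mean value equation of \<open>scale_avg_limit\<close>
  with C = M.\<close>

lemma slice_int_limit:
  assumes u: "bharm M u" and xy: "x \<le> y"
  shows "\<exists>l. \<forall>a>0. \<bar>slice_int u a x y - l\<bar> \<le> 2 * M * a"
proof (rule scale_avg_limit)
  note [measurable] = bharmD(1)[OF u]
  show m [measurable]: "(\<lambda>a. slice_int u a x y) \<in> borel_measurable borel"
    unfolding slice_int_eq[OF xy] by measurable
  show "\<bar>slice_int u a x y\<bar> \<le> M * \<bar>y - x\<bar>" for a by (rule slice_int_bound[OF u])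
  fix a :: real assume a: "0 < a"
  let ?F = "\<lambda>h. slice_int u (a * fst h) (x + a * snd h) (y + a * snd h)" and ?G = "\<lambda>h. slice_int u (a * fst h) x y"
  have iF: "integrable step_law ?F"
    using slice_int_bound[OF u] by (intro step_integrable[where M = "M * \<bar>y - x\<bar>"] slice_int_step_measurable[OF u xy])
      (metis add_diff_cancel_right)
  have iG: "integrable step_law ?G"
    using slice_int_bound[OF u] by (intro step_integrable[where M = "M * \<bar>y - x\<bar>"]) auto
  have "scale_avg (\<lambda>a. slice_int u a x y) a = (\<integral>h. ?G h \<partial>step_law)"
    unfolding scale_avg_def by (rule step_law_fst[symmetric]) measurable
  then have "slice_int u a x y - scale_avg (\<lambda>a. slice_int u a x y) a = (\<integral>h. ?F h - ?G h \<partial>step_law)"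
    unfolding slice_int_step[OF u a xy] using iF iG by simp
  then have "\<bar>slice_int u a x y - scale_avg (\<lambda>a. slice_int u a x y) a\<bar> \<le> (\<integral>h. \<bar>?F h - ?G h\<bar> \<partial>step_law)"
    by (simp only: integral_abs_bound)
  also have "\<dots> \<le> (\<integral>h. 2 * M * a * \<bar>snd h\<bar> \<partial>step_law)"
  proof (rule integral_mono)
    fix h :: "real \<times> real"
    show "\<bar>?F h - ?G h\<bar> \<le> 2 * M * a * \<bar>snd h\<bar>"
    proof -
      have "\<bar>?F h - ?G h\<bar> \<le> 2 * M * \<bar>a * snd h\<bar>"
        using interval_integral_shift_bound[OF bharm_slice[OF u], of x "a * snd h" y "a * fst h"]
        by (simp only: slice_int_def)
      also have "\<dots> = 2 * M * a * \<bar>snd h\<bar>" using a by (simp add: abs_mult)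
      finally show ?thesis .
    qed
  next
    show "integrable step_law (\<lambda>h. \<bar>?F h - ?G h\<bar>)" using iF iG by (intro integrable_abs Bochner_Integration.integrable_diff)
    show "integrable step_law (\<lambda>h. 2 * M * a * \<bar>snd h\<bar>)" by (intro integrable_mult_right step_law_snd_mean)
  qed
  also have "\<dots> = M * a" using step_law_snd_mean by simp
  finally show "\<bar>slice_int u a x y - scale_avg (\<lambda>a. slice_int u a x y) a\<bar> \<le> M * a" .
qed

text \<open>One step replaces the bound C a by C a A on a shifted interval. As the bound is uniform
  over intervals it can be iterated, gaining the mean 1/2 of A each time, so all interval integrals
  vanish. Hence w(a, b) = 0 for every a > 0 and almost every b; harmonicity makes this pointwise,
  since the shift B has a density and a b' + b avoids Lebesgue null sets almost surely.\<close>

lemma bharm_zero: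
  assumes w: "bharm M w" and small: "\<And>a x y. 0 < a \<Longrightarrow> x \<le> y \<Longrightarrow> \<bar>slice_int w a x y\<bar> \<le> C * a"
    and a: "0 < a"
  shows "w (a, b) = 0"
proof -
  note [measurable] = bharmD(1)[OF w]
  have decay: "\<bar>slice_int w a x y\<bar> \<le> C * a * (1/2) ^ n" if "0 < a" "x \<le> y" for a x y n
    using that
  proof (induct n arbitrary: a x y)
    case (Suc n)
    let ?F = "\<lambda>h. slice_int w (a * fst h) (x + a * snd h) (y + a * snd h)"
    have iF: "integrable step_law ?F"
      using slice_int_bound[OF w] by (intro step_integrable[where M = "M * \<bar>y - x\<bar>"] slice_int_step_measurable[OF w Suc(3)])
        (metis add_diff_cancel_right)
    have "\<bar>slice_int w a x y\<bar> \<le> (\<integral>h. \<bar>?F h\<bar> \<partial>step_law)"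
      unfolding slice_int_step[OF w Suc(2,3)] by (rule integral_abs_bound)
    also have "\<dots> \<le> (\<integral>h. C * a * (1/2) ^ n * \<bar>fst h\<bar> \<partial>step_law)"
    proof (rule integral_mono_AE)
      show "AE h in step_law. \<bar>?F h\<bar> \<le> C * a * (1/2) ^ n * \<bar>fst h\<bar>"
        using AE_step_law_pos
      proof eventually_elim
        fix h :: "real \<times> real" assume "0 < fst h"
        then show "\<bar>?F h\<bar> \<le> C * a * (1/2) ^ n * \<bar>fst h\<bar>"
          using Suc(1)[of "a * fst h" "x + a * snd h" "y + a * snd h"] Suc(2,3) by (simp add: ac_simps)
      qed
    qed (use iF step_law_fst_mean in auto)
    also have "\<dots> = C * a * (1/2) ^ Suc n" using step_law_fst_mean by simp
    finally show ?case .
  qed (use small in simp)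
  have zero: "slice_int w a x y = 0" if "0 < a" "x \<le> y" for a x y
  proof -
    have "(\<lambda>n. C * a * (1/2) ^ n) \<longlonglongrightarrow> C * a * 0" by (intro tendsto_intros LIMSEQ_power_zero) auto
    then have "\<bar>slice_int w a x y\<bar> \<le> C * a * 0"
      by (rule LIMSEQ_le_const) (use decay[OF that] in auto)
    then show ?thesis by simp
  qed
  have AE0: "AE b in lborel. w (a, b) = 0" if "0 < a" for a
    using zero[OF that] by (intro AE_zero_of_interval_integrals[OF bharm_slice[OF w]]) (simp add: slice_int_def)
  have AE_shift: "AE b' in shift_law. w (a', a * b' + b) = 0" if a': "0 < a'" for a'
  proof -
    have "AE x in lborel. w (a', b + a * x) = 0"
      by (rule AE_borel_affine[of a "\<lambda>x. w (a', x) = 0" b]) (use a AE0[OF a'] in simp_all)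
    then show ?thesis
      unfolding shift_law_def by (subst AE_density) (auto simp: add.commute)
  qed
  have "w (a, b) = (\<integral>h. w (a * fst h, a * snd h + b) \<partial>step_law)" by (rule bharmD(4)[OF w a])
  also have "\<dots> = (\<integral>h. 0 \<partial>step_law)"
  proof (rule integral_cong_AE)
    have "(\<integral>\<^sup>+h. ennreal \<bar>w (a * fst h, a * snd h + b)\<bar> \<partial>step_law)
        = (\<integral>\<^sup>+a'. (\<integral>\<^sup>+b'. ennreal \<bar>w (a * a', a * b' + b)\<bar> \<partial>shift_law) \<partial>scale_law)"
      by (subst nn_integral_step_law) simp_all
    also have "\<dots> = (\<integral>\<^sup>+a'. 0 \<partial>scale_law)"
    proof (rule nn_integral_cong_AE)
      show "AE a' in scale_law. (\<integral>\<^sup>+b'. ennreal \<bar>w (a * a', a * b' + b)\<bar> \<partial>shift_law) = 0"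
        using AE_scale_law_pos
      proof eventually_elim
        fix a' :: real assume "0 < a'"
        then have "AE b' in shift_law. w (a * a', a * b' + b) = 0" using a by (intro AE_shift) simp
        then have "(\<integral>\<^sup>+b'. ennreal \<bar>w (a * a', a * b' + b)\<bar> \<partial>shift_law) = (\<integral>\<^sup>+b'. 0 \<partial>shift_law)"
          by (intro nn_integral_cong_AE) auto
        then show "(\<integral>\<^sup>+b'. ennreal \<bar>w (a * a', a * b' + b)\<bar> \<partial>shift_law) = 0" by simp
      qed
    qed
    finally have "(\<integral>\<^sup>+h. ennreal \<bar>w (a * fst h, a * snd h + b)\<bar> \<partial>step_law) = 0" by simp
    then have "AE h in step_law. ennreal \<bar>w (a * fst h, a * snd h + b)\<bar> = 0"
      by (subst (asm) nn_integral_0_iff_AE) auto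
    then show "AE h in step_law. w (a * fst h, a * snd h + b) = 0" by eventually_elim simp
  qed auto
  finally show ?thesis by simp
qed

section \<open>Poisson integrals and the representation of bounded harmonic functions\<close>

interpretation hitting_step: pair_sigma_finite hitting_measure step_law ..
interpretation lborel_hitting: pair_sigma_finite lborel hitting_measure ..

lemma integral_hitting_stationary:
  assumes g: "bounded_borel M g"
  shows "(\<integral>x. g x \<partial>hitting_measure) = (\<integral>h. (\<integral>x. g (fst h * x + snd h) \<partial>hitting_measure) \<partial>step_law)"
proof -
  note [measurable] = bounded_borelD(1)[OF g]
  note bd = bounded_borelD(2)[OF g]
  \<comment> \<open>Adding M makes the function nonnegative, so that stationarity in the form of
    \<open>hitting_stationary\<close> applies; M is subtracted at the end.\<close>
  let ?g = "\<lambda>x. g x + M"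
  have g0: "0 \<le> ?g x" for x using bd[of x] by (simp add: abs_le_iff)
  have g2: "\<bar>?g x\<bar> \<le> 2 * M" for x using bd[of x] by (simp add: abs_le_iff)
  have ig: "integrable hitting_measure (\<lambda>x. ?g (a * x + b))" for a b
    using g2 by (intro hitting.integrable_const_bound[where B = "2 * M"]) auto
  have ig': "integrable hitting_measure (\<lambda>x. g (a * x + b))" for a b
    using bd by (intro hitting.integrable_const_bound[where B = "M"]) auto
  have inner: "(\<integral>x. ?g (a * x + b) \<partial>hitting_measure) = (\<integral>x. g (a * x + b) \<partial>hitting_measure) + M" for a b
    using ig'[of a b] hitting.prob_space by simp
  have in1: "(\<integral>x. ?g x \<partial>hitting_measure) = (\<integral>x. g x \<partial>hitting_measure) + M"
    using inner[of 1 0] by (simp only: mult_1 add_0_right)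
  have nn_inner: "(\<integral>\<^sup>+x. ennreal (?g (a * x + b)) \<partial>hitting_measure) = ennreal (\<integral>x. ?g (a * x + b) \<partial>hitting_measure)" for a b
    by (intro nn_integral_eq_integral ig) (use g0 in auto)
  let ?I = "\<lambda>h. (\<integral>x. ?g (fst h * x + snd h) \<partial>hitting_measure)"
  have I0: "0 \<le> ?I h" for h by (intro integral_nonneg_AE) (use g0 in auto)
  have I2: "\<bar>?I h\<bar> \<le> 2 * M" for h
  proof -
    have "?I h \<le> (\<integral>x. 2 * M \<partial>hitting_measure)"
      by (intro integral_mono ig) (use g2 in \<open>auto simp: abs_le_iff\<close>)
    then show ?thesis using I0[of h] hitting.prob_space by simp
  qed
  have iI: "integrable step_law ?I" by (intro step_integrable[where M = "2 * M"] I2) measurable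
  have "ennreal (\<integral>x. ?g x \<partial>hitting_measure) = (\<integral>\<^sup>+x. ennreal (?g x) \<partial>hitting_measure)"
    using nn_inner[of 1 0] by simp
  also have "\<dots> = (\<integral>\<^sup>+h. (\<integral>\<^sup>+x. ennreal (?g (fst h * x + snd h)) \<partial>hitting_measure) \<partial>step_law)"
    by (intro hitting_stationary) measurable
  also have "\<dots> = (\<integral>\<^sup>+h. ennreal (?I h) \<partial>step_law)" unfolding nn_inner ..
  also have "\<dots> = ennreal (\<integral>h. ?I h \<partial>step_law)"
    by (intro nn_integral_eq_integral iI) (use I0 in auto)
  finally have "(\<integral>x. ?g x \<partial>hitting_measure) = (\<integral>h. ?I h \<partial>step_law)"
    by (subst (asm) ennreal_inj) (use g0 I0 in \<open>auto intro!: integral_nonneg_AE\<close>)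
  then have "(\<integral>x. g x \<partial>hitting_measure) + M = (\<integral>h. (\<integral>x. g (fst h * x + snd h) \<partial>hitting_measure) + M \<partial>step_law)"
    unfolding inner in1 .
  moreover have "integrable step_law (\<lambda>h. \<integral>x. g (fst h * x + snd h) \<partial>hitting_measure)"
    using iI unfolding inner using Bochner_Integration.integrable_diff[OF _ step_law.integrable_const[of M]] by fastforce
  ultimately show ?thesis using step_law.prob_space by simp
qed

definition poisson :: "(real \<Rightarrow> real) \<Rightarrow> real \<times> real \<Rightarrow> real" where
  "poisson f = (\<lambda>z. \<integral>x. f (fst z * x + snd z) \<partial>hitting_measure)"

lemma hitting_abs_mean: "integrable hitting_measure (\<lambda>x. \<bar>x\<bar>)" "(\<integral>x. \<bar>x\<bar> \<partial>hitting_measure) \<le> 1"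
proof -
  have "(\<integral>\<^sup>+x. ennreal (norm \<bar>x\<bar>) \<partial>hitting_measure) < \<infinity>"
    using le_less_trans[OF hitting_mean, of \<infinity>] by simp
  then show i: "integrable hitting_measure (\<lambda>x. \<bar>x\<bar>)" by (intro integrableI_bounded) auto
  have "ennreal (\<integral>x. \<bar>x\<bar> \<partial>hitting_measure) = (\<integral>\<^sup>+x. ennreal \<bar>x\<bar> \<partial>hitting_measure)"
    using i by (intro nn_integral_eq_integral[symmetric]) auto
  then have "ennreal (\<integral>x. \<bar>x\<bar> \<partial>hitting_measure) \<le> ennreal 1" using hitting_mean by simp
  then show "(\<integral>x. \<bar>x\<bar> \<partial>hitting_measure) \<le> 1" by (subst (asm) ennreal_le_iff) auto
qed

lemma bounded_borel_affine: "bounded_borel M f \<Longrightarrow> bounded_borel M (\<lambda>x. f (a * x + b))"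
  by (auto simp: bounded_borel_def)

lemma bounded_borel_hitting: "bounded_borel M f \<Longrightarrow> integrable hitting_measure f"
  by (intro hitting.integrable_const_bound[where B = M]) (auto simp: bounded_borel_def)

lemma hitting_integral_bound: "bounded_borel M f \<Longrightarrow> \<bar>\<integral>x. f x \<partial>hitting_measure\<bar> \<le> M"
proof -
  assume f: "bounded_borel M f"
  have "\<bar>\<integral>x. f x \<partial>hitting_measure\<bar> \<le> (\<integral>x. \<bar>f x\<bar> \<partial>hitting_measure)" by (rule integral_abs_bound)
  also have "\<dots> \<le> (\<integral>x. M \<partial>hitting_measure)"
    using bounded_borelD(2)[OF f] bounded_borel_hitting[OF f] by (intro integral_mono integrable_abs) auto
  finally show ?thesis using hitting.prob_space by simp
qed

lemma poisson_bharm: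
  assumes f: "bounded_borel M f"
  shows "bharm M (poisson f)"
  unfolding bharm_def
proof (intro conjI allI impI)
  note [measurable] = bounded_borelD(1)[OF f]
  show "poisson f \<in> borel_measurable (borel \<Otimes>\<^sub>M borel)" unfolding poisson_def by measurable
  show "\<bar>poisson f z\<bar> \<le> M" for z
    unfolding poisson_def by (rule hitting_integral_bound[OF bounded_borel_affine[OF f]])
  fix a b :: real assume "0 < a"
  have "poisson f (a, b) = (\<integral>h. (\<integral>x. f (a * (fst h * x + snd h) + b) \<partial>hitting_measure) \<partial>step_law)"
    unfolding poisson_def fst_conv snd_conv by (rule integral_hitting_stationary[OF bounded_borel_affine[OF f]])
  then show "poisson f (a, b) = (\<integral>h. poisson f (a * fst h, a * snd h + b) \<partial>step_law)"
    by (simp add: poisson_def algebra_simps)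
qed

text \<open>After exchanging integrals, the interval integral at height a is the mean, over X with
  the hitting law, of the integral of f over the interval shifted by a X. Each shift costs 2 M a
  |X|, and |X| has mean at most 1.\<close>

lemma poisson_avg:
  assumes f: "bounded_borel M f" and a: "0 < a" and xy: "x \<le> y"
  shows "\<bar>slice_int (poisson f) a x y - (LBINT b=ereal x..ereal y. f b)\<bar> \<le> 2 * M * a"
proof -
  note [measurable] = bounded_borelD(1)[OF f]
  let ?f = "\<lambda>b z. indicator {x<..<y} b * f (a * z + b)"
  have int: "integrable (lborel \<Otimes>\<^sub>M hitting_measure) (case_prod ?f)"
  proof (rule integrableI_bounded_set[where A = "{x<..<y} \<times> UNIV" and B = M])
    show "{x<..<y} \<times> UNIV \<in> sets (lborel \<Otimes>\<^sub>M hitting_measure)"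
      by (intro pair_measureI) auto
    have "emeasure (lborel \<Otimes>\<^sub>M hitting_measure) ({x<..<y} \<times> UNIV) = emeasure lborel {x<..<y} * emeasure hitting_measure UNIV"
      by (intro hitting.emeasure_pair_measure_Times) auto
    then show "emeasure (lborel \<Otimes>\<^sub>M hitting_measure) ({x<..<y} \<times> UNIV) < \<infinity>"
      using xy hitting.emeasure_space_1 by simp
  qed (use bounded_borelD(2)[OF f] in \<open>auto simp: indicator_def\<close>)
  let ?G = "\<lambda>z. LBINT b=ereal (x + a * z)..ereal (y + a * z). f b"
  have inner: "(\<integral>b. ?f b z \<partial>lborel) = ?G z" for z
    using interval_integral_translate[OF xy, of f "a * z"] xy
    by (simp add: interval_lebesgue_integral_def set_lebesgue_integral_def)
  have "slice_int (poisson f) a x y = (\<integral>b. (\<integral>z. ?f b z \<partial>hitting_measure) \<partial>lborel)"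
    unfolding slice_int_eq[OF xy] by (intro Bochner_Integration.integral_cong refl) (simp add: poisson_def)
  also have "\<dots> = (\<integral>z. (\<integral>b. ?f b z \<partial>lborel) \<partial>hitting_measure)"
    by (rule lborel_hitting.Fubini_integral[OF int, symmetric])
  finally have slice_int: "slice_int (poisson f) a x y = (\<integral>z. ?G z \<partial>hitting_measure)" unfolding inner .
  have iG: "integrable hitting_measure ?G"
  proof (rule hitting.integrable_const_bound[where B = "M * \<bar>y - x\<bar>"])
    show "?G \<in> borel_measurable hitting_measure" unfolding inner[symmetric] by measurable
    show "AE z in hitting_measure. norm (?G z) \<le> M * \<bar>y - x\<bar>"
      using interval_integral_bound[OF f] by (metis (no_types, lifting) AE_I2 add_diff_cancel_right real_norm_def)
  qed
  let ?c = "LBINT b=ereal x..ereal y. f b"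
  have "slice_int (poisson f) a x y - ?c = (\<integral>z. ?G z - ?c \<partial>hitting_measure)"
    unfolding slice_int using iG hitting.prob_space by simp
  then have "\<bar>slice_int (poisson f) a x y - ?c\<bar> \<le> (\<integral>z. \<bar>?G z - ?c\<bar> \<partial>hitting_measure)"
    by (simp only: integral_abs_bound)
  also have "\<dots> \<le> (\<integral>z. 2 * M * a * \<bar>z\<bar> \<partial>hitting_measure)"
  proof (rule integral_mono)
    fix z :: real
    have "\<bar>?G z - ?c\<bar> \<le> 2 * M * \<bar>a * z\<bar>" by (rule interval_integral_shift_bound[OF f])
    also have "\<dots> = 2 * M * a * \<bar>z\<bar>" using a by (simp add: abs_mult)
    finally show "\<bar>?G z - ?c\<bar> \<le> 2 * M * a * \<bar>z\<bar>" .
  next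
    show "integrable hitting_measure (\<lambda>z. \<bar>?G z - ?c\<bar>)" using iG by auto
    show "integrable hitting_measure (\<lambda>z. 2 * M * a * \<bar>z\<bar>)" by (intro integrable_mult_right hitting_abs_mean)
  qed
  also have "\<dots> = 2 * M * a * (\<integral>z. \<bar>z\<bar> \<partial>hitting_measure)" by simp
  also have "\<dots> \<le> 2 * M * a * 1"
    using a bounded_borelD(3)[OF f] by (intro mult_left_mono hitting_abs_mean) auto
  finally show ?thesis by simp
qed

lemma le_of_le_linear:
  fixes c C d :: real
  assumes "\<And>a. 0 < a \<Longrightarrow> c \<le> d + C * a"
  shows "c \<le> d"
proof (rule tendsto_lowerbound)
  show "((\<lambda>a. d + C * a) \<longlongrightarrow> d) (at_right 0)" by (auto intro!: tendsto_eq_intros)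
  show "\<forall>\<^sub>F a in at_right 0. c \<le> d + C * a"
    using eventually_at_right_less[of "0::real"] by eventually_elim (rule assms)
qed simp

text \<open>The limits \<open>l x y\<close> are additive over adjacent intervals and bounded by M |y
  - x|, so \<open>l 0\<close> is Lipschitz and has a density f bounded by M. The interval integrals
  of u and of \<open>poisson f\<close> both lie within 2 M a of \<open>l x y\<close>; this is the 4
  M a to which \<open>bharm_zero\<close> is applied.\<close>

lemma bharm_representation:
  assumes u: "bharm M u"
  shows "\<exists>f. bounded_borel M f \<and> (\<forall>a>0. \<forall>b. u (a, b) = poisson f (a, b))"
proof -
  have M0: "0 \<le> M" using bharmD(3)[OF u] .
  have "\<exists>l. \<forall>a>0. \<bar>slice_int u a x y - l\<bar> \<le> 2 * M * a" for x y
  proof (cases "x \<le> y")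
    case False
    then obtain l where l: "\<And>a. 0 < a \<Longrightarrow> \<bar>slice_int u a y x - l\<bar> \<le> 2 * M * a" using slice_int_limit[OF u, of y x] by auto
    have "slice_int u a x y = - slice_int u a y x" for a unfolding slice_int_def by (rule interval_integral_endpoints_reverse)
    then show ?thesis using l by (intro exI[of _ "- l"]) (auto simp: abs_minus_commute)
  qed (rule slice_int_limit[OF u])
  then obtain l where l: "\<And>x y a. 0 < a \<Longrightarrow> \<bar>slice_int u a x y - l x y\<bar> \<le> 2 * M * a" by metis
  have add: "l 0 y - l 0 x = l x y" for x y
  proof -
    have "\<bar>l 0 y - l 0 x - l x y\<bar> \<le> 0"
    proof (rule le_of_le_linear)
      fix a :: real assume a: "0 < a"
      have "slice_int u a 0 x + slice_int u a x y = slice_int u a 0 y"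
        unfolding slice_int_def by (rule interval_integral_add[OF bharm_slice[OF u]])
      then show "\<bar>l 0 y - l 0 x - l x y\<bar> \<le> 0 + 6 * M * a"
        using l[OF a, of 0 y] l[OF a, of 0 x] l[OF a, of x y] by linarith
    qed
    then show ?thesis by simp
  qed
  have bound: "\<bar>l x y\<bar> \<le> M * \<bar>y - x\<bar>" for x y
  proof (rule le_of_le_linear)
    fix a :: real assume a: "0 < a"
    show "\<bar>l x y\<bar> \<le> M * \<bar>y - x\<bar> + 2 * M * a" using l[OF a, of x y] slice_int_bound[OF u, of a x y] by linarith
  qed
  have "\<bar>l 0 y - l 0 x\<bar> \<le> M * (y - x)" if "x \<le> y" for x y
    using bound[of x y] that unfolding add by simp
  from lipschitz_density[OF M0 this] obtain f where f: "bounded_borel M f"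
    "\<And>x y. x \<le> y \<Longrightarrow> (LBINT b=ereal x..ereal y. f b) = l 0 y - l 0 x"
    by blast
  let ?w = "\<lambda>z. u z - poisson f z"
  note v = poisson_bharm[OF f(1)]
  note [measurable] = bharmD(1)[OF u] bharmD(1)[OF v]
  have w: "bharm (2 * M) ?w"
    unfolding bharm_def
  proof (intro conjI allI impI)
    show "\<bar>?w z\<bar> \<le> 2 * M" for z using bharmD(2)[OF u, of z] bharmD(2)[OF v, of z] by linarith
    fix a b :: real assume a: "0 < a"
    have "integrable step_law (\<lambda>h. u (a * fst h, a * snd h + b))" "integrable step_law (\<lambda>h. poisson f (a * fst h, a * snd h + b))"
      using bharmD(2)[OF u] bharmD(2)[OF v] by (auto intro!: step_integrable[where M = M])
    then show "?w (a, b) = (\<integral>h. ?w (a * fst h, a * snd h + b) \<partial>step_law)"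
      by (simp add: bharmD(4)[OF u a, of b] bharmD(4)[OF v a, of b])
  qed measurable
  have small: "\<bar>slice_int ?w a x y\<bar> \<le> (4 * M) * a" if a: "0 < a" and xy: "x \<le> y" for a x y
  proof -
    have "slice_int ?w a x y = slice_int u a x y - slice_int (poisson f) a x y"
      unfolding slice_int_def
      by (intro interval_lebesgue_integral_diff bounded_borel_integrable(1)[OF bharm_slice[OF u]]
          bounded_borel_integrable(1)[OF bharm_slice[OF v]])
    then show ?thesis
      using l[OF a, of x y] poisson_avg[OF f(1) a xy] unfolding f(2)[OF xy] add by linarith
  qed
  have "u (a, b) = poisson f (a, b)" if "0 < a" for a b
    using bharm_zero[OF w small that, of b] by simp
  then show ?thesis using f(1) by blast
qed

text \<open>In the limit a to 0 the bound s passes from the Poisson integral to the interval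
  integrals of f. These therefore have a density g bounded by s, and f = g almost everywhere. This
  is the nontrivial half of the isometry.\<close>

lemma poisson_norm:
  assumes f: "bounded_borel M f" and s: "\<And>a b. 0 < a \<Longrightarrow> \<bar>poisson f (a, b)\<bar> \<le> s"
  shows "AE x in lborel. \<bar>f x\<bar> \<le> s"
proof -
  have s0: "0 \<le> s" using s[of 1 0] by linarith
  note [measurable] = bharmD(1)[OF poisson_bharm[OF f]]
  let ?F = "\<lambda>x. LBINT b=ereal 0..ereal x. f b"
  have F: "?F y - ?F x = (LBINT b=ereal x..ereal y. f b)" for x y
    using interval_integral_add[OF f, of 0 x y] by linarith
  have "\<bar>LBINT b=ereal x..ereal y. f b\<bar> \<le> s * (y - x)" if xy: "x \<le> y" for x y
  proof (rule le_of_le_linear)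
    fix a :: real assume a: "0 < a"
    have "bounded_borel s (\<lambda>b. poisson f (a, b))"
      using s[OF a] by (auto simp: bounded_borel_def)
    from interval_integral_bound[OF this, of x y] xy
    show "\<bar>LBINT b=ereal x..ereal y. f b\<bar> \<le> s * (y - x) + 2 * M * a"
      using poisson_avg[OF f a xy] unfolding slice_int_def by simp
  qed
  then obtain g where g: "bounded_borel s g" "\<And>x y. x \<le> y \<Longrightarrow> (LBINT b=ereal x..ereal y. g b) = ?F y - ?F x"
    using lipschitz_density[OF s0, of ?F] unfolding F by blast
  have fg: "bounded_borel (M + s) (\<lambda>x. f x - g x)"
    using f g(1) unfolding bounded_borel_def by (auto intro: order_trans[OF abs_triangle_ineq4] add_mono)
  have "AE x in lborel. f x - g x = 0"
  proof (rule AE_zero_of_interval_integrals[OF fg])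
    fix x y :: real assume xy: "x \<le> y"
    have "(LBINT b=ereal x..ereal y. f b - g b) = (LBINT b=ereal x..ereal y. f b) - (LBINT b=ereal x..ereal y. g b)"
      by (intro interval_lebesgue_integral_diff bounded_borel_integrable(1)[OF f] bounded_borel_integrable(1)[OF g(1)])
    then show "(LBINT b=ereal x..ereal y. f b - g b) = 0" using g(2)[OF xy] by (simp add: F)
  qed
  then show ?thesis by eventually_elim (use bounded_borelD(2)[OF g(1)] in auto)
qed

section \<open>The Poisson boundary\<close>

definition half_plane :: "(real \<times> real) set" where
  "half_plane = {0<..} \<times> UNIV"

lemma half_plane_iff [simp]: "z \<in> half_plane \<longleftrightarrow> 0 < fst z"
  by (cases z) (simp add: half_plane_def)

lemma open_half_plane: "open half_plane"
  unfolding half_plane_def by (intro open_Times) auto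

lemma half_plane_borel [measurable]: "half_plane \<in> sets borel"
  using open_half_plane by (rule borel_open)

lemma carrier_aff [simp]: "carrier aff = half_plane"
  and mult_aff: "x \<otimes>\<^bsub>aff\<^esub> y = (fst x * fst y, fst x * snd y + snd x)"
  and one_aff: "\<one>\<^bsub>aff\<^esub> = (1, 0)"
  by (simp_all add: aff_def half_plane_def case_prod_beta)

lemma aff_topology_eq: "aff_topology = top_of_set half_plane"
  by (simp add: aff_topology_def half_plane_def)

lemma group_aff: "group aff"
proof (rule groupI)
  fix x assume "x \<in> carrier aff"
  then show "\<exists>y\<in>carrier aff. y \<otimes>\<^bsub>aff\<^esub> x = \<one>\<^bsub>aff\<^esub>"
    by (intro bexI[of _ "(1 / fst x, - snd x / fst x)"]) (auto simp: mult_aff one_aff)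
qed (auto simp: mult_aff one_aff algebra_simps)

lemma inv_aff:
  assumes "x \<in> half_plane"
  shows "inv\<^bsub>aff\<^esub> x = (1 / fst x, - snd x / fst x)"
  using assms by (intro group.inv_equality[OF group_aff]) (auto simp: mult_aff one_aff)

lemma second_countable_euclidean: "second_countable (euclidean :: 'a::second_countable_topology topology)"
proof -
  obtain B :: "'a set set" where B: "countable B" "topological_basis B"
    using ex_countable_basis by blast
  show ?thesis
    unfolding second_countable_def
  proof (intro exI[of _ B] conjI ballI allI impI B(1))
    show "openin euclidean V" if "V \<in> B" for V
      using topological_basis_open[OF B(2) that] by simp
    fix U :: "'a set" and x assume "openin euclidean U \<and> x \<in> U"
    then obtain V where "V \<in> B" "x \<in> V" "V \<subseteq> U" using topological_basisE[OF B(2), of U x] by auto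
    then show "\<exists>V\<in>B. x \<in> V \<and> V \<subseteq> U" by blast
  qed
qed

lemma sets_borel_of_top_of_set:
  assumes "open S"
  shows "sets (borel_of (top_of_set S)) = sets (restrict_space borel S)"
proof -
  have "{U. openin (top_of_set S) U} = (\<inter>) S ` {U. open U}"
    by (auto simp: openin_open)
  moreover have "(\<inter>) S ` sigma_sets UNIV {U. open U} = sigma_sets S ((\<inter>) S ` {U. open U})"
    using assms by (intro sigma_sets_Int) auto
  moreover have "sets (restrict_space borel S) = (\<inter>) S ` sigma_sets UNIV {U. open U}"
    unfolding sets_restrict_space borel_def by (subst sets_measure_of) auto
  ultimately show ?thesis by (simp add: sets_borel_of)
qed

lemma lcsc_group_aff: "lcsc_group aff aff_topology"
  unfolding lcsc_group_def
proof (intro conjI group_aff)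
  show "topspace aff_topology = carrier aff" by (simp add: aff_topology_eq)
  have prod: "prod_topology aff_topology aff_topology = top_of_set (half_plane \<times> half_plane)"
    unfolding aff_topology_eq by simp
  show "continuous_map (prod_topology aff_topology aff_topology) aff_topology (\<lambda>(x, y). x \<otimes>\<^bsub>aff\<^esub> y)"
    unfolding prod unfolding aff_topology_eq
    by (auto simp: mult_aff case_prod_beta' intro!: continuous_intros)
  show "continuous_map aff_topology aff_topology (\<lambda>x. inv\<^bsub>aff\<^esub> x)"
  proof (rule continuous_map_eq)
    show "continuous_map aff_topology aff_topology (\<lambda>x. (1 / fst x, - snd x / fst x))"
      unfolding aff_topology_eq by (auto intro!: continuous_intros)
  qed (auto simp: aff_topology_eq inv_aff)
  show "Hausdorff_space aff_topology"
    unfolding aff_topology_eq by (intro Hausdorff_space_subtopology) simp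
  show "locally_compact_space aff_topology"
    unfolding aff_topology_eq using open_half_plane
    by (intro locally_compact_space_open_subset) (auto simp: locally_compact_space_euclidean)
  show "second_countable aff_topology"
    unfolding aff_topology_eq by (intro second_countable_subtopology second_countable_euclidean)
qed

section \<open>Haar measure and null sets on the affine group\<close>

lemma sets_borel_of_aff: "sets (borel_of aff_topology) = sets (restrict_space borel half_plane)"
  unfolding aff_topology_eq by (rule sets_borel_of_top_of_set[OF open_half_plane])

text \<open>Left multiplication by (a, b) sends (c, d) to (a c, a d + b) and scales area by a^2; the
  density 1/c^2 compensates for this.\<close>

definition aff_haar :: "(real \<times> real) measure" where
  "aff_haar = density (restrict_space lborel half_plane) (\<lambda>z. ennreal (1 / (fst z)\<^sup>2))"

lemma sets_aff_haar: "sets aff_haar = sets (restrict_space borel half_plane)"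
  unfolding aff_haar_def sets_density by (rule sets_restrict_space_cong) simp

lemma sets_restrict_half_plane: "A \<in> sets (restrict_space borel half_plane) \<longleftrightarrow> A \<in> sets borel \<and> A \<subseteq> half_plane"
  by (subst sets_restrict_space_iff) auto

lemma emeasure_aff_haar:
  assumes A: "A \<in> sets borel" "A \<subseteq> half_plane"
  shows "emeasure aff_haar A = (\<integral>\<^sup>+c. (\<integral>\<^sup>+d. ennreal (1 / c\<^sup>2) * indicator A (c, d) \<partial>lborel) \<partial>lborel)"
proof -
  have A' [measurable]: "A \<in> sets (borel \<Otimes>\<^sub>M borel)" using A(1) by (simp only: borel_prod)
  have "(\<lambda>z::real \<times> real. ennreal (1 / (fst z)\<^sup>2)) \<in> borel_measurable borel"
    unfolding borel_prod[symmetric] by measurable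
  then have m: "(\<lambda>z. ennreal (1 / (fst z)\<^sup>2)) \<in> borel_measurable (restrict_space lborel half_plane)"
    by (intro measurable_restrict_space1) (simp only: measurable_lborel1 measurable_lborel2)
  have "emeasure aff_haar A = (\<integral>\<^sup>+z. ennreal (1 / (fst z)\<^sup>2) * indicator A z \<partial>restrict_space lborel half_plane)"
    unfolding aff_haar_def using A
    by (intro emeasure_density m) (auto simp: sets_restrict_space_iff)
  also have "\<dots> = (\<integral>\<^sup>+z. ennreal (1 / (fst z)\<^sup>2) * indicator A z * indicator half_plane z \<partial>lborel)"
    by (intro nn_integral_restrict_space) auto
  also have "\<dots> = (\<integral>\<^sup>+z. ennreal (1 / (fst z)\<^sup>2) * indicator A z \<partial>(lborel \<Otimes>\<^sub>M lborel))"
    unfolding lborel_prod using A(2) by (intro nn_integral_cong) (auto simp: indicator_def)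
  also have "\<dots> = (\<integral>\<^sup>+c. (\<integral>\<^sup>+d. ennreal (1 / c\<^sup>2) * indicator A (c, d) \<partial>lborel) \<partial>lborel)"
    by (subst lborel.nn_integral_fst[symmetric]) simp_all
  finally show ?thesis .
qed

lemma emeasure_lborel_pair:
  fixes A :: "(real \<times> real) set"
  assumes A: "A \<in> sets borel"
  shows "emeasure lborel A = (\<integral>\<^sup>+c. (\<integral>\<^sup>+d. indicator A (c, d) \<partial>lborel) \<partial>lborel)"
proof -
  have A' [measurable]: "A \<in> sets (borel \<Otimes>\<^sub>M borel)" using A by (simp only: borel_prod)
  have "emeasure lborel A = (\<integral>\<^sup>+z. indicator A z \<partial>(lborel \<Otimes>\<^sub>M lborel))"
    using A by (simp add: lborel_prod)
  also have "\<dots> = (\<integral>\<^sup>+c. (\<integral>\<^sup>+d. indicator A (c, d) \<partial>lborel) \<partial>lborel)"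
    by (subst lborel.nn_integral_fst[symmetric]) simp_all
  finally show ?thesis .
qed

lemma pair_null_iff:
  fixes A :: "(real \<times> real) set"
  assumes A: "A \<in> sets borel"
  shows "emeasure lborel A = 0 \<longleftrightarrow> (AE c in lborel. (\<integral>\<^sup>+d. indicator A (c, d) \<partial>lborel) = 0)"
proof -
  have A' [measurable]: "A \<in> sets (borel \<Otimes>\<^sub>M borel)" using A by (simp only: borel_prod)
  show ?thesis unfolding emeasure_lborel_pair[OF A] by (intro nn_integral_0_iff_AE) measurable
qed

lemma aff_haar_null_iff:
  assumes A: "A \<in> sets borel" "A \<subseteq> half_plane"
  shows "emeasure aff_haar A = 0 \<longleftrightarrow> emeasure lborel A = 0"
proof -
  have A' [measurable]: "A \<in> sets (borel \<Otimes>\<^sub>M borel)" using A(1) by (simp only: borel_prod)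
  have "emeasure aff_haar A = 0 \<longleftrightarrow> (AE c in lborel. (\<integral>\<^sup>+d. ennreal (1 / c\<^sup>2) * indicator A (c, d) \<partial>lborel) = 0)"
    unfolding emeasure_aff_haar[OF A] by (intro nn_integral_0_iff_AE) measurable
  also have "\<dots> \<longleftrightarrow> (AE c in lborel. (\<integral>\<^sup>+d. indicator A (c, d) \<partial>lborel) = 0)"
  proof (intro eventually_subst always_eventually allI)
    fix c :: real
    have "(\<integral>\<^sup>+d. ennreal (1 / c\<^sup>2) * indicator A (c, d) \<partial>lborel) = ennreal (1 / c\<^sup>2) * (\<integral>\<^sup>+d. indicator A (c, d) \<partial>lborel)"
      by (intro nn_integral_cmult) measurable
    \<comment> \<open>Since \<open>1 / 0\<close> is 0, the factor 1/c^2 vanishes at c = 0; the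
      section of A there is empty.\<close>
    moreover have "(\<integral>\<^sup>+d. indicator A (c, d) \<partial>lborel) = 0" if "c = 0"
    proof -
      have "indicator A (c, d) = (0::ennreal)" for d using A(2) that by (auto simp: indicator_def)
      then show ?thesis by simp
    qed
    ultimately show "(\<integral>\<^sup>+d. ennreal (1 / c\<^sup>2) * indicator A (c, d) \<partial>lborel) = 0 \<longleftrightarrow> (\<integral>\<^sup>+d. indicator A (c, d) \<partial>lborel) = 0"
      by (cases "c = 0") (auto simp: ennreal_eq_0_iff divide_le_0_iff)
  qed
  finally show ?thesis unfolding pair_null_iff[OF A(1)] .
qed

text \<open>The scale density is positive on a > 0, and the shift law has the Lebesgue null sets.
  Together with \<open>aff_haar_null_iff\<close> this gives absolute continuity; together with
  \<open>open_null_empty\<close> it shows that no proper closed subset of the half-plane carries the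
  law.\<close>

lemma step_law_null_iff:
  assumes A: "A \<in> sets borel" "A \<subseteq> half_plane"
  shows "emeasure step_law A = 0 \<longleftrightarrow> emeasure lborel A = 0"
proof -
  have A' [measurable]: "A \<in> sets (borel \<Otimes>\<^sub>M borel)" using A(1) by (simp only: borel_prod)
  have "emeasure step_law A = (\<integral>\<^sup>+z. indicator A z \<partial>step_law)"
    by (intro nn_integral_indicator[symmetric]) (simp add: sets_step_law)
  also have "\<dots> = (\<integral>\<^sup>+a. (\<integral>\<^sup>+b. indicator A (a, b) \<partial>shift_law) \<partial>scale_law)"
    by (intro nn_integral_step_law) measurable
  also have "\<dots> = (\<integral>\<^sup>+a. ennreal (scale_density a) * (\<integral>\<^sup>+b. indicator A (a, b) \<partial>shift_law) \<partial>lborel)"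
    unfolding scale_law_def by (intro nn_integral_density) measurable
  also have "\<dots> = 0 \<longleftrightarrow> (AE a in lborel. ennreal (scale_density a) * (\<integral>\<^sup>+b. indicator A (a, b) \<partial>shift_law) = 0)"
    by (intro nn_integral_0_iff_AE) measurable
  also have "\<dots> \<longleftrightarrow> (AE c in lborel. (\<integral>\<^sup>+d. indicator A (c, d) \<partial>lborel) = 0)"
  proof (intro eventually_subst always_eventually allI)
    fix c :: real
    have [measurable]: "{d. (c, d) \<in> A} \<in> sets borel"
      using measurable_sets[of "\<lambda>d. (c, d)" borel "borel \<Otimes>\<^sub>M borel" A] by (simp add: vimage_def)
    have i: "indicator A (c, d) = (indicator {d. (c, d) \<in> A} d :: ennreal)" for d by (simp add: indicator_def)
    show "ennreal (scale_density c) * (\<integral>\<^sup>+b. indicator A (c, b) \<partial>shift_law) = 0 \<longleftrightarrow> (\<integral>\<^sup>+d. indicator A (c, d) \<partial>lborel) = 0"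
    proof (cases "0 < c")
      case True
      have "(\<integral>\<^sup>+b. indicator A (c, b) \<partial>shift_law) = 0 \<longleftrightarrow> (\<integral>\<^sup>+d. indicator A (c, d) \<partial>lborel) = 0"
        using shift_law_null_iff[of "{d. (c, d) \<in> A}" 0] unfolding i by simp
      then show ?thesis using scale_density_pos[OF True] by (simp add: ennreal_eq_0_iff)
    next
      case False
      then have "indicator A (c, d) = (0::ennreal)" for d using A(2) by (auto simp: indicator_def)
      then show ?thesis by simp
    qed
  qed
  finally show ?thesis unfolding pair_null_iff[OF A(1)] .
qed

lemma open_null_empty:
  fixes U :: "(real \<times> real) set"
  assumes "open U" "emeasure lborel U = 0"
  shows "U = {}"
proof (rule ccontr)
  assume "U \<noteq> {}"
  then have "\<not> negligible U" using assms(1) by (rule open_not_negligible[rotated])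
  moreover have "U \<in> null_sets lborel" using assms by (intro null_setsI) auto
  ultimately show False by (simp add: negligible_iff_null_sets null_sets_completionI)
qed

lemma left_haar_measure_aff: "left_haar_measure aff aff_topology aff_haar"
  unfolding left_haar_measure_def
proof (intro conjI allI impI ballI)
  show "sets aff_haar = sets (borel_of aff_topology)" by (simp add: sets_aff_haar sets_borel_of_aff)
  have sp: "space aff_haar = half_plane" by (simp add: aff_haar_def space_restrict_space)
  have "half_plane \<noteq> {}" using half_plane_iff[of "(1, 0)"] by force
  then show "emeasure aff_haar (space aff_haar) \<noteq> 0"
    unfolding sp using open_null_empty[OF open_half_plane] aff_haar_null_iff[of half_plane] by auto
next
  fix K assume "compactin aff_topology K"
  then have K: "compact K" "K \<subseteq> half_plane" by (auto simp: aff_topology_eq compactin_subtopology)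
  have Kb: "K \<in> sets borel" using K(1) by (intro borel_compact)
  have [measurable]: "K \<in> sets (borel \<Otimes>\<^sub>M borel)" using Kb by (simp only: borel_prod)
  show "emeasure aff_haar K < \<infinity>"
  proof (cases "K = {}")
    case False
    obtain z where z: "z \<in> K" "\<And>w. w \<in> K \<Longrightarrow> fst z \<le> fst w"
      using continuous_attains_inf[OF K(1) False continuous_on_fst[OF continuous_on_id]] by auto
    then have z0: "0 < fst z" using K(2) by auto
    have "emeasure aff_haar K \<le> (\<integral>\<^sup>+c. (\<integral>\<^sup>+d. ennreal (1 / (fst z)\<^sup>2) * indicator K (c, d) \<partial>lborel) \<partial>lborel)"
      unfolding emeasure_aff_haar[OF Kb K(2)]
    proof (intro nn_integral_mono)
      fix c d :: real
      show "ennreal (1 / c\<^sup>2) * indicator K (c, d) \<le> ennreal (1 / (fst z)\<^sup>2) * indicator K (c, d)"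
      proof (cases "(c, d) \<in> K")
        case True
        then have "fst z \<le> c" using z(2) by force
        then have "1 / c\<^sup>2 \<le> 1 / (fst z)\<^sup>2" using z0 by (intro divide_left_mono power_mono) auto
        then show ?thesis using True by (simp add: ennreal_leI)
      qed simp
    qed
    also have "\<dots> = ennreal (1 / (fst z)\<^sup>2) * emeasure lborel K"
      unfolding emeasure_lborel_pair[OF Kb] by (simp add: nn_integral_cmult)
    also have "\<dots> < \<infinity>" using emeasure_compact_finite[OF K(1)] by (simp add: ennreal_mult_less_top)
    finally show ?thesis .
  qed simp
next
  fix g A assume g: "g \<in> carrier aff" and "A \<in> sets aff_haar"
  then have A: "A \<in> sets borel" "A \<subseteq> half_plane" by (simp_all add: sets_aff_haar sets_restrict_half_plane)
  obtain a b where ab: "g = (a, b)" by (cases g)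
  with g have a: "0 < a" by simp
  let ?gA = "(\<lambda>x. g \<otimes>\<^bsub>aff\<^esub> x) ` A"
  have gA: "(c, d) \<in> ?gA \<longleftrightarrow> (c / a, (d - b) / a) \<in> A" for c d
  proof
    assume "(c / a, (d - b) / a) \<in> A"
    then show "(c, d) \<in> ?gA" using a by (intro image_eqI[of _ _ "(c / a, (d - b) / a)"]) (auto simp: mult_aff ab)
  qed (use a in \<open>auto simp: mult_aff ab\<close>)
  have sub: "?gA \<subseteq> half_plane" using A(2) a by (auto simp: mult_aff ab)
  have A' [measurable]: "A \<in> sets (borel \<Otimes>\<^sub>M borel)" using A(1) by (simp only: borel_prod)
  have "?gA = (\<lambda>z. (fst z / a, (snd z - b) / a)) -` A \<inter> space (borel \<Otimes>\<^sub>M borel)"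
    unfolding set_eq_iff by (simp only: split_paired_all gA vimage_def space_pair_measure) (simp add: gA)
  also have "\<dots> \<in> sets (borel \<Otimes>\<^sub>M borel)" by (rule measurable_sets[OF _ A']) measurable
  finally have gA' [measurable]: "?gA \<in> sets (borel \<Otimes>\<^sub>M borel)" .
  then have gAb: "?gA \<in> sets borel" by (simp only: borel_prod)
  have mem: "(a * c, b + a * d) \<in> ?gA \<longleftrightarrow> (c, d) \<in> A" for c d using a by (simp add: gA)
  have "emeasure aff_haar ?gA = (\<integral>\<^sup>+c. (\<integral>\<^sup>+d. ennreal (1 / c\<^sup>2) * indicator ?gA (c, d) \<partial>lborel) \<partial>lborel)"
    by (rule emeasure_aff_haar[OF gAb sub])
  also have "\<dots> = ennreal \<bar>a\<bar> * (\<integral>\<^sup>+c. (\<integral>\<^sup>+d. ennreal (1 / (0 + a * c)\<^sup>2) * indicator ?gA (0 + a * c, d) \<partial>lborel) \<partial>lborel)"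
    using a by (intro nn_integral_real_affine) auto
  also have "\<dots> = ennreal \<bar>a\<bar> * (\<integral>\<^sup>+c. ennreal \<bar>a\<bar> * (\<integral>\<^sup>+d. ennreal (1 / (0 + a * c)\<^sup>2) * indicator ?gA (0 + a * c, b + a * d) \<partial>lborel) \<partial>lborel)"
    using a by (intro arg_cong2[where f = "(*)"] refl nn_integral_cong nn_integral_real_affine) auto
  also have "\<dots> = (\<integral>\<^sup>+c. (\<integral>\<^sup>+d. ennreal \<bar>a\<bar> * (ennreal \<bar>a\<bar> * (ennreal (1 / (0 + a * c)\<^sup>2) * indicator A (c, d))) \<partial>lborel) \<partial>lborel)"
    by (simp add: nn_integral_cmult indicator_def mem)
  also have "\<dots> = (\<integral>\<^sup>+c. (\<integral>\<^sup>+d. ennreal (1 / c\<^sup>2) * indicator A (c, d) \<partial>lborel) \<partial>lborel)"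
  proof (intro nn_integral_cong)
    fix c d :: real
    have "\<bar>a\<bar> * (\<bar>a\<bar> * (1 / (0 + a * c)\<^sup>2)) = 1 / c\<^sup>2" using a by (simp add: power_mult_distrib power2_eq_square)
    then have "ennreal \<bar>a\<bar> * (ennreal \<bar>a\<bar> * ennreal (1 / (0 + a * c)\<^sup>2)) = ennreal (1 / c\<^sup>2)"
      by (simp only: ennreal_mult[symmetric] abs_ge_zero zero_le_divide_1_iff zero_le_power2 mult_nonneg_nonneg)
    then show "ennreal \<bar>a\<bar> * (ennreal \<bar>a\<bar> * (ennreal (1 / (0 + a * c)\<^sup>2) * indicator A (c, d))) = ennreal (1 / c\<^sup>2) * indicator A (c, d)"
      by (simp only: mult.assoc[symmetric])
  qed
  also have "\<dots> = emeasure aff_haar A" by (rule emeasure_aff_haar[OF A, symmetric])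
  finally show "emeasure aff_haar ?gA = emeasure aff_haar A" .
qed

text \<open>The law on the group has to have the half-plane as its space, whereas the product
  \<open>step_law\<close> lives on the whole plane, with full mass on the half-plane.\<close>

definition aff_law :: "(real \<times> real) measure" where
  "aff_law = restrict_space step_law half_plane"

lemma sets_step_law_borel: "sets step_law = sets borel"
  by (simp only: sets_step_law borel_prod)

lemma sets_aff_law: "sets aff_law = sets (borel_of aff_topology)"
  unfolding aff_law_def sets_borel_of_aff by (intro sets_restrict_space_cong sets_step_law_borel)

lemma emeasure_aff_law: "A \<subseteq> half_plane \<Longrightarrow> emeasure aff_law A = emeasure step_law A"
  unfolding aff_law_def by (intro emeasure_restrict_space) (auto simp: sets_step_law_borel)

lemma measured_group_aff: "measured_group aff aff_topology aff_law"
  unfolding measured_group_def admissible_def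
proof (intro conjI lcsc_group_aff sets_aff_law exI[of _ aff_haar] left_haar_measure_aff)
  have sp: "space aff_law = half_plane" by (simp add: aff_law_def space_restrict_space)
  have "emeasure step_law half_plane = emeasure step_law (space step_law)"
    using AE_step_law_pos by (intro emeasure_eq_AE) (auto simp: sets_step_law_borel)
  then have "emeasure aff_law (space aff_law) = 1"
    unfolding sp by (simp add: emeasure_aff_law step_law.emeasure_space_1[simplified])
  then show "prob_space aff_law" by (rule prob_spaceI)
  show "absolutely_continuous aff_haar aff_law"
    unfolding absolutely_continuous_def
  proof
    fix A assume A: "A \<in> null_sets aff_haar"
    then have "A \<in> sets (restrict_space borel half_plane)" by (auto simp: sets_aff_haar[symmetric])
    then have Ab: "A \<in> sets borel" "A \<subseteq> half_plane" by (simp_all add: sets_restrict_half_plane)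
    have "emeasure step_law A = 0"
      using A aff_haar_null_iff[OF Ab] step_law_null_iff[OF Ab] by auto
    then show "A \<in> null_sets aff_law"
      using A Ab by (intro null_setsI) (auto simp: emeasure_aff_law sets_aff_law sets_borel_of_aff sets_restrict_half_plane)
  qed
  show "\<not> (\<exists>S. closedin aff_topology S \<and> S \<subset> carrier aff \<and> (\<forall>x\<in>S. \<forall>y\<in>S. x \<otimes>\<^bsub>aff\<^esub> y \<in> S) \<and>
            emeasure aff_law (carrier aff - S) = 0)"
  proof
    assume "\<exists>S. closedin aff_topology S \<and> S \<subset> carrier aff \<and> (\<forall>x\<in>S. \<forall>y\<in>S. x \<otimes>\<^bsub>aff\<^esub> y \<in> S) \<and>
            emeasure aff_law (carrier aff - S) = 0"
    then obtain S where S: "closedin aff_topology S" "S \<subset> half_plane" "emeasure aff_law (half_plane - S) = 0"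
      by auto
    have "openin aff_topology (half_plane - S)"
      using S(1) openin_diff[OF openin_topspace S(1)] by (simp add: aff_topology_eq)
    then have o: "open (half_plane - S)"
      using open_half_plane by (simp add: aff_topology_eq openin_open_eq)
    have "emeasure lborel (half_plane - S) = 0"
      using S(3) step_law_null_iff[of "half_plane - S"] o by (simp add: emeasure_aff_law borel_open)
    with o have "half_plane - S = {}" by (rule open_null_empty)
    then show False using S(2) by auto
  qed
qed

lemma aff_action_eq: "aff_action g x = fst g * x + snd g"
  by (simp add: aff_action_def case_prod_beta)

lemma poisson_transform_eq: "poisson_transform aff_action hitting_measure f g = poisson f g"
  by (simp add: poisson_transform_def poisson_def aff_action_eq)

section \<open>Harmonic functions on the group and on the half-plane\<close>

lemma measurable_borel_of_aff:
  "u \<in> borel_measurable (borel_of aff_topology) \<longleftrightarrow> (\<lambda>z. indicator half_plane z * u z) \<in> borel_measurable (borel \<Otimes>\<^sub>M borel)"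
  for u :: "real \<times> real \<Rightarrow> real"
proof -
  have "u \<in> borel_measurable (borel_of aff_topology) \<longleftrightarrow> u \<in> borel_measurable (restrict_space borel half_plane)"
    by (intro arg_cong2[where f = "(\<in>)"] refl measurable_cong_sets sets_borel_of_aff)
  also have "\<dots> \<longleftrightarrow> (\<lambda>z. indicator half_plane z * u z) \<in> borel_measurable borel"
    by (subst borel_measurable_restrict_space_iff) auto
  finally show ?thesis unfolding borel_prod .
qed

lemma half_plane_prod [measurable]: "half_plane \<in> sets (borel \<Otimes>\<^sub>M borel)"
  unfolding borel_prod by (rule half_plane_borel)

interpretation aff_law: prob_space aff_law
  using measured_group_aff by (simp add: measured_group_def)

lemma integral_aff_law:
  fixes f :: "real \<times> real \<Rightarrow> real"
  shows "(\<integral>h. f h \<partial>aff_law) = (\<integral>h. indicator half_plane h * f h \<partial>step_law)"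
  unfolding aff_law_def by (subst integral_restrict_space) (auto simp: sets_step_law_borel)

lemma measurable_aff_law:
  "f \<in> borel_measurable step_law \<Longrightarrow> f \<in> borel_measurable aff_law"
  unfolding aff_law_def by (rule measurable_restrict_space1)

lemma bharm_imp_harmonic:
  assumes v: "bharm M v"
  shows "v \<in> bounded_harmonic aff aff_topology aff_law"
proof -
  note [measurable] = bharmD(1)[OF v]
  have "(\<integral>h. v (g \<otimes>\<^bsub>aff\<^esub> h) \<partial>aff_law) = v g" "integrable aff_law (\<lambda>h. v (g \<otimes>\<^bsub>aff\<^esub> h))"
    if g: "g \<in> half_plane" for g
  proof -
    have m: "(\<lambda>h. v (g \<otimes>\<^bsub>aff\<^esub> h)) \<in> borel_measurable step_law" unfolding mult_aff by measurable
    show "integrable aff_law (\<lambda>h. v (g \<otimes>\<^bsub>aff\<^esub> h))"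
      using bharmD(2)[OF v] by (intro aff_law.integrable_const_bound[where B = M] measurable_aff_law m) auto
    have "(\<integral>h. v (g \<otimes>\<^bsub>aff\<^esub> h) \<partial>aff_law) = (\<integral>h. indicator half_plane h * v (g \<otimes>\<^bsub>aff\<^esub> h) \<partial>step_law)"
      by (rule integral_aff_law)
    also have "\<dots> = (\<integral>h. v (fst g * fst h, fst g * snd h + snd g) \<partial>step_law)"
    proof (rule integral_cong_AE)
      show "AE h in step_law. indicator half_plane h * v (g \<otimes>\<^bsub>aff\<^esub> h) = v (fst g * fst h, fst g * snd h + snd g)"
        using AE_step_law_pos by eventually_elim (simp add: mult_aff)
      show "(\<lambda>h. indicator half_plane h * v (g \<otimes>\<^bsub>aff\<^esub> h)) \<in> borel_measurable step_law"
        unfolding mult_aff by measurable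
    qed measurable
    also have "\<dots> = v g" using bharmD(4)[OF v, of "fst g" "snd g"] g by simp
    finally show "(\<integral>h. v (g \<otimes>\<^bsub>aff\<^esub> h) \<partial>aff_law) = v g" .
  qed
  moreover have "v \<in> borel_measurable (borel_of aff_topology)" unfolding measurable_borel_of_aff by measurable
  moreover have "sup_norm aff v \<le> ennreal M"
    unfolding sup_norm_def using bharmD(2)[OF v] by (intro SUP_least ennreal_leI)
  then have "sup_norm aff v < \<infinity>" by (rule le_less_trans) simp
  ultimately show ?thesis by (simp add: bounded_harmonic_def harmonic_def)
qed

text \<open>Outside the half-plane u is arbitrary, so it is replaced by 0 there; a product of two
  elements stays in the half-plane, so the mean value equation is unaffected.\<close>

lemma harmonic_imp_bharm:
  assumes u: "u \<in> bounded_harmonic aff aff_topology aff_law"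
  shows "\<exists>M. bharm M (\<lambda>z. indicator half_plane z * u z)"
proof -
  let ?v = "\<lambda>z. indicator half_plane z * u z"
  have fin: "sup_norm aff u < \<infinity>" using u by (simp add: bounded_harmonic_def)
  then obtain M where M: "sup_norm aff u = ennreal M" "0 \<le> M" by (cases "sup_norm aff u") auto
  have bound: "\<bar>u g\<bar> \<le> M" if "g \<in> half_plane" for g
  proof -
    have "ennreal \<bar>u g\<bar> \<le> ennreal M"
      unfolding M(1)[symmetric] sup_norm_def using that by (intro SUP_upper) simp
    then show ?thesis using M(2) by (simp add: ennreal_le_iff)
  qed
  have "bharm M ?v"
    unfolding bharm_def
  proof (intro conjI allI impI)
    show "?v \<in> borel_measurable (borel \<Otimes>\<^sub>M borel)"
      using u measurable_borel_of_aff by (simp add: bounded_harmonic_def harmonic_def)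
    show "\<bar>?v z\<bar> \<le> M" for z using bound[of z] M(2) by (auto simp: indicator_def)
    fix a b :: real assume a: "0 < a"
    have "?v (a, b) = (\<integral>h. u ((a, b) \<otimes>\<^bsub>aff\<^esub> h) \<partial>aff_law)"
      using u a by (simp add: bounded_harmonic_def harmonic_def)
    also have "\<dots> = (\<integral>h. indicator half_plane h * u ((a, b) \<otimes>\<^bsub>aff\<^esub> h) \<partial>step_law)"
      by (rule integral_aff_law)
    also have "\<dots> = (\<integral>h. ?v (a * fst h, a * snd h + b) \<partial>step_law)"
      using a by (intro Bochner_Integration.integral_cong refl) (simp add: mult_aff indicator_def zero_less_mult_iff)
    finally show "?v (a, b) = (\<integral>h. ?v (a * fst h, a * snd h + b) \<partial>step_law)" .
  qed
  then show ?thesis by blast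
qed

section \<open>Norms of Poisson integrals and the Poisson boundary\<close>

lemma AE_hitting_iff: "(AE x in hitting_measure. P x) \<longleftrightarrow> (AE x in lborel. P x)"
proof -
  have "null_sets hitting_measure = null_sets lborel"
    using hitting_null_iff by (auto simp: null_sets_def)
  then have "ae_filter hitting_measure = ae_filter lborel"
    by (simp add: ae_filter_def)
  then show ?thesis by (rule arg_cong[where f = "eventually P"])
qed

lemma Linf_norm_le_iff:
  assumes [measurable]: "f \<in> borel_measurable borel" and s: "0 \<le> s"
  shows "Linf_norm hitting_measure f \<le> ennreal s \<longleftrightarrow> (AE x in lborel. \<bar>f x\<bar> \<le> s)"
proof
  assume le: "Linf_norm hitting_measure f \<le> ennreal s"
  have "AE x in hitting_measure. ennreal \<bar>f x\<bar> \<le> Linf_norm hitting_measure f"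
    unfolding Linf_norm_def by (rule esssup_AE)
  then show "AE x in lborel. \<bar>f x\<bar> \<le> s"
    unfolding AE_hitting_iff
    by eventually_elim (use le s order_trans in \<open>fastforce simp: ennreal_le_iff\<close>)
next
  assume "AE x in lborel. \<bar>f x\<bar> \<le> s"
  then have "AE x in hitting_measure. ennreal \<bar>f x\<bar> \<le> ennreal s"
    unfolding AE_hitting_iff by eventually_elim (rule ennreal_leI)
  then show "Linf_norm hitting_measure f \<le> ennreal s"
    unfolding Linf_norm_def by (intro esssup_I) auto
qed

lemma Lp_bounded:
  assumes f: "f \<in> Lp \<infinity> hitting_measure"
  obtains M f' where "bounded_borel M f'" "AE x in lborel. f x = f' x" "f \<in> borel_measurable borel"
proof -
  have fm [measurable]: "f \<in> borel_measurable borel" and fin: "Linf_norm hitting_measure f < \<infinity>"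
    using f by (auto simp: Lp_def)
  obtain M where M: "Linf_norm hitting_measure f = ennreal M" "0 \<le> M"
    using fin by (cases "Linf_norm hitting_measure f") auto
  have AE: "AE x in lborel. \<bar>f x\<bar> \<le> M" using Linf_norm_le_iff[OF fm M(2)] M(1) by simp
  show ?thesis
  proof (rule that[of M "\<lambda>x. if \<bar>f x\<bar> \<le> M then f x else 0"])
    show "bounded_borel M (\<lambda>x. if \<bar>f x\<bar> \<le> M then f x else 0)"
      unfolding bounded_borel_def using M(2) by auto
    show "AE x in lborel. f x = (if \<bar>f x\<bar> \<le> M then f x else 0)" using AE by eventually_elim simp
  qed (rule fm)
qed

lemma poisson_cong_AE:
  assumes [measurable]: "f \<in> borel_measurable borel" "f' \<in> borel_measurable borel"
    and AE: "AE x in lborel. f x = f' x" and g: "g \<in> half_plane"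
  shows "poisson f g = poisson f' g"
proof -
  have "AE x in lborel. f (snd g + fst g * x) = f' (snd g + fst g * x)"
    by (rule AE_borel_affine[of "fst g" "\<lambda>x. f x = f' x"]) (use AE g in auto)
  then show ?thesis
    unfolding poisson_def
    by (intro integral_cong_AE) (auto simp: AE_hitting_iff add.commute)
qed

text \<open>Truncating f at its essential supremum changes it on a null set only and leaves its
  Poisson integral as it is, which gives one inequality; \<open>poisson_norm\<close> gives the
  other.\<close>

lemma sup_norm_poisson:
  assumes f: "bounded_borel M f"
  shows "sup_norm aff (poisson f) = Linf_norm hitting_measure f"
proof (rule antisym)
  note fm = bounded_borelD(1)[OF f]
  note [measurable] = fm
  note M0 = bounded_borelD(3)[OF f]
  have "Linf_norm hitting_measure f \<le> ennreal M"
    using bounded_borelD(2)[OF f] M0 by (subst Linf_norm_le_iff) auto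
  then have "Linf_norm hitting_measure f \<noteq> \<top>" by (auto simp: top_unique)
  then obtain s where s: "Linf_norm hitting_measure f = ennreal s" "0 \<le> s"
    by (cases "Linf_norm hitting_measure f") auto
  have AE: "AE x in lborel. \<bar>f x\<bar> \<le> s" using Linf_norm_le_iff[OF fm s(2)] s(1) by simp
  show "sup_norm aff (poisson f) \<le> Linf_norm hitting_measure f"
    unfolding sup_norm_def s(1)
  proof (rule SUP_least, rule ennreal_leI)
    fix g assume g: "g \<in> carrier aff"
    let ?f = "\<lambda>x. if \<bar>f x\<bar> \<le> s then f x else 0"
    have b: "bounded_borel s ?f" unfolding bounded_borel_def using s(2) by auto
    have "poisson f g = poisson ?f g"
      using AE g by (intro poisson_cong_AE) (auto elim: eventually_mono)
    then show "\<bar>poisson f g\<bar> \<le> s" using bharmD(2)[OF poisson_bharm[OF b]] by simp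
  qed
  have "sup_norm aff (poisson f) \<le> ennreal M"
    unfolding sup_norm_def using bharmD(2)[OF poisson_bharm[OF f]] by (intro SUP_least ennreal_leI)
  then have "sup_norm aff (poisson f) \<noteq> \<top>" by (auto simp: top_unique)
  then obtain t where t: "sup_norm aff (poisson f) = ennreal t" "0 \<le> t"
    by (cases "sup_norm aff (poisson f)") auto
  have "\<bar>poisson f (a, b)\<bar> \<le> t" if "0 < a" for a b
  proof -
    have "ennreal \<bar>poisson f (a, b)\<bar> \<le> ennreal t"
      unfolding t(1)[symmetric] sup_norm_def using that by (intro SUP_upper) simp
    then show ?thesis using t(2) by (simp add: ennreal_le_iff)
  qed
  from poisson_norm[OF f this] show "Linf_norm hitting_measure f \<le> sup_norm aff (poisson f)"
    unfolding t(1) using Linf_norm_le_iff[OF fm t(2)] by simp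
qed

lemma sup_norm_cong: "(\<And>g. g \<in> carrier G \<Longrightarrow> u g = v g) \<Longrightarrow> sup_norm G u = sup_norm G v"
  unfolding sup_norm_def by (intro SUP_cong) auto

lemma standard_borel_hitting: "standard_borel hitting_measure"
proof -
  have "sets (borel_of (euclidean :: real topology)) = sets borel"
    by (simp add: sets_borel_of borel_def)
  then show ?thesis
    unfolding standard_borel_def
    by (intro exI[of _ euclidean]) (simp add: completely_metrizable_space_euclidean second_countable_euclidean)
qed

lemma group_action_aff: "group_action aff UNIV aff_action"
proof -
  have bij: "aff_action g \<in> Bij UNIV" if "g \<in> half_plane" for g
    unfolding Bij_def using that
    by (auto simp: aff_action_eq intro!: bij_betwI[where g = "\<lambda>y. (y - snd g) / fst g"])
  show ?thesis
    unfolding group_action_def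
  proof (intro group_hom.intro group_hom_axioms.intro group_aff group_BijGroup homI)
    show "aff_action x \<in> carrier (BijGroup UNIV)" if "x \<in> carrier aff" for x
      using bij that by (simp add: BijGroup_def)
    fix x y assume "x \<in> carrier aff" "y \<in> carrier aff"
    then show "aff_action (x \<otimes>\<^bsub>aff\<^esub> y) = aff_action x \<otimes>\<^bsub>BijGroup UNIV\<^esub> aff_action y"
      using bij by (auto simp: BijGroup_def compose_def mult_aff aff_action_eq fun_eq_iff algebra_simps)
  qed
qed

lemma borel_action_aff: "borel_action aff aff_topology hitting_measure aff_action"
  unfolding borel_action_def
proof (intro conjI)
  show "group_action aff (space hitting_measure) aff_action" using group_action_aff by simp
  have "(\<lambda>z. z) \<in> borel_of aff_topology \<rightarrow>\<^sub>M borel"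
    using measurable_cong_sets[OF sets_borel_of_aff refl] measurable_restrict_space1[of "\<lambda>z. z" borel borel half_plane]
    by auto
  then have id: "(\<lambda>z. z) \<in> borel_of aff_topology \<rightarrow>\<^sub>M borel \<Otimes>\<^sub>M borel" unfolding borel_prod .
  have [measurable]: "fst \<in> borel_of aff_topology \<rightarrow>\<^sub>M borel" "snd \<in> borel_of aff_topology \<rightarrow>\<^sub>M borel"
    using measurable_compose[OF id measurable_fst] measurable_compose[OF id measurable_snd] by simp_all
  show "(\<lambda>(g, x). aff_action g x) \<in> borel_of aff_topology \<Otimes>\<^sub>M hitting_measure \<rightarrow>\<^sub>M hitting_measure"
    unfolding aff_action_eq case_prod_beta' by measurable
qed

lemma emeasure_translate_aff:
  assumes A [measurable]: "A \<in> sets borel"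
  shows "emeasure (translate aff_action g hitting_measure) A = (\<integral>\<^sup>+x. indicator A (fst g * x + snd g) \<partial>hitting_measure)"
proof -
  have [measurable]: "aff_action g \<in> hitting_measure \<rightarrow>\<^sub>M hitting_measure"
    unfolding aff_action_eq[abs_def] by measurable
  have "emeasure (translate aff_action g hitting_measure) A = (\<integral>\<^sup>+x. indicator A x \<partial>distr hitting_measure hitting_measure (aff_action g))"
    unfolding translate_def by simp
  also have "\<dots> = (\<integral>\<^sup>+x. indicator A (aff_action g x) \<partial>hitting_measure)"
    by (intro nn_integral_distr) auto
  finally show ?thesis by (simp add: aff_action_eq)
qed

lemma emeasure_translate_poisson:
  assumes A [measurable]: "A \<in> sets borel"
  shows "emeasure (translate aff_action g hitting_measure) A = ennreal (poisson (indicator A) g)"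
proof -
  have "(\<integral>\<^sup>+x. ennreal (indicator A (fst g * x + snd g)) \<partial>hitting_measure)
      = ennreal (\<integral>x. indicator A (fst g * x + snd g) \<partial>hitting_measure)"
    by (intro nn_integral_eq_integral hitting.integrable_const_bound[where B = 1]) auto
  then show ?thesis unfolding emeasure_translate_aff[OF A] poisson_def by (simp add: ennreal_indicator)
qed

lemma stationary_space_aff: "stationary_space aff aff_topology aff_law hitting_measure aff_action"
  unfolding stationary_space_def
proof (intro conjI standard_borel_hitting borel_action_aff ballI)
  show "prob_space hitting_measure" by (rule hitting.prob_space_axioms)
  fix A assume "A \<in> sets hitting_measure"
  then have A [measurable]: "A \<in> sets borel" by simp
  let ?F = "\<lambda>g. \<integral>\<^sup>+x. indicator A (fst g * x + snd g) \<partial>hitting_measure"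
  have "(\<integral>\<^sup>+g. emeasure (translate aff_action g hitting_measure) A \<partial>aff_law) = (\<integral>\<^sup>+g. ?F g * indicator half_plane g \<partial>step_law)"
    unfolding emeasure_translate_aff[OF A] aff_law_def
    by (intro nn_integral_restrict_space) (simp add: sets_step_law_borel)
  also have "\<dots> = (\<integral>\<^sup>+g. ?F g \<partial>step_law)"
    using AE_step_law_pos by (intro nn_integral_cong_AE) (auto elim: eventually_mono)
  also have "\<dots> = (\<integral>\<^sup>+x. indicator A x \<partial>hitting_measure)"
    by (intro hitting_stationary[symmetric]) measurable
  finally show "(\<integral>\<^sup>+g. emeasure (translate aff_action g hitting_measure) A \<partial>aff_law) = emeasure hitting_measure A"
    by simp
qed

lemma poisson_boundary_aff: "poisson_boundary aff aff_topology aff_law hitting_measure aff_action"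
  unfolding poisson_boundary_def poisson_transform_eq[abs_def]
proof (intro conjI measured_group_aff stationary_space_aff ballI)
  fix f assume "f \<in> Lp \<infinity> hitting_measure"
  then obtain M f' where f': "bounded_borel M f'" "AE x in lborel. f x = f' x" and fm: "f \<in> borel_measurable borel"
    by (rule Lp_bounded)
  \<comment> \<open>An element of \<open>Lp \<infinity>\<close> may be unbounded on a null set, so
    every property is transferred from a bounded version with the same Poisson integral on the
    group.\<close>
  have eq: "poisson f g = poisson f' g" if "g \<in> half_plane" for g
    using poisson_cong_AE[OF fm bounded_borelD(1)[OF f'(1)] f'(2) that] .
  have h: "poisson f' \<in> bounded_harmonic aff aff_topology aff_law"
    by (rule bharm_imp_harmonic[OF poisson_bharm[OF f'(1)]])
  have "(\<lambda>z. indicator half_plane z * poisson f z) = (\<lambda>z. indicator half_plane z * poisson f' z)"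
    using eq by (auto simp: indicator_def fun_eq_iff)
  then have m: "poisson f \<in> borel_measurable (borel_of aff_topology)"
    using h unfolding bounded_harmonic_def harmonic_def measurable_borel_of_aff by simp
  have "g \<otimes>\<^bsub>aff\<^esub> h \<in> half_plane" if "g \<in> half_plane" "h \<in> half_plane" for g h
    using that by (simp add: mult_aff)
  then have eq': "poisson f (g \<otimes>\<^bsub>aff\<^esub> h) = poisson f' (g \<otimes>\<^bsub>aff\<^esub> h)" if "g \<in> half_plane" "h \<in> space aff_law" for g h
    using that eq by (simp add: aff_law_def space_restrict_space)
  have "integrable aff_law (\<lambda>h. poisson f (g \<otimes>\<^bsub>aff\<^esub> h)) \<and> (\<integral>h. poisson f (g \<otimes>\<^bsub>aff\<^esub> h) \<partial>aff_law) = poisson f g"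
    if g: "g \<in> half_plane" for g
    using h g eq'[OF g] eq[OF g] unfolding bounded_harmonic_def harmonic_def
    by (simp cong: Bochner_Integration.integrable_cong Bochner_Integration.integral_cong)
  moreover have "sup_norm aff (poisson f) = sup_norm aff (poisson f')"
    by (rule sup_norm_cong) (simp add: eq)
  ultimately show "poisson f \<in> bounded_harmonic aff aff_topology aff_law"
    using h m by (simp add: bounded_harmonic_def harmonic_def)
next
  fix f1 f2 assume "f1 \<in> Lp \<infinity> hitting_measure" "f2 \<in> Lp \<infinity> hitting_measure"
  then obtain M1 f1' M2 f2' where
    f1: "bounded_borel M1 f1'" "AE x in lborel. f1 x = f1' x" "f1 \<in> borel_measurable borel" and
    f2: "bounded_borel M2 f2'" "AE x in lborel. f2 x = f2' x" "f2 \<in> borel_measurable borel"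
    by (metis Lp_bounded)
  note [measurable] = f1(3) f2(3) bounded_borelD(1)[OF f1(1)] bounded_borelD(1)[OF f2(1)]
  let ?d = "\<lambda>x. f1' x - f2' x"
  have d: "bounded_borel (M1 + M2) ?d"
    using f1(1) f2(1) unfolding bounded_borel_def by (auto intro: order_trans[OF abs_triangle_ineq4] add_mono)
  have "poisson f1 g - poisson f2 g = poisson ?d g" if g: "g \<in> half_plane" for g
  proof -
    have "poisson f1 g - poisson f2 g = poisson f1' g - poisson f2' g"
      using poisson_cong_AE[OF f1(3) _ f1(2) g] poisson_cong_AE[OF f2(3) _ f2(2) g] by simp
    also have "\<dots> = poisson ?d g"
      unfolding poisson_def
      by (intro Bochner_Integration.integral_diff[symmetric] bounded_borel_hitting[OF bounded_borel_affine[OF f1(1)]]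
          bounded_borel_hitting[OF bounded_borel_affine[OF f2(1)]])
    finally show ?thesis .
  qed
  then have "sup_norm aff (\<lambda>g. poisson f1 g - poisson f2 g) = sup_norm aff (poisson ?d)"
    by (intro sup_norm_cong) simp
  also have "\<dots> = Linf_norm hitting_measure ?d" by (rule sup_norm_poisson[OF d])
  also have "\<dots> = Linf_norm hitting_measure (\<lambda>x. f1 x - f2 x)"
    unfolding Linf_norm_def
    by (intro esssup_AE_cong) (use f1(2) f2(2) in \<open>auto simp: AE_hitting_iff elim: eventually_elim2\<close>)
  finally show "sup_norm aff (\<lambda>g. poisson f1 g - poisson f2 g) = Linf_norm hitting_measure (\<lambda>x. f1 x - f2 x)" .
next
  fix u assume u: "u \<in> bounded_harmonic aff aff_topology aff_law"
  from harmonic_imp_bharm[OF this] obtain M where "bharm M (\<lambda>z. indicator half_plane z * u z)" by blast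
  from bharm_representation[OF this] obtain f where f: "bounded_borel M f"
    "\<And>a b. 0 < a \<Longrightarrow> indicator half_plane (a, b) * u (a, b) = poisson f (a, b)" by blast
  show "\<exists>f\<in>Lp \<infinity> hitting_measure. \<forall>g\<in>carrier aff. poisson f g = u g"
  proof (intro bexI[of _ f] ballI)
    fix g assume "g \<in> carrier aff"
    then show "poisson f g = u g" using f(2)[of "fst g" "snd g"] by simp
  next
    have "Linf_norm hitting_measure f \<le> ennreal M"
      using bounded_borelD[OF f(1)] by (subst Linf_norm_le_iff) auto
    then have "Linf_norm hitting_measure f < \<top>" by (rule le_less_trans) simp
    then show "f \<in> Lp \<infinity> hitting_measure" using bounded_borelD(1)[OF f(1)] by (simp add: Lp_def)
  qed
qed

lemma emeasure_hitting_eq: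
  assumes "B \<in> sets borel" "\<And>x. \<phi> x = indicator B x"
  shows "emeasure hitting_measure B = (\<integral>\<^sup>+x. \<phi> x \<partial>hitting_measure)"
  using assms by simp

lemma translate_null_iff:
  assumes A [measurable]: "A \<in> sets borel" and g: "g \<in> half_plane"
  shows "emeasure (translate aff_action g hitting_measure) A = 0 \<longleftrightarrow> emeasure hitting_measure A = 0"
proof -
  let ?B = "{x. fst g * x + snd g \<in> A}"
  have B: "?B \<in> sets borel"
    using measurable_sets[of "\<lambda>x. fst g * x + snd g" borel borel A] by (simp add: vimage_def)
  have scaled: "emeasure lborel A = ennreal \<bar>fst g\<bar> * emeasure lborel ?B"
  proof -
    have "emeasure lborel A = (\<integral>\<^sup>+x. indicator A x \<partial>lborel)" by simp
    also have "\<dots> = ennreal \<bar>fst g\<bar> * (\<integral>\<^sup>+x. indicator A (snd g + fst g * x) \<partial>lborel)"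
      using g by (intro nn_integral_real_affine) auto
    also have "(\<integral>\<^sup>+x. indicator A (snd g + fst g * x) \<partial>lborel) = (\<integral>\<^sup>+x. indicator ?B x \<partial>lborel)"
      by (intro nn_integral_cong) (simp add: indicator_def add.commute)
    finally show ?thesis using B by simp
  qed
  have "emeasure (translate aff_action g hitting_measure) A = emeasure hitting_measure ?B"
    unfolding emeasure_translate_aff[OF A]
    by (rule emeasure_hitting_eq[OF B, symmetric]) (simp add: indicator_def)
  also have "\<dots> = 0 \<longleftrightarrow> emeasure lborel ?B = 0" by (rule hitting_null_iff[OF B])
  also have "\<dots> \<longleftrightarrow> emeasure lborel A = 0" unfolding scaled using g by (simp add: ennreal_eq_0_iff)
  also have "\<dots> \<longleftrightarrow> emeasure hitting_measure A = 0" by (rule hitting_null_iff[OF A, symmetric])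
  finally show ?thesis .
qed

lemma quasi_invariant_aff: "quasi_invariant aff aff_action hitting_measure"
  unfolding quasi_invariant_def absolutely_continuous_def
  using translate_null_iff by (auto simp: null_sets_def translate_def)

section \<open>Unbounded Radon-Nikodym derivatives and the failure of Harnack's inequality\<close>

lemma translate_density:
  assumes "g \<in> half_plane"
  shows "density hitting_measure (RN_deriv hitting_measure (translate aff_action g hitting_measure)) = translate aff_action g hitting_measure"
  using quasi_invariant_aff assms
  by (intro hitting.density_RN_deriv) (auto simp: quasi_invariant_def translate_def)

lemma RN_norm_bound:
  assumes g: "g \<in> half_plane" and A [measurable]: "A \<in> sets borel"
  shows "emeasure (translate aff_action g hitting_measure) A \<le> RN_norm aff_action hitting_measure g * emeasure hitting_measure A"
proof -
  let ?D = "RN_deriv hitting_measure (translate aff_action g hitting_measure)"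
  have [measurable]: "?D \<in> borel_measurable hitting_measure" by (rule borel_measurable_RN_deriv)
  have "emeasure (translate aff_action g hitting_measure) A = (\<integral>\<^sup>+x. ?D x * indicator A x \<partial>hitting_measure)"
    by (subst translate_density[OF g, symmetric], subst emeasure_density) auto
  also have "\<dots> \<le> (\<integral>\<^sup>+x. RN_norm aff_action hitting_measure g * indicator A x \<partial>hitting_measure)"
  proof (rule nn_integral_mono_AE)
    have "AE x in hitting_measure. ?D x \<le> RN_norm aff_action hitting_measure g"
      unfolding RN_norm_def by (rule esssup_AE)
    then show "AE x in hitting_measure. ?D x * indicator A x \<le> RN_norm aff_action hitting_measure g * indicator A x"
      by eventually_elim (rule mult_right_mono, auto)
  qed
  also have "\<dots> = RN_norm aff_action hitting_measure g * emeasure hitting_measure A"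
    by (simp add: nn_integral_cmult_indicator)
  finally show ?thesis .
qed

lemma nn_integral_translates:
  fixes A :: "real set"
  assumes [measurable]: "A \<in> sets borel"
  shows "(\<integral>\<^sup>+t. (\<integral>\<^sup>+x. indicator A (x - t) \<partial>hitting_measure) \<partial>lborel) = emeasure lborel A"
proof -
  have "(\<integral>\<^sup>+t. (\<integral>\<^sup>+x. indicator A (x - t) \<partial>hitting_measure) \<partial>lborel)
      = (\<integral>\<^sup>+x. (\<integral>\<^sup>+t. indicator A (x - t) \<partial>lborel) \<partial>hitting_measure)"
    by (intro lborel_hitting.Fubini'[symmetric]) measurable
  also have "\<dots> = (\<integral>\<^sup>+x. emeasure lborel A \<partial>hitting_measure)"
  proof (rule nn_integral_cong)
    fix x :: real
    show "(\<integral>\<^sup>+t. indicator A (x - t) \<partial>lborel) = emeasure lborel A"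
      using nn_integral_real_affine[of "indicator A" "-1" x] by simp
  qed
  finally show ?thesis using hitting.emeasure_space_1 by simp
qed

text \<open>By Fubini the measures of the translates have as Lebesgue integral over t the length of
  the interval, here 2 * 8^-k. With the weights 6^k the sum over k is still finite, of ratio 3/4, so
  the weighted measures are bounded for almost every t. The base 6 is chosen between 8 and 4, since
  8^-k to the power 2/3 is 4^-k.\<close>

lemma AE_translates_small:
  "AE t in lborel. \<exists>C<\<infinity>. \<forall>k::nat. 6 ^ k * (\<integral>\<^sup>+x. indicator {-((1/8)^k)<..<(1/8)^k} (x - t) \<partial>hitting_measure) \<le> C"
proof -
  let ?m = "\<lambda>k t. (\<integral>\<^sup>+x. indicator {-((1/8)^k)<..<(1/8)^k} (x - t) \<partial>hitting_measure) :: ennreal"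
  have "(\<integral>\<^sup>+t. (\<Sum>k. 6 ^ k * ?m k t) \<partial>lborel) = (\<Sum>k. (\<integral>\<^sup>+t. 6 ^ k * ?m k t \<partial>lborel))"
    by (intro nn_integral_suminf) measurable
  also have "\<dots> = (\<Sum>k. ennreal (2 * (3/4) ^ k))"
  proof (rule suminf_cong)
    fix k
    have "(\<integral>\<^sup>+t. 6 ^ k * ?m k t \<partial>lborel) = 6 ^ k * emeasure lborel {-((1/8)^k)<..<(1/8::real)^k}"
      by (subst nn_integral_cmult) (auto simp: nn_integral_translates)
    also have "emeasure lborel {-((1/8)^k)<..<(1/8::real)^k} = ennreal (2 * (1/8)^k)"
      by (subst emeasure_lborel_Ioo) auto
    also have "6 ^ k * ennreal (2 * (1/8)^k) = ennreal (6 ^ k) * ennreal (2 * (1/8)^k)"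
      by (simp add: ennreal_power[symmetric])
    also have "ennreal (6 ^ k) * ennreal (2 * (1/8)^k) = ennreal (2 * (3/4) ^ k)"
      by (subst ennreal_mult[symmetric]) (auto simp: power_mult_distrib[symmetric] ac_simps)
    finally show "(\<integral>\<^sup>+t. 6 ^ k * ?m k t \<partial>lborel) = ennreal (2 * (3/4) ^ k)" .
  qed
  also have "\<dots> \<noteq> \<infinity>"
    by (subst suminf_ennreal2) (auto intro!: summable_mult summable_geometric)
  finally have "AE t in lborel. (\<Sum>k. 6 ^ k * ?m k t) \<noteq> \<infinity>"
    by (intro nn_integral_PInf_AE) measurable
  then show ?thesis
  proof eventually_elim
    fix t assume fin: "(\<Sum>k. 6 ^ k * ?m k t) \<noteq> \<infinity>"
    have "6 ^ k * ?m k t \<le> (\<Sum>k. 6 ^ k * ?m k t)" for k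
      using sum_le_suminf[of "\<lambda>k. 6 ^ k * ?m k t" "{k}"] by simp
    with fin show "\<exists>C<\<infinity>. \<forall>k::nat. 6 ^ k * ?m k t \<le> C"
      by (intro exI[of _ "\<Sum>k. 6 ^ k * ?m k t"]) (simp add: less_top)
  qed
qed

text \<open>Near 0 the measure of an interval of length \<open>e\<close> is at least of order \<open>e\<close> to the power 2/3,
  whereas its translate by almost every \<open>t\<close> has much smaller measure.\<close>

lemma RN_norm_infinite_of_small_translates:
  assumes C: "C < \<infinity>" "\<And>k::nat. 6 ^ k * (\<integral>\<^sup>+x. indicator {-((1/8)^k)<..<(1/8)^k} (x - t) \<partial>hitting_measure) \<le> C"
  shows "RN_norm aff_action hitting_measure (1, t) = \<infinity>"
proof (rule ccontr)
  assume "RN_norm aff_action hitting_measure (1, t) \<noteq> \<infinity>"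
  then obtain R where R: "RN_norm aff_action hitting_measure (1, t) = ennreal R" "0 \<le> R"
    by (cases "RN_norm aff_action hitting_measure (1, t)") auto
  obtain D where D: "C = ennreal D" "0 \<le> D" using C(1) by (cases C) auto
  \<comment> \<open>On \<open>?A\<close> the translate by (1, t) has the mass \<mu>(-e,e), at least
    4^-k/16, while \<mu> itself has at most C 6^-k. A finite bound R for the derivative would bound
    (6/4)^k.\<close>
  have bound: "(3/2) ^ k \<le> 16 * R * D" for k :: nat
  proof -
    let ?e = "(1/8::real) ^ k"
    let ?A = "{- ?e + t<..<?e + t}"
    have "ennreal ((1/4) ^ k / 16) \<le> emeasure hitting_measure {- ?e<..<?e}"
    proof -
      have "?e powr (2/3) = (1/4) ^ k"
      proof -
        have "(1/8::real) powr (2/3) = ((1/2) powr 3) powr (2/3)" by (simp add: power_divide)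
        also have "\<dots> = (1/2) powr 2" by (subst powr_powr) simp
        also have "\<dots> = 1/4" by (simp add: power2_eq_square)
        finally have e: "(1/8::real) powr (2/3) = 1/4" .
        have "?e powr (2/3) = ((1/8) powr (real k)) powr (2/3)" by (simp add: powr_realpow)
        also have "\<dots> = ((1/8) powr (2/3)) powr (real k)" by (simp add: powr_powr mult.commute)
        also have "\<dots> = (1/4) ^ k" unfolding e by (simp add: powr_realpow)
        finally show ?thesis .
      qed
      then show ?thesis using hitting_near_0[of ?e] by (simp add: power_le_one)
    qed
    also have "emeasure hitting_measure {- ?e<..<?e} = emeasure (translate aff_action (1, t) hitting_measure) ?A"
    proof (subst emeasure_translate_aff)
      show "emeasure hitting_measure {- ?e<..<?e} = (\<integral>\<^sup>+x. indicator ?A (fst (1, t) * x + snd (1, t)) \<partial>hitting_measure)"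
        by (rule emeasure_hitting_eq) (auto simp: indicator_def)
    qed simp
    also have "\<dots> \<le> ennreal R * emeasure hitting_measure ?A"
      unfolding R(1)[symmetric] by (intro RN_norm_bound) auto
    also have "emeasure hitting_measure ?A = (\<integral>\<^sup>+x. indicator {- ?e<..<?e} (x - t) \<partial>hitting_measure)"
      by (rule emeasure_hitting_eq) (auto simp: indicator_def)
    finally have "6 ^ k * ennreal ((1/4) ^ k / 16) \<le> 6 ^ k * (ennreal R * (\<integral>\<^sup>+x. indicator {- ?e<..<?e} (x - t) \<partial>hitting_measure))"
      by (rule mult_left_mono) simp
    also have "\<dots> = ennreal R * (6 ^ k * (\<integral>\<^sup>+x. indicator {- ?e<..<?e} (x - t) \<partial>hitting_measure))"
      by (simp add: ac_simps)
    also have "\<dots> \<le> ennreal R * ennreal D"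
      unfolding D(1)[symmetric] by (intro mult_left_mono C(2)) simp
    finally have "ennreal (6 ^ k) * ennreal ((1/4) ^ k / 16) \<le> ennreal R * ennreal D"
      by (simp add: ennreal_power[symmetric])
    moreover have "ennreal (6 ^ k * ((1/4) ^ k / 16)) = ennreal (6 ^ k) * ennreal ((1/4) ^ k / 16)"
      by (rule ennreal_mult) auto
    ultimately have "ennreal (6 ^ k * ((1/4) ^ k / 16)) \<le> ennreal (R * D)"
      using ennreal_mult[OF R(2) D(2)] by simp
    then have "6 ^ k * ((1/4) ^ k / 16) \<le> R * D"
      using R D by (subst (asm) ennreal_le_iff) auto
    moreover have "(6::real) ^ k * ((1/4) ^ k / 16) = (3/2) ^ k / 16"
      by (simp add: power_mult_distrib[symmetric])
    ultimately show ?thesis by simp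
  qed
  obtain k where "16 * R * D < (3/2) ^ k" using real_arch_pow[of "3/2" "16 * R * D"] by auto
  then show False using bound[of k] by simp
qed

text \<open>Almost every t qualifies, so arbitrarily small t > 0 do, and (1, t) tends to the
  identity as t tends to 0.\<close>

lemma RN_norm_infinite_near_one:
  assumes U: "openin aff_topology U" "\<one>\<^bsub>aff\<^esub> \<in> U"
  shows "\<exists>g\<in>U. RN_norm aff_action hitting_measure g = \<infinity>"
proof -
  have "open U" using U(1) open_half_plane by (simp add: aff_topology_eq openin_open_eq)
  then obtain d where d: "0 < d" "ball (1, 0) d \<subseteq> U" using U(2) by (auto simp: open_contains_ball one_aff)
  have nonnull: "\<not> (AE t in lborel. t \<notin> {0<..<d})"
  proof
    assume "AE t in lborel. t \<notin> {0<..<d}"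
    then have "{0<..<d} \<in> null_sets lborel" by (subst AE_iff_null_sets) auto
    then have "emeasure lborel {0<..<d} = 0" by (rule null_setsD1)
    then show False using d(1) by simp
  qed
  have "\<exists>t. t \<in> {0<..<d} \<and> (\<exists>C<\<infinity>. \<forall>k::nat. 6 ^ k * (\<integral>\<^sup>+x. indicator {-((1/8)^k)<..<(1/8)^k} (x - t) \<partial>hitting_measure) \<le> C)"
  proof (rule ccontr)
    assume none: "\<not> ?thesis"
    have "AE t in lborel. t \<notin> {0<..<d}"
      using AE_translates_small by eventually_elim (use none in blast)
    then show False using nonnull by simp
  qed
  then obtain t C where t: "t \<in> {0<..<d}" "C < \<infinity>"
    "\<And>k::nat. 6 ^ k * (\<integral>\<^sup>+x. indicator {-((1/8)^k)<..<(1/8)^k} (x - t) \<partial>hitting_measure) \<le> C" by blast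
  have "(1, t) \<in> U" using d(2) t(1) by (auto simp: dist_Pair_Pair dist_real_def subset_iff)
  then show ?thesis using RN_norm_infinite_of_small_translates[OF t(2,3)] by blast
qed

text \<open>The supremum of the translated measures of A is the sup norm of the Poisson transform of
  its indicator. By the isometry this is the essential supremum of the indicator, which is 1 because
  A is not null.\<close>

lemma SAT_aff: "SAT aff aff_action hitting_measure"
  unfolding SAT_def
proof (intro conjI quasi_invariant_aff ballI impI)
  fix A assume "A \<in> sets hitting_measure" and pos: "0 < emeasure hitting_measure A"
  then have A [measurable]: "A \<in> sets borel" by simp
  have b: "bounded_borel 1 (indicator A)" by (simp add: bounded_borel_def)
  have "(SUP g\<in>carrier aff. emeasure (translate aff_action g hitting_measure) A) = sup_norm aff (poisson (indicator A))"
    unfolding sup_norm_def emeasure_translate_poisson[OF A]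
    by (intro SUP_cong refl) (simp add: poisson_def integral_nonneg_AE)
  also have "\<dots> = Linf_norm hitting_measure (indicator A)" by (rule sup_norm_poisson[OF b])
  also have "\<dots> = 1"
  proof (rule antisym)
    have "Linf_norm hitting_measure (indicator A) \<le> ennreal 1" by (subst Linf_norm_le_iff) auto
    then show "Linf_norm hitting_measure (indicator A) \<le> 1" by simp
    show "1 \<le> Linf_norm hitting_measure (indicator A)"
    proof (rule ccontr)
      assume "\<not> 1 \<le> Linf_norm hitting_measure (indicator A)"
      then have lt: "Linf_norm hitting_measure (indicator A) < 1" by simp
      have "AE x in hitting_measure. ennreal \<bar>indicator A x\<bar> \<le> Linf_norm hitting_measure (indicator A)"
        unfolding Linf_norm_def by (rule esssup_AE)
      then have "AE x in hitting_measure. x \<notin> A"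
        by eventually_elim (use lt in \<open>auto simp: indicator_def split: if_splits\<close>)
      then have "emeasure hitting_measure A = 0" by (subst (asm) AE_iff_measurable[OF _ refl]) auto
      then show False using pos by simp
    qed
  qed
  finally show "(SUP g\<in>carrier aff. emeasure (translate aff_action g hitting_measure) A) = 1" .
qed

text \<open>The set B on which the derivative exceeds C has positive measure. The Poisson transform
  of its indicator, divided by \<mu>(B), is harmonic, equals 1 at the identity and is at least C at
  g; quasi-invariance makes it positive everywhere.\<close>

lemma harmonic_majorant_infinite:
  assumes g: "g \<in> half_plane" and inf: "RN_norm aff_action hitting_measure g = \<infinity>"
  shows "harmonic_majorant aff aff_topology aff_law g = \<infinity>"
proof -
  let ?D = "RN_deriv hitting_measure (translate aff_action g hitting_measure)"
  have [measurable]: "?D \<in> borel_measurable hitting_measure" by (rule borel_measurable_RN_deriv)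
  have "ennreal C \<le> harmonic_majorant aff aff_topology aff_law g" if C0: "0 \<le> C" for C :: real
  proof -
    define B where "B = {x \<in> space hitting_measure. ennreal C < ?D x}"
    have "B \<in> sets hitting_measure" unfolding B_def by measurable
    then have B [measurable]: "B \<in> sets borel" by simp
    have "emeasure hitting_measure B > 0"
      unfolding B_def using inf by (intro esssup_pos_measure) (auto simp: RN_norm_def)
    then have m: "0 < hitting.prob B" by (simp add: hitting.emeasure_eq_measure)
    have b: "bounded_borel 1 (indicator B)" by (simp add: bounded_borel_def)
    have P0: "0 \<le> poisson (indicator B) h" for h by (simp add: poisson_def integral_nonneg_AE)
    have Ppos: "0 < poisson (indicator B) h" if "h \<in> half_plane" for h
      using translate_null_iff[OF B that] m P0[of h] unfolding emeasure_translate_poisson[OF B]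
      by (simp add: hitting.emeasure_eq_measure ennreal_eq_0_iff)
    define u where "u h = poisson (indicator B) h / hitting.prob B" for h
    have "u \<in> positive_harmonic aff aff_topology aff_law"
    proof -
      have "harmonic aff aff_topology aff_law (poisson (indicator B))"
        using bharm_imp_harmonic[OF poisson_bharm[OF b]] by (simp add: bounded_harmonic_def)
      then have "harmonic aff aff_topology aff_law u" unfolding u_def harmonic_def by auto
      moreover have "u \<one>\<^bsub>aff\<^esub> = 1" using m by (simp add: u_def poisson_def one_aff)
      ultimately show ?thesis using Ppos m by (simp add: positive_harmonic_def u_def)
    qed
    moreover have "ennreal C \<le> ennreal (u g)"
    proof (rule ennreal_leI)
      have "ennreal C * emeasure hitting_measure B = (\<integral>\<^sup>+x. ennreal C * indicator B x \<partial>hitting_measure)"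
        by (simp add: nn_integral_cmult_indicator)
      also have "\<dots> \<le> (\<integral>\<^sup>+x. ?D x * indicator B x \<partial>hitting_measure)"
        by (intro nn_integral_mono) (auto simp: B_def indicator_def intro: less_imp_le)
      also have "\<dots> = emeasure (translate aff_action g hitting_measure) B"
        by (subst (2) translate_density[OF g, symmetric], subst emeasure_density) auto
      finally have "ennreal (C * hitting.prob B) \<le> ennreal (poisson (indicator B) g)"
        unfolding emeasure_translate_poisson[OF B] hitting.emeasure_eq_measure using C0 by (simp add: ennreal_mult)
      then have "C * hitting.prob B \<le> poisson (indicator B) g" using P0 by (subst (asm) ennreal_le_iff) auto
      then show "C \<le> u g" unfolding u_def using m by (simp add: pos_le_divide_eq)
    qed
    ultimately show ?thesis
      unfolding harmonic_majorant_def by (intro SUP_upper2[of u])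
  qed
  note unbounded = this
  show ?thesis
  proof (rule ccontr)
    assume "harmonic_majorant aff aff_topology aff_law g \<noteq> \<infinity>"
    then obtain r where "harmonic_majorant aff aff_topology aff_law g = ennreal r" "0 \<le> r"
      by (cases "harmonic_majorant aff aff_topology aff_law g") auto
    then show False using unbounded[of "r + 1"] by simp
  qed
qed

theorem theorem1p3:
  shows "(\<forall>(G :: ('g, 'm) monoid_scheme) T \<theta> \<eta> f (p :: ennreal).
            measured_group G T \<theta> \<and> left_haar_measure G T \<eta> \<and>
            1 < p \<and> p \<le> \<infinity> \<and> f \<in> Lp_compact p T \<eta> \<and> (AE x in \<eta>. 0 \<le> f x) \<and>
            \<theta> = density \<eta> (\<lambda>x. ennreal (f x)) \<longrightarrow>
            harnack_inequality G T \<theta>)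
       \<and> (\<exists>(\<theta> :: (real \<times> real) measure) (\<mu> :: real measure).
            measured_group aff aff_topology \<theta> \<and>
            sets \<mu> = sets borel \<and> prob_space \<mu> \<and>
            poisson_boundary aff aff_topology \<theta> \<mu> aff_action \<and>
            (\<forall>U. openin aff_topology U \<and> \<one>\<^bsub>aff\<^esub> \<in> U \<longrightarrow>
                 (\<exists>g\<in>U. RN_norm aff_action \<mu> g = \<infinity>)) \<and>
            SAT aff aff_action \<mu> \<and>
            \<not> SAT_star aff aff_action \<mu> \<and>
            (\<exists>g\<in>carrier aff. harmonic_majorant aff aff_topology \<theta> g = \<infinity>))"
proof (intro conjI allI impI exI[of _ aff_law] exI[of _ hitting_measure])
  fix G :: "('g, 'm) monoid_scheme" and T \<theta> \<eta> f and p :: ennreal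
  assume "measured_group G T \<theta> \<and> left_haar_measure G T \<eta> \<and>
    1 < p \<and> p \<le> \<infinity> \<and> f \<in> Lp_compact p T \<eta> \<and> (AE x in \<eta>. 0 \<le> f x) \<and> \<theta> = density \<eta> (\<lambda>x. ennreal (f x))"
  then show "harnack_inequality G T \<theta>" by (elim conjE) (rule harnack_compact_Lp)
next
  have "openin aff_topology (carrier aff)" "\<one>\<^bsub>aff\<^esub> \<in> carrier aff"
    by (simp_all add: aff_topology_eq one_aff)
  then obtain g where g: "g \<in> carrier aff" "RN_norm aff_action hitting_measure g = \<infinity>"
    using RN_norm_infinite_near_one by blast
  show "\<not> SAT_star aff aff_action hitting_measure"
  proof
    assume "SAT_star aff aff_action hitting_measure"
    then have "RN_norm aff_action hitting_measure g < \<infinity>" using g(1) unfolding SAT_star_def by blast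
    then show False using g(2) by simp
  qed
  have "harmonic_majorant aff aff_topology aff_law g = \<infinity>"
    using g by (intro harmonic_majorant_infinite) simp_all
  with g(1) show "\<exists>g\<in>carrier aff. harmonic_majorant aff aff_topology aff_law g = \<infinity>" by (rule bexI[rotated])
qed (use measured_group_aff hitting.prob_space_axioms poisson_boundary_aff RN_norm_infinite_near_one SAT_aff in auto)

end
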